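(* (a) Let $\mathfrak g=\mathfrak g_A$ be a Kac-Moody algebra of rank $2$ with $I=\{1,2\}$ such that $a_{21}\le-2$. Let $a_1,a_2\in\mathbb C$ and $b_{12}:=a_{21}a_1a_2$. Then the assignments $u_1\mapsto e_1$, $u_2\mapsto e_2+b_{12}f_1$ define an injective homomorphism of Lie algebras $\mathfrak g^{(\mathbf b)}\hookrightarrow\mathfrak g$. (b) Let $\mathfrak g=so_{2n}(\mathbb C)$, $n\ge3$, with $I=\{1,\dots,n\}$ and with the branch of the Dynkin diagram at $i=n-2$ (edges $\{i,i+1\}$ for $1\le i\le n-2$ and $\{n-2,n\}$). Let $\mathbf b$ consist of complex numbers $b_{ij}=b_{ji}$, one for each edge $\{i,j\}$. Then the assignments $$u_i\mapsto\begin{cases}e_i+b_{i-1,i}f_{i-1}&\text{if }1\le i\le n-2\\ e_i+b_{n-2,i}f_{n-2}&\text{if }i\in\{n-1,n\}\end{cases}$$ (with $b_{01}=0$, $f_0=0$) define an injective homomorphism of Lie algebras $so_{2n}^{(\mathbf b)}\hookrightarrow so_{2n}$. (c) Let $\mathfrak g=\widehat{sl}_n$, $n\geq 2$, be the untwisted affine Lie algebra of type $\hat A_{n-1}$ with $I=\{0,\dots,n-1\}$. Let $\mathbf b$ consist of complex numbers $b_{ij}=b_{ji}$, one for each pair $\{i,j\}$ with $a_{ij}=-1$ (and $b_{ij}=0$ for other pairs). Then the assignments $u_i\mapsto e_i+b_{i-1,i}f_{i-1}$, $i\in I$, where $i-1$ is calculated modulo $n$, define an injective homomorphism of Lie algebras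 $\widehat{sl}_n^{(\mathbf b)}\hookrightarrow\widehat{sl}_n$.
   Context: For a generalized Cartan matrix $A=(a_{ij})_{i,j\in I}$, $\mathfrak g_A$ is the complex Lie algebra generated by $e_i,f_i$ ($i\in I$), $h_i:=[e_i,f_i]$, subject to $[h_i,h_j]=0$, $[e_i,f_j]=\delta_{ij}h_i$, $[h_i,e_j]=a_{ij}e_j$, $[h_i,f_j]=-a_{ij}f_j$, $(\mathrm{ad}\,e_i)^{1-a_{ij}}(e_j)=(\mathrm{ad}\,f_i)^{1-a_{ij}}(f_j)=0$ for $i\neq j$. Given complex numbers $\mathbf b=(b_{ij}=b_{ji})$ indexed by pairs $\{i,j\}$ for which $a_{ij}=-1$ or $a_{ji}=-1$, the generalized electrical Lie algebra of edge type, $\mathfrak g^{(\mathbf b)}$, is the Lie algebra generated by $u_i$, $i\in I$, subject to $$(\mathrm{ad}\,u_i)^{1-a_{ij}}(u_j)+2\delta_{a_{ij},-1}\,b_{ij}\,u_i=0$$ for all distinct $i,j\in I$ (the second term being absent when $a_{ij}\neq-1$). In particular in (a), when $a_{12}\le-2$, $\mathfrak g^{(\mathbf b)}$ is defined by the relations $(\mathrm{ad}\,u_1)^{1-a_{12}}(u_2)=0=(\mathrm{ad}\,u_2)^{1-a_{21}}(u_1)$, with no parameter. $\widehat{sl}_n$ in (c) is $\mathfrak g_A$ for $A$ of type $A^{(1)}_{n-1}$. *)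

theory Defs
  imports "HOL-Algebra.Module" "Jordan_Normal_Form.VS_Connect"
begin

section \<open>Lie algebras\<close>

record ('a, 'b) lie_algebra = "('a, 'b) module" +
  bracket :: "'b \<Rightarrow> 'b \<Rightarrow> 'b"

text \<open>As for modules in HOL-Algebra, the fields \<open>mult\<close> and \<open>one\<close> inherited from rings carry no meaning.\<close>

locale lie_algebra = Module.module R L
  for R (structure) and L :: "('a, 'b, 'm) lie_algebra_scheme" (structure) +
  assumes bracket_closed:
      "\<lbrakk>x \<in> carrier L; y \<in> carrier L\<rbrakk> \<Longrightarrow> bracket L x y \<in> carrier L"
    and bracket_add_left:
      "\<lbrakk>x \<in> carrier L; y \<in> carrier L; z \<in> carrier L\<rbrakk> \<Longrightarrow>
        bracket L (x \<oplus>\<^bsub>L\<^esub> y) z = bracket L x z \<oplus>\<^bsub>L\<^esub> bracket L y z"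
    and bracket_add_right:
      "\<lbrakk>x \<in> carrier L; y \<in> carrier L; z \<in> carrier L\<rbrakk> \<Longrightarrow>
        bracket L x (y \<oplus>\<^bsub>L\<^esub> z) = bracket L x y \<oplus>\<^bsub>L\<^esub> bracket L x z"
    and bracket_smult_left:
      "\<lbrakk>c \<in> carrier R; x \<in> carrier L; y \<in> carrier L\<rbrakk> \<Longrightarrow>
        bracket L (c \<odot>\<^bsub>L\<^esub> x) y = c \<odot>\<^bsub>L\<^esub> bracket L x y"
    and bracket_smult_right:
      "\<lbrakk>c \<in> carrier R; x \<in> carrier L; y \<in> carrier L\<rbrakk> \<Longrightarrow>
        bracket L x (c \<odot>\<^bsub>L\<^esub> y) = c \<odot>\<^bsub>L\<^esub> bracket L x y"
    and bracket_self: "x \<in> carrier L \<Longrightarrow> bracket L x x = \<zero>\<^bsub>L\<^esub>"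
    and jacobi:
      "\<lbrakk>x \<in> carrier L; y \<in> carrier L; z \<in> carrier L\<rbrakk> \<Longrightarrow>
        bracket L x (bracket L y z) \<oplus>\<^bsub>L\<^esub> bracket L y (bracket L z x)
          \<oplus>\<^bsub>L\<^esub> bracket L z (bracket L x y) = \<zero>\<^bsub>L\<^esub>"

locale lie_algebra_hom = dom: lie_algebra R L + cod: lie_algebra R M
  for R (structure) and L (structure) and M (structure) and \<phi> +
  assumes hom_closed: "\<phi> \<in> carrier L \<rightarrow> carrier M"
    and hom_add:
      "\<lbrakk>x \<in> carrier L; y \<in> carrier L\<rbrakk> \<Longrightarrow> \<phi> (x \<oplus>\<^bsub>L\<^esub> y) = \<phi> x \<oplus>\<^bsub>M\<^esub> \<phi> y"
    and hom_smult:
      "\<lbrakk>c \<in> carrier R; x \<in> carrier L\<rbrakk> \<Longrightarrow> \<phi> (c \<odot>\<^bsub>L\<^esub> x) = c \<odot>\<^bsub>M\<^esub> \<phi> x"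
    and hom_bracket:
      "\<lbrakk>x \<in> carrier L; y \<in> carrier L\<rbrakk> \<Longrightarrow> \<phi> (bracket L x y) = bracket M (\<phi> x) (\<phi> y)"

definition defines_injective_hom ::
    "(complex, 'a, 'm) lie_algebra_scheme \<Rightarrow> ('i \<Rightarrow> 'a) \<Rightarrow> 'i set \<Rightarrow>
     (complex, 'b, 'n) lie_algebra_scheme \<Rightarrow> ('i \<Rightarrow> 'b) \<Rightarrow> bool" where
  "defines_injective_hom L u I M v \<longleftrightarrow>
    (\<exists>\<phi>. lie_algebra_hom class_ring L M \<phi> \<and> inj_on \<phi> (carrier L) \<and> (\<forall>i\<in>I. \<phi> (u i) = v i))"


section \<open>Complex Lie algebras given by generators and relations\<close>

datatype (lie_gens: 'g) lie_term =
    Gen 'g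
  | Zero
  | Add "'g lie_term" "'g lie_term"
  | Scale complex "'g lie_term"
  | Br "'g lie_term" "'g lie_term"

definition lie_terms :: "'g set \<Rightarrow> 'g lie_term set" where
  "lie_terms X = {t. lie_gens t \<subseteq> X}"

text \<open>The smallest congruence on the Lie terms over \<open>X\<close> that contains the axioms of a complex
  Lie algebra and identifies every element of \<open>R\<close> with zero.\<close>

inductive_set lie_rel :: "'g set \<Rightarrow> 'g lie_term set \<Rightarrow> ('g lie_term \<times> 'g lie_term) set"
  for X :: "'g set" and R :: "'g lie_term set" where
  refl: "s \<in> lie_terms X \<Longrightarrow> (s, s) \<in> lie_rel X R"
| sym: "(s, t) \<in> lie_rel X R \<Longrightarrow> (t, s) \<in> lie_rel X R"
| trans: "\<lbrakk>(s, t) \<in> lie_rel X R; (t, r) \<in> lie_rel X R\<rbrakk> \<Longrightarrow> (s, r) \<in> lie_rel X R"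
| add_cong: "\<lbrakk>(s, s') \<in> lie_rel X R; (t, t') \<in> lie_rel X R\<rbrakk> \<Longrightarrow> (Add s t, Add s' t') \<in> lie_rel X R"
| scale_cong: "(s, s') \<in> lie_rel X R \<Longrightarrow> (Scale c s, Scale c s') \<in> lie_rel X R"
| br_cong: "\<lbrakk>(s, s') \<in> lie_rel X R; (t, t') \<in> lie_rel X R\<rbrakk> \<Longrightarrow> (Br s t, Br s' t') \<in> lie_rel X R"
| add_assoc: "\<lbrakk>r \<in> lie_terms X; s \<in> lie_terms X; t \<in> lie_terms X\<rbrakk> \<Longrightarrow>
    (Add (Add r s) t, Add r (Add s t)) \<in> lie_rel X R"
| add_comm: "\<lbrakk>s \<in> lie_terms X; t \<in> lie_terms X\<rbrakk> \<Longrightarrow> (Add s t, Add t s) \<in> lie_rel X R"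
| add_zero: "s \<in> lie_terms X \<Longrightarrow> (Add Zero s, s) \<in> lie_rel X R"
| add_neg: "s \<in> lie_terms X \<Longrightarrow> (Add (Scale (-1) s) s, Zero) \<in> lie_rel X R"
| scale_add_left: "s \<in> lie_terms X \<Longrightarrow>
    (Scale (c + d) s, Add (Scale c s) (Scale d s)) \<in> lie_rel X R"
| scale_add_right: "\<lbrakk>s \<in> lie_terms X; t \<in> lie_terms X\<rbrakk> \<Longrightarrow>
    (Scale c (Add s t), Add (Scale c s) (Scale c t)) \<in> lie_rel X R"
| scale_scale: "s \<in> lie_terms X \<Longrightarrow> (Scale (c * d) s, Scale c (Scale d s)) \<in> lie_rel X R"
| scale_one: "s \<in> lie_terms X \<Longrightarrow> (Scale 1 s, s) \<in> lie_rel X R"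
| br_add_left: "\<lbrakk>r \<in> lie_terms X; s \<in> lie_terms X; t \<in> lie_terms X\<rbrakk> \<Longrightarrow>
    (Br (Add r s) t, Add (Br r t) (Br s t)) \<in> lie_rel X R"
| br_add_right: "\<lbrakk>r \<in> lie_terms X; s \<in> lie_terms X; t \<in> lie_terms X\<rbrakk> \<Longrightarrow>
    (Br r (Add s t), Add (Br r s) (Br r t)) \<in> lie_rel X R"
| br_scale_left: "\<lbrakk>s \<in> lie_terms X; t \<in> lie_terms X\<rbrakk> \<Longrightarrow>
    (Br (Scale c s) t, Scale c (Br s t)) \<in> lie_rel X R"
| br_scale_right: "\<lbrakk>s \<in> lie_terms X; t \<in> lie_terms X\<rbrakk> \<Longrightarrow>
    (Br s (Scale c t), Scale c (Br s t)) \<in> lie_rel X R"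
| br_self: "s \<in> lie_terms X \<Longrightarrow> (Br s s, Zero) \<in> lie_rel X R"
| br_jacobi: "\<lbrakk>r \<in> lie_terms X; s \<in> lie_terms X; t \<in> lie_terms X\<rbrakk> \<Longrightarrow>
    (Add (Add (Br r (Br s t)) (Br s (Br t r))) (Br t (Br r s)), Zero) \<in> lie_rel X R"
| relator: "\<lbrakk>r \<in> R; r \<in> lie_terms X\<rbrakk> \<Longrightarrow> (r, Zero) \<in> lie_rel X R"

definition lie_class :: "'g set \<Rightarrow> 'g lie_term set \<Rightarrow> 'g lie_term \<Rightarrow> 'g lie_term set" where
  "lie_class X R t = lie_rel X R `` {t}"

definition presented_lie_algebra ::
    "'g set \<Rightarrow> 'g lie_term set \<Rightarrow> (complex, 'g lie_term set) lie_algebra" where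
  "presented_lie_algebra X R =
    \<lparr>carrier = lie_terms X // lie_rel X R,
     mult = undefined,
     one = undefined,
     zero = lie_class X R Zero,
     add = (\<lambda>U V. \<Union>s\<in>U. \<Union>t\<in>V. lie_class X R (Add s t)),
     smult = (\<lambda>c U. \<Union>s\<in>U. lie_class X R (Scale c s)),
     bracket = (\<lambda>U V. \<Union>s\<in>U. \<Union>t\<in>V. lie_class X R (Br s t))\<rparr>"

abbreviation ad_pow :: "'g lie_term \<Rightarrow> nat \<Rightarrow> 'g lie_term \<Rightarrow> 'g lie_term" where
  "ad_pow s k t \<equiv> (Br s ^^ k) t"


section \<open>The Lie algebra of a generalized Cartan matrix\<close>

definition generalized_cartan_matrix :: "'i set \<Rightarrow> ('i \<Rightarrow> 'i \<Rightarrow> int) \<Rightarrow> bool" where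
  "generalized_cartan_matrix I A \<longleftrightarrow>
    (\<forall>i\<in>I. A i i = 2) \<and>
    (\<forall>i\<in>I. \<forall>j\<in>I. i \<noteq> j \<longrightarrow> A i j \<le> 0 \<and> (A i j = 0 \<longleftrightarrow> A j i = 0))"

datatype 'i chevalley_gen = E 'i | F 'i

abbreviation chevalley_h :: "'i \<Rightarrow> 'i chevalley_gen lie_term" where
  "chevalley_h i \<equiv> Br (Gen (E i)) (Gen (F i))"

text \<open>The relation \<open>[e\<^sub>i, f\<^sub>i] = h\<^sub>i\<close> holds by the definition of \<open>h\<^sub>i\<close>, so \<open>[e\<^sub>i, f\<^sub>j] = \<delta>\<^sub>i\<^sub>j h\<^sub>i\<close>
  only has to be imposed for distinct indices.\<close>

definition kac_moody_relators ::
    "'i set \<Rightarrow> ('i \<Rightarrow> 'i \<Rightarrow> int) \<Rightarrow> 'i chevalley_gen lie_term set" where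
  "kac_moody_relators I A =
    {Br (chevalley_h i) (chevalley_h j) | i j. i \<in> I \<and> j \<in> I} \<union>
    {Br (Gen (E i)) (Gen (F j)) | i j. i \<in> I \<and> j \<in> I \<and> i \<noteq> j} \<union>
    {Add (Br (chevalley_h i) (Gen (E j))) (Scale (- of_int (A i j)) (Gen (E j))) | i j.
      i \<in> I \<and> j \<in> I} \<union>
    {Add (Br (chevalley_h i) (Gen (F j))) (Scale (of_int (A i j)) (Gen (F j))) | i j.
      i \<in> I \<and> j \<in> I} \<union>
    {ad_pow (Gen (E i)) (nat (1 - A i j)) (Gen (E j)) | i j. i \<in> I \<and> j \<in> I \<and> i \<noteq> j} \<union>
    {ad_pow (Gen (F i)) (nat (1 - A i j)) (Gen (F j)) | i j. i \<in> I \<and> j \<in> I \<and> i \<noteq> j}"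

definition chevalley_gens :: "'i set \<Rightarrow> 'i chevalley_gen set" where
  "chevalley_gens I = E ` I \<union> F ` I"

definition kac_moody ::
    "'i set \<Rightarrow> ('i \<Rightarrow> 'i \<Rightarrow> int) \<Rightarrow> (complex, 'i chevalley_gen lie_term set) lie_algebra" where
  "kac_moody I A = presented_lie_algebra (chevalley_gens I) (kac_moody_relators I A)"

definition km_e :: "'i set \<Rightarrow> ('i \<Rightarrow> 'i \<Rightarrow> int) \<Rightarrow> 'i \<Rightarrow> 'i chevalley_gen lie_term set" where
  "km_e I A i = lie_class (chevalley_gens I) (kac_moody_relators I A) (Gen (E i))"

definition km_f :: "'i set \<Rightarrow> ('i \<Rightarrow> 'i \<Rightarrow> int) \<Rightarrow> 'i \<Rightarrow> 'i chevalley_gen lie_term set" where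
  "km_f I A i = lie_class (chevalley_gens I) (kac_moody_relators I A) (Gen (F i))"


section \<open>Generalized electrical Lie algebras of edge type\<close>

text \<open>The values of \<open>b\<close> at other pairs are irrelevant: they do not occur in the relations below.\<close>

definition edge_parameters ::
    "'i set \<Rightarrow> ('i \<Rightarrow> 'i \<Rightarrow> int) \<Rightarrow> ('i \<Rightarrow> 'i \<Rightarrow> complex) \<Rightarrow> bool" where
  "edge_parameters I A b \<longleftrightarrow>
    (\<forall>i\<in>I. \<forall>j\<in>I. A i j = -1 \<or> A j i = -1 \<longrightarrow> b i j = b j i)"

definition electrical_relators ::
    "'i set \<Rightarrow> ('i \<Rightarrow> 'i \<Rightarrow> int) \<Rightarrow> ('i \<Rightarrow> 'i \<Rightarrow> complex) \<Rightarrow> 'i lie_term set" where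
  "electrical_relators I A b =
    {Add (ad_pow (Gen i) (nat (1 - A i j)) (Gen j))
         (Scale (if A i j = -1 then 2 * b i j else 0) (Gen i)) | i j.
      i \<in> I \<and> j \<in> I \<and> i \<noteq> j}"

definition electrical ::
    "'i set \<Rightarrow> ('i \<Rightarrow> 'i \<Rightarrow> int) \<Rightarrow> ('i \<Rightarrow> 'i \<Rightarrow> complex) \<Rightarrow> (complex, 'i lie_term set) lie_algebra" where
  "electrical I A b = presented_lie_algebra I (electrical_relators I A b)"

definition elec_u ::
    "'i set \<Rightarrow> ('i \<Rightarrow> 'i \<Rightarrow> int) \<Rightarrow> ('i \<Rightarrow> 'i \<Rightarrow> complex) \<Rightarrow> 'i \<Rightarrow> 'i lie_term set" where
  "elec_u I A b i = lie_class I (electrical_relators I A b) (Gen i)"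


section \<open>Type D\<close>

definition cartan_D :: "nat \<Rightarrow> nat \<Rightarrow> nat \<Rightarrow> int" where
  "cartan_D n i j =
    (if i = j then 2
     else if (\<exists>k\<in>{1..n-2}. {i, j} = {k, k+1}) \<or> {i, j} = {n-2, n} then -1
     else 0)"

text \<open>The Lie algebra of \<open>2n \<times> 2n\<close> matrices that are skew with respect to the symmetric form with
  Gram matrix \<open>J = (0, 1; 1, 0)\<close> in \<open>n \<times> n\<close> blocks; its elements have the block form
  \<open>(P, Q; S, -P\<^sup>T)\<close> with \<open>Q\<close> and \<open>S\<close> skew-symmetric. Matrix indices start at 0.\<close>

definition so_form :: "nat \<Rightarrow> complex mat" where
  "so_form n = mat (2*n) (2*n) (\<lambda>(p, q). if p + n = q \<or> q + n = p then 1 else 0)"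

definition so_even :: "nat \<Rightarrow> (complex, complex mat) lie_algebra" where
  "so_even n =
    \<lparr>carrier = {X \<in> carrier_mat (2*n) (2*n).
        transpose_mat X * so_form n + so_form n * X = 0\<^sub>m (2*n) (2*n)},
     mult = (*),
     one = 1\<^sub>m (2*n),
     zero = 0\<^sub>m (2*n) (2*n),
     add = (+),
     smult = (\<cdot>\<^sub>m),
     bracket = (\<lambda>X Y. X * Y - Y * X)\<rparr>"

definition elem_mat :: "nat \<Rightarrow> nat \<Rightarrow> nat \<Rightarrow> complex mat" where
  "elem_mat N p q = mat N N (\<lambda>(p', q'). if p' = p \<and> q' = q then 1 else 0)"

text \<open>The standard Chevalley generators, for the Cartan subalgebra of diagonal matrices and the
  simple roots \<open>\<epsilon>\<^sub>i - \<epsilon>\<^sub>i\<^sub>+\<^sub>1\<close> (\<open>i < n\<close>) and \<open>\<epsilon>\<^sub>n\<^sub>-\<^sub>1 + \<epsilon>\<^sub>n\<close>.\<close>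

definition so_e :: "nat \<Rightarrow> nat \<Rightarrow> complex mat" where
  "so_e n i =
    (if i < n then elem_mat (2*n) (i - 1) i - elem_mat (2*n) (n + i) (n + i - 1)
     else elem_mat (2*n) (n - 2) (2*n - 1) - elem_mat (2*n) (n - 1) (2*n - 2))"

definition so_f :: "nat \<Rightarrow> nat \<Rightarrow> complex mat" where
  "so_f n i = transpose_mat (so_e n i)"


section \<open>Affine type A\<close>

text \<open>The affine Cartan matrix of rank \<open>n \<ge> 2\<close>, with index set the residues modulo \<open>n\<close>.\<close>

definition cartan_affine_A :: "nat \<Rightarrow> nat \<Rightarrow> nat \<Rightarrow> int" where
  "cartan_affine_A n i j =
    (if i = j then 2
     else if n = 2 then -2
     else if j = (i + 1) mod n \<or> i = (j + 1) mod n then -1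
     else 0)"

end

theory Submission
  imports Defs
begin

text \<open>
  That the generators satisfy the defining relations is a computation with three neighbouring
  nodes. Injectivity of \<open>\<phi>: u\<^sub>i \<mapsto> e\<^sub>i + c\<^sub>i f\<^sub>p\<^sub>(\<^sub>i\<^sub>)\<close> is a statement about leading terms. Filter \<open>\<gg>\<^sup>(\<^sup>b\<^sup>)\<close> by the
  number of generators in a bracket and suppose that \<open>t\<close> has exact filtration degree \<open>d\<close>. A linear
  form \<open>l\<close> that vanishes on lower degrees but not on \<open>t\<close> gives the function \<open>\<xi>(i\<^sub>1 \<dots> i\<^sub>m) =
  l [u\<^sub>i\<^sub>1, [\<dots>, u\<^sub>i\<^sub>m]]\<close> on words of length at most \<open>d\<close>. The Kac--Moody algebra acts on functions on
  words (the dual of a Verma module over the free algebra); the Serre relations of the \<open>e\<^sub>i\<close> hold on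
  the submodule of functions annihilated by the two-sided ideal of the Serre elements, and \<open>\<xi>\<close> lies
  in it because the Serre elements have lower degree in \<open>\<gg>\<^sup>(\<^sup>b\<^sup>)\<close>. By Dynkin's identity \<open>\<phi>(t)\<close> sends \<open>\<xi>\<close>
  to a function with value \<open>d \<cdot> l(t) \<noteq> 0\<close> at the empty word, so \<open>\<phi>(t) \<noteq> 0\<close>.

  For \<open>so\<^sub>2\<^sub>n\<close> it remains to see that the Kac--Moody algebra of type D acts faithfully. In the kernel
  take a weight vector of minimal positive height. It is killed by all \<open>f\<^sub>i\<close>, and since the \<open>e\<^sub>i\<close>
  act locally nilpotently its weight is antidominant; as the height is a nonnegative combination of
  the coroots, it is not positive, a contradiction.
\<close>

section \<open>Presented Lie algebras\<close>

text \<open>Filtering by degree turns the defining relations of the electrical algebra into Serre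
  relations, so its graded algebra is a quotient of the Lie algebra given by the \<open>e i\<close>
  and the Serre relations. Injectivity therefore contains the claim that this algebra does not
  collapse inside the Kac-Moody algebra, and this calls for a module as witness. The dual of a Verma
  module over the free algebra is chosen because the \<open>f i\<close> act on it by an explicit
  recursion and the Serre elements commute with every \<open>f k\<close>, so that the functions
  annihilated by their ideal form a submodule. Characteristic 0 enters when a nonzero integer d has
  to stay nonzero.

  All assignments have the shape \<open>e i + c i *\<^sub>L f (p i)\<close> with a parent map
  \<open>p\<close>: constant in rank 2, a rooted tree in type D, a cycle in affine type A. The shape
  of \<open>p\<close> matters only when the relations are checked. In the passage from type D to
  matrices, the height is expressed through half the sum of the positive coroots, which takes the
  value 1 on every simple root.\<close>

lemma lie_terms_simps [simp]:
  "Gen g \<in> lie_terms X \<longleftrightarrow> g \<in> X"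
  "Zero \<in> lie_terms X"
  "Add s t \<in> lie_terms X \<longleftrightarrow> s \<in> lie_terms X \<and> t \<in> lie_terms X"
  "Scale c t \<in> lie_terms X \<longleftrightarrow> t \<in> lie_terms X"
  "Br s t \<in> lie_terms X \<longleftrightarrow> s \<in> lie_terms X \<and> t \<in> lie_terms X"
  by (auto simp: lie_terms_def)

lemma ad_pow_in_lie_terms [simp]:
  "s \<in> lie_terms X \<Longrightarrow> t \<in> lie_terms X \<Longrightarrow> ad_pow s k t \<in> lie_terms X"
  by (induction k) auto

lemma lie_rel_in_lie_terms:
  assumes "(s, t) \<in> lie_rel X R"
  shows "s \<in> lie_terms X" "t \<in> lie_terms X"
  using assms by (induction rule: lie_rel.induct) auto

lemma equiv_lie_rel: "equiv (lie_terms X) (lie_rel X R)"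
proof (rule equivI)
  show "lie_rel X R \<subseteq> lie_terms X \<times> lie_terms X"
    by (auto dest: lie_rel_in_lie_terms)
  show "refl_on (lie_terms X) (lie_rel X R)"
    by (rule refl_onI) (auto intro: lie_rel.refl)
  show "sym (lie_rel X R)"
    by (rule symI) (rule lie_rel.sym)
  show "trans (lie_rel X R)"
    by (rule transI) (rule lie_rel.trans)
qed

lemma lie_class_eq_iff:
  "s \<in> lie_terms X \<Longrightarrow> t \<in> lie_terms X \<Longrightarrow>
    lie_class X R s = lie_class X R t \<longleftrightarrow> (s, t) \<in> lie_rel X R"
  unfolding lie_class_def by (rule eq_equiv_class_iff[OF equiv_lie_rel])

lemma lie_class_eqI: "(s, t) \<in> lie_rel X R \<Longrightarrow> lie_class X R t = lie_class X R s"
  unfolding lie_class_def by (rule equiv_class_eq[OF equiv_lie_rel lie_rel.sym])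

lemma presented_carrier: "carrier (presented_lie_algebra X R) = lie_class X R ` lie_terms X"
  by (auto simp: presented_lie_algebra_def quotient_def lie_class_def)

lemma lie_class_in_carrier [simp]:
  "t \<in> lie_terms X \<Longrightarrow> lie_class X R t \<in> carrier (presented_lie_algebra X R)"
  by (auto simp: presented_carrier)

text \<open>The operations of \<open>presented_lie_algebra\<close> are unions over representatives.
  If all representatives give the same set, the union collapses to it, because a class of a term is
  nonempty.\<close>

lemma UN_lie_class:
  assumes "s \<in> lie_terms X"
    and "\<And>s'. (s, s') \<in> lie_rel X R \<Longrightarrow> f s' = f s"
  shows "(\<Union>s'\<in>lie_class X R s. f s') = f s"
proof (rule SUP_eq_const)
  show "lie_class X R s \<noteq> {}"
    using assms(1) by (auto simp: lie_class_def intro: lie_rel.refl)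
qed (use assms(2) in \<open>simp add: lie_class_def\<close>)

lemma presented_ops:
  assumes s: "s \<in> lie_terms X"
  shows presented_zero: "\<zero>\<^bsub>presented_lie_algebra X R\<^esub> = lie_class X R Zero"
    and presented_add: "t \<in> lie_terms X \<Longrightarrow>
      lie_class X R s \<oplus>\<^bsub>presented_lie_algebra X R\<^esub> lie_class X R t = lie_class X R (Add s t)"
    and presented_smult:
      "c \<odot>\<^bsub>presented_lie_algebra X R\<^esub> lie_class X R s = lie_class X R (Scale c s)"
    and presented_bracket: "t \<in> lie_terms X \<Longrightarrow>
      bracket (presented_lie_algebra X R) (lie_class X R s) (lie_class X R t) = lie_class X R (Br s t)"
proof -
  show "\<zero>\<^bsub>presented_lie_algebra X R\<^esub> = lie_class X R Zero"
    by (simp add: presented_lie_algebra_def)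
  show "lie_class X R s \<oplus>\<^bsub>presented_lie_algebra X R\<^esub> lie_class X R t = lie_class X R (Add s t)"
    if t: "t \<in> lie_terms X"
  proof -
    have "(\<Union>t'\<in>lie_class X R t. lie_class X R (Add s' t')) = lie_class X R (Add s' t)"
      if "s' \<in> lie_terms X" for s'
      by (rule UN_lie_class[OF t], intro lie_class_eqI lie_rel.add_cong lie_rel.refl that)
    then have "(\<Union>s'\<in>lie_class X R s. \<Union>t'\<in>lie_class X R t. lie_class X R (Add s' t'))
        = (\<Union>s'\<in>lie_class X R s. lie_class X R (Add s' t))"
      by (intro SUP_cong) (auto simp: lie_class_def dest: lie_rel_in_lie_terms)
    also have "\<dots> = lie_class X R (Add s t)"
      by (rule UN_lie_class[OF s], intro lie_class_eqI lie_rel.add_cong lie_rel.refl t)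
    finally show ?thesis by (simp add: presented_lie_algebra_def)
  qed
  show "bracket (presented_lie_algebra X R) (lie_class X R s) (lie_class X R t) = lie_class X R (Br s t)"
    if t: "t \<in> lie_terms X"
  proof -
    have "(\<Union>t'\<in>lie_class X R t. lie_class X R (Br s' t')) = lie_class X R (Br s' t)"
      if "s' \<in> lie_terms X" for s'
      by (rule UN_lie_class[OF t], intro lie_class_eqI lie_rel.br_cong lie_rel.refl that)
    then have "(\<Union>s'\<in>lie_class X R s. \<Union>t'\<in>lie_class X R t. lie_class X R (Br s' t'))
        = (\<Union>s'\<in>lie_class X R s. lie_class X R (Br s' t))"
      by (intro SUP_cong) (auto simp: lie_class_def dest: lie_rel_in_lie_terms)
    also have "\<dots> = lie_class X R (Br s t)"
      by (rule UN_lie_class[OF s], intro lie_class_eqI lie_rel.br_cong lie_rel.refl t)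
    finally show ?thesis by (simp add: presented_lie_algebra_def)
  qed
  show "c \<odot>\<^bsub>presented_lie_algebra X R\<^esub> lie_class X R s = lie_class X R (Scale c s)"
    unfolding presented_lie_algebra_def
    by (simp, rule UN_lie_class[OF s], intro lie_class_eqI lie_rel.scale_cong)
qed

lemma presented_carrierE:
  assumes "x \<in> carrier (presented_lie_algebra X R)"
  obtains s where "s \<in> lie_terms X" "x = lie_class X R s"
  using assms by (auto simp: presented_carrier)

lemma lie_algebra_presented: "lie_algebra class_ring (presented_lie_algebra X R)"
proof -
  let ?P = "presented_lie_algebra X R"
  note ops = presented_zero[of Zero] presented_ops(2-) lie_class_eq_iff
  have "abelian_group ?P"
  proof (rule abelian_groupI)
    fix x
    assume "x \<in> carrier ?P"
    then obtain s where s: "s \<in> lie_terms X" "x = lie_class X R s"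
      by (rule presented_carrierE)
    show "\<exists>y\<in>carrier ?P. y \<oplus>\<^bsub>?P\<^esub> x = \<zero>\<^bsub>?P\<^esub>"
      by (rule bexI[of _ "lie_class X R (Scale (-1) s)"])
        (use s in \<open>simp_all add: ops lie_rel.add_neg\<close>)
  qed ((elim presented_carrierE)?,
      simp add: ops lie_rel.add_assoc lie_rel.add_comm lie_rel.add_zero)+
  then have "Module.module class_ring ?P"
    by (intro Module.module.intro module_axioms.intro class_cring.is_cring;
        (elim presented_carrierE)?)
      (simp_all add: ops lie_rel.scale_add_left lie_rel.scale_add_right lie_rel.scale_scale
        lie_rel.scale_one)
  then show ?thesis
    by (intro lie_algebra.intro lie_algebra_axioms.intro; (elim presented_carrierE)?)
      (simp_all add: ops lie_rel.br_add_left lie_rel.br_add_right lie_rel.br_scale_left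
        lie_rel.br_scale_right lie_rel.br_self lie_rel.br_jacobi)
qed

section \<open>Evaluation of terms and the universal property of a presentation\<close>

primrec lie_eval :: "(complex, 'a, 'm) lie_algebra_scheme \<Rightarrow> ('g \<Rightarrow> 'a) \<Rightarrow> 'g lie_term \<Rightarrow> 'a" where
  "lie_eval M v (Gen g) = v g"
| "lie_eval M v Zero = \<zero>\<^bsub>M\<^esub>"
| "lie_eval M v (Add s t) = lie_eval M v s \<oplus>\<^bsub>M\<^esub> lie_eval M v t"
| "lie_eval M v (Scale c t) = c \<odot>\<^bsub>M\<^esub> lie_eval M v t"
| "lie_eval M v (Br s t) = bracket M (lie_eval M v s) (lie_eval M v t)"

lemma lie_eval_closed:
  assumes "lie_algebra class_ring M" "\<And>g. g \<in> X \<Longrightarrow> v g \<in> carrier M" "t \<in> lie_terms X"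
  shows "lie_eval M v t \<in> carrier M"
proof -
  interpret M: lie_algebra class_ring M by fact
  from assms(3) show ?thesis
    by (induction t) (auto intro: assms(2) M.bracket_closed)
qed

lemma lie_eval_sound:
  assumes M: "lie_algebra class_ring M"
    and v: "\<And>g. g \<in> X \<Longrightarrow> v g \<in> carrier M"
    and R: "\<And>r. r \<in> R \<Longrightarrow> r \<in> lie_terms X \<Longrightarrow> lie_eval M v r = \<zero>\<^bsub>M\<^esub>"
    and st: "(s, t) \<in> lie_rel X R"
  shows "lie_eval M v s = lie_eval M v t"
proof -
  interpret M: lie_algebra class_ring M by fact
  note closed [simp] = lie_eval_closed[OF M, of X v, OF v]
  from st show ?thesis
  proof (induction rule: lie_rel.induct)
    case (add_neg s)
    then show ?case
      using M.smult_l_distr[of "-1" 1 "lie_eval M v s"] M.smult_one[of "lie_eval M v s"]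
        M.smult_l_null[of "lie_eval M v s"] by simp
  next
    case (scale_add_left s c d)
    then show ?case using M.smult_l_distr[of c d "lie_eval M v s"] by simp
  next
    case (scale_scale s c d)
    then show ?case using M.smult_assoc1[of c d "lie_eval M v s"] by simp
  next
    case (scale_one s)
    then show ?case using M.smult_one[of "lie_eval M v s"] by simp
  next
    case (scale_add_right s t c)
    then show ?case using M.smult_r_distr[of c "lie_eval M v s" "lie_eval M v t"] by simp
  next
    case (add_assoc r s t)
    then show ?case by (simp add: M.a_assoc)
  next
    case (add_comm s t)
    then show ?case by (simp add: M.a_comm)
  next
    case (br_scale_left s t c)
    then show ?case using M.bracket_smult_left[of c] by simp
  next
    case (br_scale_right s t c)
    then show ?case using M.bracket_smult_right[of c] by simp
  qed (simp_all add: R M.bracket_add_left M.bracket_add_right M.bracket_self M.jacobi)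
qed

primrec lie_subst :: "('g \<Rightarrow> 'h lie_term) \<Rightarrow> 'g lie_term \<Rightarrow> 'h lie_term" where
  "lie_subst \<sigma> (Gen g) = \<sigma> g"
| "lie_subst \<sigma> Zero = Zero"
| "lie_subst \<sigma> (Add s t) = Add (lie_subst \<sigma> s) (lie_subst \<sigma> t)"
| "lie_subst \<sigma> (Scale c t) = Scale c (lie_subst \<sigma> t)"
| "lie_subst \<sigma> (Br s t) = Br (lie_subst \<sigma> s) (lie_subst \<sigma> t)"

lemma lie_subst_in_lie_terms:
  "t \<in> lie_terms X \<Longrightarrow> (\<And>g. g \<in> X \<Longrightarrow> \<sigma> g \<in> lie_terms Y) \<Longrightarrow> lie_subst \<sigma> t \<in> lie_terms Y"
  by (induction t) auto

lemma lie_eval_subst: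
  "lie_eval M v (lie_subst \<sigma> t) = lie_eval M (\<lambda>g. lie_eval M v (\<sigma> g)) t"
  by (induction t) auto

lemma lie_eval_presented:
  assumes "t \<in> lie_terms X" "\<And>g. g \<in> X \<Longrightarrow> \<sigma> g \<in> lie_terms Y"
  shows "lie_eval (presented_lie_algebra Y R) (\<lambda>g. lie_class Y R (\<sigma> g)) t = lie_class Y R (lie_subst \<sigma> t)"
  using assms
proof (induction t)
  case (Add s t)
  then show ?case
    using lie_subst_in_lie_terms[of s X \<sigma> Y] lie_subst_in_lie_terms[of t X \<sigma> Y]
    by (simp add: presented_add)
next
  case (Scale c t)
  then show ?case
    using lie_subst_in_lie_terms[of t X \<sigma> Y] by (simp add: presented_smult)
next
  case (Br s t)
  then show ?case
    using lie_subst_in_lie_terms[of s X \<sigma> Y] lie_subst_in_lie_terms[of t X \<sigma> Y]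
    by (simp add: presented_bracket)
qed (simp_all add: presented_zero[of Zero])

text \<open>Injectivity is asked for on terms instead of classes: a term whose value is zero must be
  congruent to \<open>Zero\<close>. In this form it can be attacked by evaluating terms in
  modules.\<close>

lemma defines_injective_homI:
  assumes M: "lie_algebra class_ring M"
    and v: "\<And>g. g \<in> X \<Longrightarrow> v g \<in> carrier M"
    and R: "\<And>r. r \<in> R \<Longrightarrow> r \<in> lie_terms X \<Longrightarrow> lie_eval M v r = \<zero>\<^bsub>M\<^esub>"
    and inj: "\<And>t. t \<in> lie_terms X \<Longrightarrow> lie_eval M v t = \<zero>\<^bsub>M\<^esub> \<Longrightarrow> (t, Zero) \<in> lie_rel X R"
  shows "defines_injective_hom (presented_lie_algebra X R) (\<lambda>g. lie_class X R (Gen g)) X M v"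
proof -
  let ?P = "presented_lie_algebra X R"
  interpret M: lie_algebra class_ring M by fact
  interpret P: lie_algebra class_ring ?P by (rule lie_algebra_presented)
  note closed [simp] = lie_eval_closed[OF M, of X v, OF v]
  note ops = presented_zero[of Zero] presented_ops(2-)
  have sound: "lie_eval M v s = lie_eval M v t" if "(s, t) \<in> lie_rel X R" for s t
    by (rule lie_eval_sound[of M X v R]) (use M v R that in auto)
  \<comment> \<open>An arbitrary representative is evaluated; by \<open>sound\<close> the value is
    the same for all of them.\<close>
  define \<phi> where "\<phi> U = lie_eval M v (SOME t. t \<in> U)" for U
  have \<phi>: "\<phi> (lie_class X R t) = lie_eval M v t" if t: "t \<in> lie_terms X" for t
  proof -
    have "t \<in> lie_class X R t" using t by (auto simp: lie_class_def intro: lie_rel.refl)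
    then have "(SOME s. s \<in> lie_class X R t) \<in> lie_class X R t" by (rule someI)
    then have "(t, SOME s. s \<in> lie_class X R t) \<in> lie_rel X R" by (simp add: lie_class_def)
    from sound[OF this] show ?thesis unfolding \<phi>_def by simp
  qed
  have hom: "lie_algebra_hom class_ring ?P M \<phi>"
    by (intro lie_algebra_hom.intro lie_algebra_hom_axioms.intro M lie_algebra_presented funcsetI;
        elim presented_carrierE) (simp_all add: \<phi> ops)
  have "inj_on \<phi> (carrier ?P)"
  proof (rule inj_onI)
    fix x y
    assume x: "x \<in> carrier ?P" and y: "y \<in> carrier ?P" and eq: "\<phi> x = \<phi> y"
    obtain s t where st: "s \<in> lie_terms X" "t \<in> lie_terms X"
        "x = lie_class X R s" "y = lie_class X R t"
      by (rule presented_carrierE[OF x], rule presented_carrierE[OF y])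
    have "lie_eval M v (Add (Scale (-1) s) t) = lie_eval M v (Add (Scale (-1) t) t)"
      using eq st by (simp add: \<phi>)
    also have "\<dots> = lie_eval M v Zero"
      by (rule sound) (use st in \<open>simp_all add: lie_rel.add_neg\<close>)
    finally have "(Add (Scale (-1) s) t, Zero) \<in> lie_rel X R"
      using st by (intro inj) auto
    then have rel: "(Add s (Add (Scale (-1) s) t), Add s Zero) \<in> lie_rel X R"
      using st by (intro lie_rel.add_cong lie_rel.refl)
    have zero: "\<zero>\<^bsub>?P\<^esub> = lie_class X R Zero" by (simp add: ops)
    have neg: "lie_class X R (Scale (-1) s) \<oplus>\<^bsub>?P\<^esub> lie_class X R s = \<zero>\<^bsub>?P\<^esub>"
      using st by (simp add: ops lie_class_eq_iff lie_rel.add_neg)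
    \<comment> \<open>The kernel condition is transported by hand: x = s + 0 = s + (-s + t) = (s -
      s) + t = y.\<close>
    have "x = lie_class X R (Add s Zero)"
      using P.r_zero[of x] st by (simp add: ops)
    also have "\<dots> = lie_class X R (Add s (Add (Scale (-1) s) t))"
      using rel st by (simp add: lie_class_eq_iff lie_rel.sym)
    also have "\<dots> = lie_class X R s \<oplus>\<^bsub>?P\<^esub> (lie_class X R (Scale (-1) s) \<oplus>\<^bsub>?P\<^esub> lie_class X R t)"
      using st by (simp add: ops)
    also have "\<dots> = y"
      using neg st P.a_comm[of "lie_class X R (Scale (-1) s)" "lie_class X R s"]
      by (simp add: P.a_assoc[symmetric])
    finally show "x = y" .
  qed
  then show ?thesis
    unfolding defines_injective_hom_def using hom by (intro exI[of _ \<phi>]) (simp add: \<phi>)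
qed

section \<open>Complex Lie algebras as a type class\<close>

text \<open>A type in place of a carrier set removes the membership conditions from bracket
  computations, and \<open>cl\<close> then provides spans and the extension of independent
  sets.\<close>

class complex_lie = ab_group_add +
  fixes scl :: "complex \<Rightarrow> 'a \<Rightarrow> 'a" (infixr \<open>*\<^sub>L\<close> 75)
    and lbr :: "'a \<Rightarrow> 'a \<Rightarrow> 'a" (\<open>(\<open>notation=\<open>mixfix Lie bracket\<close>\<close>\<lblot>_,/ _\<rblot>)\<close>)
  assumes scl_add_right: "c *\<^sub>L (x + y) = c *\<^sub>L x + c *\<^sub>L y"
    and scl_add_left: "(c + d) *\<^sub>L x = c *\<^sub>L x + d *\<^sub>L x"
    and scl_scl [simp]: "c *\<^sub>L d *\<^sub>L x = (c * d) *\<^sub>L x"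
    and scl_one [simp]: "1 *\<^sub>L x = x"
    and lbr_add_left: "\<lblot>x + y, z\<rblot> = \<lblot>x, z\<rblot> + \<lblot>y, z\<rblot>"
    and lbr_add_right: "\<lblot>x, y + z\<rblot> = \<lblot>x, y\<rblot> + \<lblot>x, z\<rblot>"
    and lbr_scl_left [simp]: "\<lblot>c *\<^sub>L x, y\<rblot> = c *\<^sub>L \<lblot>x, y\<rblot>"
    and lbr_scl_right [simp]: "\<lblot>x, c *\<^sub>L y\<rblot> = c *\<^sub>L \<lblot>x, y\<rblot>"
    and lbr_self [simp]: "\<lblot>x, x\<rblot> = 0"
    and jacobi: "\<lblot>x, \<lblot>y, z\<rblot>\<rblot> + \<lblot>y, \<lblot>z, x\<rblot>\<rblot> + \<lblot>z, \<lblot>x, y\<rblot>\<rblot> = 0"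

interpretation cl: vector_space "scl :: complex \<Rightarrow> 'a::complex_lie \<Rightarrow> 'a"
  by unfold_locales (simp_all add: scl_add_right scl_add_left)

lemmas scl_simps [simp] = cl.scale_zero_left cl.scale_zero_right cl.scale_minus_left
  cl.scale_minus_right

lemma lbr_zero_left [simp]: "\<lblot>0, (x::'a::complex_lie)\<rblot> = 0"
  using lbr_scl_left[of 0 0 x] by simp

lemma lbr_zero_right [simp]: "\<lblot>(x::'a::complex_lie), 0\<rblot> = 0"
  using lbr_scl_right[of x 0 0] by simp

lemma lbr_minus_left [simp]: "\<lblot>- (x::'a::complex_lie), y\<rblot> = - \<lblot>x, y\<rblot>"
  using lbr_scl_left[of "-1" x y] by simp

lemma lbr_minus_right [simp]: "\<lblot>(x::'a::complex_lie), - y\<rblot> = - \<lblot>x, y\<rblot>"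
  using lbr_scl_right[of x "-1" y] by simp

lemma lbr_antisym: "\<lblot>y, (x::'a::complex_lie)\<rblot> = - \<lblot>x, y\<rblot>"
proof -
  have "\<lblot>x, y\<rblot> + \<lblot>y, x\<rblot> = \<lblot>x + y, x + y\<rblot>"
    by (simp only: lbr_add_left lbr_add_right) simp
  then have "\<lblot>x, y\<rblot> + \<lblot>y, x\<rblot> = 0" by simp
  then show ?thesis by (simp add: eq_neg_iff_add_eq_0 add.commute)
qed

lemma lbr_leibniz: "\<lblot>(x::'a::complex_lie), \<lblot>y, z\<rblot>\<rblot> = \<lblot>\<lblot>x, y\<rblot>, z\<rblot> + \<lblot>y, \<lblot>x, z\<rblot>\<rblot>"
  using jacobi[of x y z] lbr_antisym[of z x] lbr_antisym[of "\<lblot>x, y\<rblot>" z]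
  by (simp add: algebra_simps add_eq_0_iff2)

lemma lbr_diff_left: "\<lblot>x - y, z\<rblot> = \<lblot>x, z\<rblot> - \<lblot>y, (z::'a::complex_lie)\<rblot>"
  using lbr_add_left[of x "-y" z] by simp

lemma lbr_diff_right: "\<lblot>x, y - z\<rblot> = \<lblot>x, y\<rblot> - \<lblot>x, (z::'a::complex_lie)\<rblot>"
  using lbr_add_right[of x y "-z"] by simp

lemma lbr_sum_right: "\<lblot>x, sum g S\<rblot> = (\<Sum>s\<in>S. \<lblot>x, (g s::'a::complex_lie)\<rblot>)"
  by (induction S rule: infinite_finite_induct) (auto simp: lbr_add_right)

primrec lie_val :: "('g \<Rightarrow> 'a) \<Rightarrow> 'g lie_term \<Rightarrow> 'a::complex_lie" where
  "lie_val v (Gen g) = v g"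
| "lie_val v Zero = 0"
| "lie_val v (Add s t) = lie_val v s + lie_val v t"
| "lie_val v (Scale c t) = c *\<^sub>L lie_val v t"
| "lie_val v (Br s t) = \<lblot>lie_val v s, lie_val v t\<rblot>"

lemma lie_val_ad_pow: "lie_val v (ad_pow s k t) = (lbr (lie_val v s) ^^ k) (lie_val v t)"
  by (induction k) auto

text \<open>A presented Lie algebra depends on parameters, hence is not a type. The product of all
  presented Lie algebras with generators in a given type is one, and it contains each factor.\<close>

typedef 'g lie_prod =
  "{F :: 'g set \<times> 'g lie_term set \<Rightarrow> 'g lie_term set.
     \<forall>X R. F (X, R) \<in> carrier (presented_lie_algebra X R)}"
proof -
  have "(\<lambda>(X, R). lie_class X R Zero) \<in> {F. \<forall>X R. F (X, R) \<in> carrier (presented_lie_algebra X R)}"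
    by simp
  then show ?thesis by blast
qed

setup_lifting type_definition_lie_prod

interpretation pres: lie_algebra class_ring "presented_lie_algebra X R" for X R
  by (rule lie_algebra_presented)

instantiation lie_prod :: (type) complex_lie
begin

lift_definition zero_lie_prod :: "'a lie_prod" is
  "\<lambda>(X, R). \<zero>\<^bsub>presented_lie_algebra X R\<^esub>"
  by auto

lift_definition plus_lie_prod :: "'a lie_prod \<Rightarrow> 'a lie_prod \<Rightarrow> 'a lie_prod" is
  "\<lambda>F G (X, R). F (X, R) \<oplus>\<^bsub>presented_lie_algebra X R\<^esub> G (X, R)"
  by auto

lift_definition uminus_lie_prod :: "'a lie_prod \<Rightarrow> 'a lie_prod" is
  "\<lambda>F (X, R). \<ominus>\<^bsub>presented_lie_algebra X R\<^esub> F (X, R)"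
  by auto

lift_definition minus_lie_prod :: "'a lie_prod \<Rightarrow> 'a lie_prod \<Rightarrow> 'a lie_prod" is
  "\<lambda>F G (X, R). F (X, R) \<ominus>\<^bsub>presented_lie_algebra X R\<^esub> G (X, R)"
  by auto

lift_definition scl_lie_prod :: "complex \<Rightarrow> 'a lie_prod \<Rightarrow> 'a lie_prod" is
  "\<lambda>c F (X, R). c \<odot>\<^bsub>presented_lie_algebra X R\<^esub> F (X, R)"
  by auto

lift_definition lbr_lie_prod :: "'a lie_prod \<Rightarrow> 'a lie_prod \<Rightarrow> 'a lie_prod" is
  "\<lambda>F G (X, R). bracket (presented_lie_algebra X R) (F (X, R)) (G (X, R))"
  by (auto intro: pres.bracket_closed)

instance
proof
  fix a b c :: "'a lie_prod" and r s :: complex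
  show "a + b + c = a + (b + c)" by transfer (auto simp: pres.a_assoc)
  show "a + b = b + a" by transfer (auto simp: pres.a_comm)
  show "0 + a = a" by transfer auto
  show "- a + a = 0" by transfer (auto simp: pres.l_neg)
  show "a - b = a + - b" by transfer (auto simp: a_minus_def)
  show "r *\<^sub>L (a + b) = r *\<^sub>L a + r *\<^sub>L b"
    by transfer (simp add: fun_eq_iff pres.smult_r_distr)
  show "(r + s) *\<^sub>L a = r *\<^sub>L a + s *\<^sub>L a"
    by transfer (simp add: fun_eq_iff pres.smult_l_distr[simplified])
  show "r *\<^sub>L s *\<^sub>L a = (r * s) *\<^sub>L a"
    by transfer (simp add: fun_eq_iff pres.smult_assoc1[simplified])
  show "1 *\<^sub>L a = a"
    by transfer (simp add: fun_eq_iff pres.smult_one[simplified])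
  show "\<lblot>a + b, c\<rblot> = \<lblot>a, c\<rblot> + \<lblot>b, c\<rblot>"
    by transfer (simp add: fun_eq_iff pres.bracket_add_left)
  show "\<lblot>a, b + c\<rblot> = \<lblot>a, b\<rblot> + \<lblot>a, c\<rblot>"
    by transfer (simp add: fun_eq_iff pres.bracket_add_right)
  show "\<lblot>r *\<^sub>L a, b\<rblot> = r *\<^sub>L \<lblot>a, b\<rblot>"
    by transfer (simp add: fun_eq_iff pres.bracket_smult_left)
  show "\<lblot>a, r *\<^sub>L b\<rblot> = r *\<^sub>L \<lblot>a, b\<rblot>"
    by transfer (simp add: fun_eq_iff pres.bracket_smult_right)
  show "\<lblot>a, a\<rblot> = 0"
    by transfer (auto simp: pres.bracket_self)
  show "\<lblot>a, \<lblot>b, c\<rblot>\<rblot> + \<lblot>b, \<lblot>c, a\<rblot>\<rblot> + \<lblot>c, \<lblot>a, b\<rblot>\<rblot> = 0"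
    by transfer (simp add: fun_eq_iff pres.jacobi)
qed

end

text \<open>The zero in all other factors keeps the map compatible with sum, scalars and bracket, so
  that equations in the product type express congruence of terms for one chosen
  presentation.\<close>

lift_definition lie_emb :: "'g set \<Rightarrow> 'g lie_term set \<Rightarrow> 'g lie_term \<Rightarrow> 'g lie_prod" is
  "\<lambda>X R t (Y, S). if Y = X \<and> S = R \<and> t \<in> lie_terms X then lie_class X R t
     else \<zero>\<^bsub>presented_lie_algebra Y S\<^esub>"
  by auto

context
  fixes X :: "'g set" and R :: "'g lie_term set"
begin

private abbreviation "\<iota> \<equiv> lie_emb X R"

lemma lie_emb_eq_iff:
  assumes "s \<in> lie_terms X" "t \<in> lie_terms X"
  shows "\<iota> s = \<iota> t \<longleftrightarrow> (s, t) \<in> lie_rel X R"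
proof -
  have "\<iota> s = \<iota> t \<longleftrightarrow> lie_class X R s = lie_class X R t"
    using assms by transfer (auto simp: fun_eq_iff)
  then show ?thesis using assms by (simp add: lie_class_eq_iff)
qed

lemma lie_emb_Zero: "\<iota> Zero = 0"
  by transfer (simp add: fun_eq_iff presented_zero[of Zero])

lemma lie_emb_Add:
  "s \<in> lie_terms X \<Longrightarrow> t \<in> lie_terms X \<Longrightarrow> \<iota> (Add s t) = \<iota> s + \<iota> t"
  by transfer (simp add: fun_eq_iff presented_add)

lemma lie_emb_Scale: "t \<in> lie_terms X \<Longrightarrow> \<iota> (Scale c t) = c *\<^sub>L \<iota> t"
  by transfer (simp add: fun_eq_iff presented_smult pres.smult_r_null)

lemma lie_emb_Br:
  "s \<in> lie_terms X \<Longrightarrow> t \<in> lie_terms X \<Longrightarrow> \<iota> (Br s t) = \<lblot>\<iota> s, \<iota> t\<rblot>"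
  by transfer (simp add: fun_eq_iff presented_bracket pres.bracket_self)

lemma lie_emb_val:
  "t \<in> lie_terms X \<Longrightarrow> \<iota> t = lie_val (\<lambda>g. \<iota> (Gen g)) t"
  by (induction t) (auto simp: lie_emb_Zero lie_emb_Add lie_emb_Scale lie_emb_Br)

lemma lie_emb_eq_0_iff: "t \<in> lie_terms X \<Longrightarrow> \<iota> t = 0 \<longleftrightarrow> (t, Zero) \<in> lie_rel X R"
  using lie_emb_eq_iff[of t Zero] by (simp add: lie_emb_Zero)

lemma lie_emb_relator:
  "r \<in> R \<Longrightarrow> r \<in> lie_terms X \<Longrightarrow> lie_val (\<lambda>g. \<iota> (Gen g)) r = 0"
  by (simp add: lie_emb_val[symmetric] lie_emb_eq_0_iff lie_rel.relator)

end

section \<open>Consequences of the Chevalley relations\<close>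

abbreviation lbr_pow :: "'a::complex_lie \<Rightarrow> nat \<Rightarrow> 'a \<Rightarrow> 'a" where
  "lbr_pow x r \<equiv> lbr x ^^ r"

lemma lbr_pow_zero [simp]: "lbr_pow x r 0 = 0"
  by (induction r) auto

lemma lbr_pow_scl [simp]: "lbr_pow x r (c *\<^sub>L y) = c *\<^sub>L lbr_pow x r y"
  by (induction r) auto

lemma lbr_pow_add: "lbr_pow x r (y + z) = lbr_pow x r y + lbr_pow x r z"
  by (induction r) (auto simp: lbr_add_right)

lemma lbr_pow_commute:
  assumes "\<lblot>z, x\<rblot> = 0"
  shows "\<lblot>z, lbr_pow x r y\<rblot> = lbr_pow x r \<lblot>z, y\<rblot>"
proof (induction r)
  case (Suc r)
  then show ?case
    using lbr_leibniz[of z x "lbr_pow x r y"] assms by simp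
qed simp

lemma sl2_weight:
  assumes "\<lblot>h, x\<rblot> = 2 *\<^sub>L x" "\<lblot>h, v\<rblot> = m *\<^sub>L v"
  shows "\<lblot>h, lbr_pow x r v\<rblot> = (m + 2 * of_nat r) *\<^sub>L lbr_pow x r v"
proof (induction r)
  case (Suc r)
  have "\<lblot>h, \<lblot>x, lbr_pow x r v\<rblot>\<rblot> = 2 *\<^sub>L \<lblot>x, lbr_pow x r v\<rblot> + (m + 2 * of_nat r) *\<^sub>L \<lblot>x, lbr_pow x r v\<rblot>"
    using lbr_leibniz[of h x "lbr_pow x r v"] Suc assms(1) by simp
  then show ?case
    by (simp add: algebra_simps)
qed (use assms in simp)

text \<open>The sl2 formula at a lowest weight vector. Since [y, x] = -h, moving \<open>y\<close>
  through the string collects the weights m, m + 2, ..., m + 2r, whose sum is (r + 1)(m +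
  r).\<close>

lemma sl2_lower:
  assumes "\<lblot>x, y\<rblot> = h" "\<lblot>h, x\<rblot> = 2 *\<^sub>L x" "\<lblot>h, v\<rblot> = m *\<^sub>L v" "\<lblot>y, v\<rblot> = 0"
  shows "\<lblot>y, lbr_pow x (Suc r) v\<rblot> = (- of_nat (Suc r) * (m + of_nat r)) *\<^sub>L lbr_pow x r v"
proof (induction r)
  case 0
  show ?case
    using lbr_leibniz[of y x v] assms lbr_antisym[of y x] by simp
next
  case (Suc r)
  let ?w = "lbr_pow x (Suc r) v"
  have "\<lblot>y, \<lblot>x, ?w\<rblot>\<rblot> = \<lblot>\<lblot>y, x\<rblot>, ?w\<rblot> + \<lblot>x, \<lblot>y, ?w\<rblot>\<rblot>"
    by (rule lbr_leibniz)
  also have "\<lblot>\<lblot>y, x\<rblot>, ?w\<rblot> = - (m + 2 * of_nat (Suc r)) *\<^sub>L ?w"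
    using sl2_weight[OF assms(2,3), of "Suc r"] lbr_antisym[of y x] assms(1)
    by (simp add: algebra_simps)
  also have "\<lblot>x, \<lblot>y, ?w\<rblot>\<rblot> = (- of_nat (Suc r) * (m + of_nat r)) *\<^sub>L ?w"
    by (simp only: Suc lbr_scl_right) simp
  also have "- (m + 2 * of_nat (Suc r)) *\<^sub>L ?w + (- of_nat (Suc r) * (m + of_nat r)) *\<^sub>L ?w =
      (- of_nat (Suc (Suc r)) * (m + of_nat (Suc r))) *\<^sub>L ?w"
    by (simp only: scl_add_left[symmetric]) (simp add: algebra_simps)
  finally show ?case by simp
qed

section \<open>Chevalley generators without the Serre relations\<close>

locale km_rels =
  fixes I :: "'i set" and A :: "'i \<Rightarrow> 'i \<Rightarrow> int" and e f :: "'i \<Rightarrow> 'a::complex_lie"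
  assumes gcm: "generalized_cartan_matrix I A"
    and hh: "\<And>i j. i \<in> I \<Longrightarrow> j \<in> I \<Longrightarrow> \<lblot>\<lblot>e i, f i\<rblot>, \<lblot>e j, f j\<rblot>\<rblot> = 0"
    and ef: "\<And>i j. i \<in> I \<Longrightarrow> j \<in> I \<Longrightarrow> i \<noteq> j \<Longrightarrow> \<lblot>e i, f j\<rblot> = 0"
    and he: "\<And>i j. i \<in> I \<Longrightarrow> j \<in> I \<Longrightarrow> \<lblot>\<lblot>e i, f i\<rblot>, e j\<rblot> = of_int (A i j) *\<^sub>L e j"
    and hf: "\<And>i j. i \<in> I \<Longrightarrow> j \<in> I \<Longrightarrow> \<lblot>\<lblot>e i, f i\<rblot>, f j\<rblot> = (- of_int (A i j)) *\<^sub>L f j"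
begin

lemma diag: "i \<in> I \<Longrightarrow> A i i = 2"
  using gcm by (simp add: generalized_cartan_matrix_def)

lemma nonpos: "i \<in> I \<Longrightarrow> j \<in> I \<Longrightarrow> i \<noteq> j \<Longrightarrow> A i j \<le> 0"
  using gcm by (simp add: generalized_cartan_matrix_def)

lemma zero_sym: "i \<in> I \<Longrightarrow> j \<in> I \<Longrightarrow> A i j = 0 \<longleftrightarrow> A j i = 0"
  using gcm by (cases "i = j") (simp_all add: generalized_cartan_matrix_def)

lemma fe: "i \<in> I \<Longrightarrow> j \<in> I \<Longrightarrow> i \<noteq> j \<Longrightarrow> \<lblot>f i, e j\<rblot> = 0"
  using ef[of j i] lbr_antisym[of "f i" "e j"] by simp

text \<open>The Chevalley involution: exchanging \<open>e\<close> and \<open>f\<close> turns every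
  coroot into its negative, and the relations are stable under this. Statements about
  \<open>f\<close> are later obtained from those about \<open>e\<close> in this way.\<close>

lemma swapped: "km_rels I A f e"
proof
  have h: "\<lblot>f i, e i\<rblot> = - \<lblot>e i, f i\<rblot>" for i by (rule lbr_antisym)
  show "\<lblot>\<lblot>f i, e i\<rblot>, \<lblot>f j, e j\<rblot>\<rblot> = 0" if "i \<in> I" "j \<in> I" for i j
    using hh that by (simp add: h)
  show "\<lblot>\<lblot>f i, e i\<rblot>, f j\<rblot> = of_int (A i j) *\<^sub>L f j" if "i \<in> I" "j \<in> I" for i j
    using hf that by (simp add: h)
  show "\<lblot>\<lblot>f i, e i\<rblot>, e j\<rblot> = (- of_int (A i j)) *\<^sub>L e j" if "i \<in> I" "j \<in> I" for i j
    using he that by (simp add: h)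
qed (use gcm fe in auto)

text \<open>For k = i, \<open>e j\<close> is a lowest weight vector for the sl2 of \<open>i\<close>
  with weight \<open>A i j\<close>, and the scalar in \<open>sl2_lower\<close> vanishes at r =
  -\<open>A i j\<close>. For k = j the bracket moves inside to give a power of ad \<open>e i\<close>
  applied to \<open>A j i\<close> times \<open>e i\<close>: zero if the power is positive, and
  otherwise \<open>A i j\<close> = 0 forces \<open>A j i\<close> = 0. For any other k,
  \<open>f k\<close> commutes with both letters.\<close>

lemma f_serre_e:
  assumes "i \<in> I" "j \<in> I" "k \<in> I" "i \<noteq> j"
  shows "\<lblot>f k, lbr_pow (e i) (nat (1 - A i j)) (e j)\<rblot> = 0"
proof (cases "k = i")
  case True
  define r where "r = nat (- A i j)"
  have r: "nat (1 - A i j) = Suc r" "of_nat r = - (of_int (A i j) :: complex)"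
    using nonpos[of i j] assms by (auto simp: r_def)
  have "\<lblot>f i, lbr_pow (e i) (Suc r) (e j)\<rblot> =
      (- of_nat (Suc r) * (of_int (A i j) + of_nat r)) *\<^sub>L lbr_pow (e i) r (e j)"
    by (rule sl2_lower[OF HOL.refl]) (use assms he[of i i] he[of i j] fe diag in auto)
  then show ?thesis using r True by simp
next
  case False
  then have *: "\<lblot>f k, lbr_pow (e i) r (e j)\<rblot> = lbr_pow (e i) r \<lblot>f k, e j\<rblot>" for r
    using assms fe by (intro lbr_pow_commute) auto
  show ?thesis
  proof (cases "k = j")
    case True
    have eh: "\<lblot>e i, \<lblot>f j, e j\<rblot>\<rblot> = of_int (A j i) *\<^sub>L e i"
      using he[of j i] assms lbr_antisym[of "e i" "\<lblot>f j, e j\<rblot>"] lbr_antisym[of "f j" "e j"] by simp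
    show ?thesis
    proof (cases "A i j = 0")
      case True
      then show ?thesis using *[of 1] eh zero_sym[of i j] assms \<open>k = j\<close> by simp
    next
      case False
      then have "nat (1 - A i j) = Suc (Suc (nat (- A i j - 1)))"
        using nonpos[of i j] assms by auto
      then show ?thesis
        using * eh \<open>k = j\<close> by (simp add: funpow_swap1 del: funpow.simps(2)) (simp add: funpow_swap1)
    qed
  qed (use * assms fe in simp)
qed

end

section \<open>Electrical relations from Chevalley and Serre relations\<close>

locale km_serre = km_rels I A e f
  for I :: "'i set" and A and e f :: "'i \<Rightarrow> 'a::complex_lie" +
  assumes serre_e: "\<And>i j. i \<in> I \<Longrightarrow> j \<in> I \<Longrightarrow> i \<noteq> j \<Longrightarrow> lbr_pow (e i) (nat (1 - A i j)) (e j) = 0"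
    and serre_f: "\<And>i j. i \<in> I \<Longrightarrow> j \<in> I \<Longrightarrow> i \<noteq> j \<Longrightarrow> lbr_pow (f i) (nat (1 - A i j)) (f j) = 0"
begin

lemma swapped': "km_serre I A f e"
  by (intro km_serre.intro km_serre_axioms.intro swapped) (auto intro: serre_e serre_f)

lemma e_commute: "i \<in> I \<Longrightarrow> j \<in> I \<Longrightarrow> i \<noteq> j \<Longrightarrow> A i j = 0 \<Longrightarrow> \<lblot>e i, e j\<rblot> = 0"
  using serre_e[of i j] by simp

lemma f_commute: "i \<in> I \<Longrightarrow> j \<in> I \<Longrightarrow> i \<noteq> j \<Longrightarrow> A i j = 0 \<Longrightarrow> \<lblot>f i, f j\<rblot> = 0"
  using serre_f[of i j] by simp

lemma serre_e_2: "i \<in> I \<Longrightarrow> j \<in> I \<Longrightarrow> i \<noteq> j \<Longrightarrow> A i j = -1 \<Longrightarrow> \<lblot>e i, \<lblot>e i, e j\<rblot>\<rblot> = 0"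
  using serre_e[of i j] by (simp add: numeral_2_eq_2)

lemma serre_f_2: "i \<in> I \<Longrightarrow> j \<in> I \<Longrightarrow> i \<noteq> j \<Longrightarrow> A i j = -1 \<Longrightarrow> \<lblot>f i, \<lblot>f i, f j\<rblot>\<rblot> = 0"
  using serre_f[of i j] by (simp add: numeral_2_eq_2)

lemma lbr_h_e: "i \<in> I \<Longrightarrow> j \<in> I \<Longrightarrow> \<lblot>e j, \<lblot>e i, f i\<rblot>\<rblot> = (- of_int (A i j)) *\<^sub>L e j"
  using he[of i j] lbr_antisym[of "e j" "\<lblot>e i, f i\<rblot>"] by simp

lemma lbr_h_f: "i \<in> I \<Longrightarrow> j \<in> I \<Longrightarrow> \<lblot>f j, \<lblot>e i, f i\<rblot>\<rblot> = of_int (A i j) *\<^sub>L f j"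
  using hf[of i j] lbr_antisym[of "f j" "\<lblot>e i, f i\<rblot>"] by simp

text \<open>All four brackets vanish separately. The alternatives with c = 0 admit a node without
  parent, for which \<open>p\<close> may take any value.\<close>

lemma shifted_commute:
  assumes "i \<in> I" "j \<in> I" "i \<noteq> j" "A i j = 0"
    and "c j = 0 \<or> p j \<in> I \<and> p j \<noteq> i" "c i = 0 \<or> p i \<in> I \<and> p i \<noteq> j"
    and "c i = 0 \<or> c j = 0 \<or> p i = p j \<or> A (p i) (p j) = 0"
  shows "\<lblot>e i + c i *\<^sub>L f (p i), e j + c j *\<^sub>L f (p j)\<rblot> = 0"
proof -
  have "\<lblot>e i, e j\<rblot> = 0" by (rule e_commute) fact+
  moreover have "c j *\<^sub>L \<lblot>e i, f (p j)\<rblot> = 0" using assms(1,5) ef[of i "p j"] by auto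
  moreover have "c i *\<^sub>L \<lblot>f (p i), e j\<rblot> = 0" using assms(2,6) fe[of "p i" j] by auto
  moreover have "(c i * c j) *\<^sub>L \<lblot>f (p i), f (p j)\<rblot> = 0"
    using assms(5-7) f_commute[of "p i" "p j"] by (cases "p i = p j") auto
  ultimately show ?thesis
    by (auto simp: lbr_add_left lbr_add_right)
qed

text \<open>Here \<open>i\<close> is the parent of \<open>j\<close> and \<open>k\<close> the parent
  of \<open>i\<close>. The summand \<open>d *\<^sub>L f i\<close> of \<open>v\<close> meets
  \<open>e i\<close> and produces a coroot; bracketing with \<open>u\<close> returns -2
  \<open>e i\<close> and one copy of -c \<open>f k\<close>, and [f k, f i] contributes the second
  copy, which together make -2d \<open>u\<close>. Adjacency of \<open>k\<close> and \<open>j\<close>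
  is allowed, as it occurs in a triangle.\<close>

lemma shifted_adjacent:
  fixes c d :: complex
  assumes ij: "i \<in> I" "j \<in> I" "i \<noteq> j" "A i j = -1" "A j i = -1"
    and k: "c = 0 \<or> k \<in> I \<and> k \<noteq> i \<and> k \<noteq> j \<and> A i k = -1 \<and> A k i = -1"
  defines "u \<equiv> e i + c *\<^sub>L f k" and "v \<equiv> e j + d *\<^sub>L f i"
  shows "\<lblot>u, \<lblot>u, v\<rblot>\<rblot> + (2 * d) *\<^sub>L u = 0"
    and "\<lblot>v, \<lblot>v, u\<rblot>\<rblot> + (2 * d) *\<^sub>L v = 0"
proof -
  let ?h = "\<lblot>e i, f i\<rblot>"
  \<comment> \<open>The brackets with \<open>f k\<close> are recorded with the factor
    \<open>c\<close>, because for c = 0 nothing is known about \<open>k\<close>.\<close>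
  have ckj: "c *\<^sub>L \<lblot>f k, e j\<rblot> = 0" "c *\<^sub>L \<lblot>f k, \<lblot>e i, e j\<rblot>\<rblot> = 0" "c *\<^sub>L \<lblot>e j, \<lblot>f k, f i\<rblot>\<rblot> = 0"
    and ckh: "c *\<^sub>L \<lblot>f k, ?h\<rblot> = (- c) *\<^sub>L f k" "c *\<^sub>L \<lblot>e i, \<lblot>f k, f i\<rblot>\<rblot> = (- c) *\<^sub>L f k"
    and ckk: "c *\<^sub>L \<lblot>f k, \<lblot>f k, f i\<rblot>\<rblot> = 0" "c *\<^sub>L \<lblot>f i, \<lblot>f k, f i\<rblot>\<rblot> = 0"
    if "c \<noteq> 0"
  proof -
    from k that have k: "k \<in> I" "k \<noteq> i" "k \<noteq> j" "A i k = -1" "A k i = -1" by auto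
    show "c *\<^sub>L \<lblot>f k, e j\<rblot> = 0" using fe k ij by simp
    show "c *\<^sub>L \<lblot>f k, \<lblot>e i, e j\<rblot>\<rblot> = 0"
      using fe[of k i] fe[of k j] k ij lbr_leibniz[of "f k" "e i" "e j"] by simp
    show "c *\<^sub>L \<lblot>e j, \<lblot>f k, f i\<rblot>\<rblot> = 0"
      using ef[of j k] ef[of j i] k ij lbr_leibniz[of "e j" "f k" "f i"] by simp
    show "c *\<^sub>L \<lblot>f k, ?h\<rblot> = (- c) *\<^sub>L f k"
      using lbr_h_f[of i k] k ij by simp
    then show "c *\<^sub>L \<lblot>e i, \<lblot>f k, f i\<rblot>\<rblot> = (- c) *\<^sub>L f k"
      using ef[of i k] k ij lbr_leibniz[of "e i" "f k" "f i"] by simp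
    show "c *\<^sub>L \<lblot>f k, \<lblot>f k, f i\<rblot>\<rblot> = 0" using serre_f_2[of k i] k ij by simp
    show "c *\<^sub>L \<lblot>f i, \<lblot>f k, f i\<rblot>\<rblot> = 0"
      using serre_f_2[of i k] k ij lbr_antisym[of "f k" "f i"] by simp
  qed
  have *: "c *\<^sub>L \<lblot>f k, e j\<rblot> = 0" "c *\<^sub>L \<lblot>f k, \<lblot>e i, e j\<rblot>\<rblot> = 0" "c *\<^sub>L \<lblot>e j, \<lblot>f k, f i\<rblot>\<rblot> = 0"
      "c *\<^sub>L \<lblot>f k, ?h\<rblot> = (- c) *\<^sub>L f k" "c *\<^sub>L \<lblot>e i, \<lblot>f k, f i\<rblot>\<rblot> = (- c) *\<^sub>L f k"
      "c *\<^sub>L \<lblot>f k, \<lblot>f k, f i\<rblot>\<rblot> = 0" "c *\<^sub>L \<lblot>f i, \<lblot>f k, f i\<rblot>\<rblot> = 0"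
    using ckj ckh ckk by (cases "c = 0"; simp)+
  have uv: "\<lblot>u, v\<rblot> = \<lblot>e i, e j\<rblot> + d *\<^sub>L ?h + d *\<^sub>L c *\<^sub>L \<lblot>f k, f i\<rblot>"
    unfolding u_def v_def by (simp add: lbr_add_left lbr_add_right *(1) scl_add_right mult.commute)
  have D1: "\<lblot>u, \<lblot>e i, e j\<rblot>\<rblot> = 0"
    unfolding u_def by (simp add: lbr_add_left *(2) serre_e_2 ij)
  have D2: "\<lblot>u, ?h\<rblot> = (-2) *\<^sub>L e i - c *\<^sub>L f k"
    unfolding u_def using lbr_h_e[of i i] diag ij by (simp add: lbr_add_left *(4))
  have D3: "\<lblot>u, c *\<^sub>L \<lblot>f k, f i\<rblot>\<rblot> = - c *\<^sub>L f k"
  proof -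
    have "\<lblot>u, c *\<^sub>L \<lblot>f k, f i\<rblot>\<rblot> = c *\<^sub>L \<lblot>e i, \<lblot>f k, f i\<rblot>\<rblot> + c *\<^sub>L c *\<^sub>L \<lblot>f k, \<lblot>f k, f i\<rblot>\<rblot>"
      unfolding u_def by (simp add: lbr_add_left scl_add_right)
    also have "\<dots> = - c *\<^sub>L f k"
      by (simp only: *) simp
    finally show ?thesis .
  qed
  have "\<lblot>u, \<lblot>u, v\<rblot>\<rblot> = d *\<^sub>L ((-2) *\<^sub>L e i - c *\<^sub>L f k) + d *\<^sub>L (- c *\<^sub>L f k)"
    unfolding uv by (simp only: lbr_add_right D1 lbr_scl_right[of u d] D2 D3) simp
  also have "\<dots> = - ((2 * d) *\<^sub>L u)"
    unfolding u_def
    using scl_add_left[of d d "c *\<^sub>L f k"] by (simp add: algebra_simps)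
  finally show "\<lblot>u, \<lblot>u, v\<rblot>\<rblot> + (2 * d) *\<^sub>L u = 0" by simp
  have vu: "\<lblot>v, u\<rblot> = \<lblot>e j, e i\<rblot> - d *\<^sub>L ?h - d *\<^sub>L c *\<^sub>L \<lblot>f k, f i\<rblot>"
    using uv lbr_antisym[of v u] lbr_antisym[of "e j" "e i"] by simp
  have F1: "\<lblot>v, \<lblot>e j, e i\<rblot>\<rblot> = - d *\<^sub>L e j"
  proof -
    have "\<lblot>f i, \<lblot>e j, e i\<rblot>\<rblot> = - e j"
      using lbr_leibniz[of "f i" "e j" "e i"] fe[of i j] ij lbr_h_e[of i j] lbr_antisym[of "f i" "e i"]
      by simp
    then show ?thesis unfolding v_def using serre_e_2[of j i] ij by (simp add: lbr_add_left)
  qed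
  have F2: "\<lblot>v, ?h\<rblot> = e j + (2 * d) *\<^sub>L f i"
    unfolding v_def using lbr_h_e[of i j] lbr_h_f[of i i] diag ij by (simp add: lbr_add_left mult.commute)
  have F3: "\<lblot>v, c *\<^sub>L \<lblot>f k, f i\<rblot>\<rblot> = 0"
  proof -
    have "\<lblot>v, c *\<^sub>L \<lblot>f k, f i\<rblot>\<rblot> = c *\<^sub>L \<lblot>e j, \<lblot>f k, f i\<rblot>\<rblot> + d *\<^sub>L c *\<^sub>L \<lblot>f i, \<lblot>f k, f i\<rblot>\<rblot>"
      unfolding v_def by (simp add: lbr_add_left scl_add_right mult.commute)
    also have "\<dots> = 0" by (simp only: *) simp
    finally show ?thesis .
  qed
  have "\<lblot>v, \<lblot>v, u\<rblot>\<rblot> = - d *\<^sub>L e j - d *\<^sub>L (e j + (2 * d) *\<^sub>L f i)"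
    unfolding vu by (simp only: lbr_diff_right F1 lbr_scl_right[of v d] F2 F3) simp
  also have "\<dots> = - ((2 * d) *\<^sub>L v)"
  proof -
    have "(2 * d) *\<^sub>L e j = d *\<^sub>L e j + d *\<^sub>L e j"
      by (simp add: scl_add_left[symmetric])
    then show ?thesis
      unfolding v_def by (simp add: scl_add_right algebra_simps)
  qed
  finally show "\<lblot>v, \<lblot>v, u\<rblot>\<rblot> + (2 * d) *\<^sub>L v = 0" by simp
qed

text \<open>Under ad \<open>e i\<close> the string of \<open>f i\<close> is: coroot, -2
  \<open>e i\<close>, 0. So an error term survives exactly for the power 2, that is for
  \<open>A i j\<close> = -1, and it is the one prescribed by the electrical relation. In the other
  relation the second power of ad \<open>u\<close> differs from that of ad \<open>e j\<close> by
  multiples of \<open>e j\<close> and \<open>f i\<close>. These commute, so the third bracket kills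
  the difference, and \<open>A j i \<le> -2\<close> makes the power at least 3.\<close>

lemma shifted_rank2:
  fixes d :: complex
  assumes ij: "i \<in> I" "j \<in> I" "i \<noteq> j" "A j i \<le> -2"
  defines "u \<equiv> e j + d *\<^sub>L f i"
  shows "lbr_pow (e i) (nat (1 - A i j)) u +
      (if A i j = -1 then 2 * d else 0) *\<^sub>L e i = 0"
    and "lbr_pow u (nat (1 - A j i)) (e i) = 0"
proof -
  have 1: "\<lblot>e i, \<lblot>e i, f i\<rblot>\<rblot> = (-2) *\<^sub>L e i"
    using lbr_h_e[of i i] ij diag by simp
  have neq: "A i j \<noteq> 0" using ij zero_sym[of i j] by auto
  then have neg: "A i j \<le> -1" using nonpos[of i j] ij by auto
  have "lbr_pow (e i) (nat (1 - A i j)) (f i) = (if A i j = -1 then -2 else 0) *\<^sub>L e i"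
  proof (cases "A i j = -1")
    case True
    then show ?thesis using 1 by (simp add: numeral_2_eq_2)
  next
    case False
    then have "nat (1 - A i j) = Suc (Suc (Suc (nat (- A i j - 2))))" using neg by auto
    then show ?thesis using 1 False by (simp add: funpow_swap1 del: funpow.simps(2)) (simp add: funpow_swap1)
  qed
  then show "lbr_pow (e i) (nat (1 - A i j)) u + (if A i j = -1 then 2 * d else 0) *\<^sub>L e i = 0"
    unfolding u_def using serre_e[of i j] ij by (auto simp: lbr_pow_add)
  have fij: "\<lblot>f i, e j\<rblot> = 0" using fe ij by simp
  have f: "\<lblot>f i, lbr_pow (e j) (Suc (Suc r)) (e i)\<rblot> = 0" for r
  proof -
    have "\<lblot>f i, lbr_pow (e j) (Suc (Suc r)) (e i)\<rblot> = lbr_pow (e j) (Suc (Suc r)) \<lblot>f i, e i\<rblot>"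
      by (rule lbr_pow_commute[OF fij])
    also have "\<dots> = lbr_pow (e j) r \<lblot>e j, \<lblot>e j, \<lblot>f i, e i\<rblot>\<rblot>\<rblot>"
      by (simp add: funpow_swap1)
    also have "\<lblot>e j, \<lblot>f i, e i\<rblot>\<rblot> = of_int (A i j) *\<^sub>L e j"
      using lbr_h_e[of i j] ij lbr_antisym[of "f i" "e i"] by simp
    finally show ?thesis by simp
  qed
  have u1: "\<lblot>u, e i\<rblot> = \<lblot>e j, e i\<rblot> - d *\<^sub>L \<lblot>e i, f i\<rblot>"
    unfolding u_def using lbr_antisym[of "f i" "e i"] by (simp add: lbr_add_left)
  have u2: "lbr_pow u 2 (e i) = lbr_pow (e j) 2 (e i) + (2 * d * of_int (A i j)) *\<^sub>L e j - (2 * d * d) *\<^sub>L f i"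
  proof -
    have "\<lblot>f i, \<lblot>e j, e i\<rblot>\<rblot> = of_int (A i j) *\<^sub>L e j"
      using lbr_leibniz[of "f i" "e j" "e i"] fij lbr_antisym[of "f i" "e i"] lbr_h_e[of i j] ij by simp
    then have "\<lblot>u, \<lblot>u, e i\<rblot>\<rblot> = \<lblot>e j, \<lblot>e j, e i\<rblot>\<rblot> + (d * of_int (A i j)) *\<^sub>L e j
        + (d * of_int (A i j)) *\<^sub>L e j - (2 * d * d) *\<^sub>L f i"
      unfolding u1 using lbr_h_e[of i j] lbr_h_f[of i i] diag ij
      by (simp add: u_def lbr_add_left lbr_diff_right algebra_simps)
    moreover have "(2 * d * of_int (A i j)) *\<^sub>L e j = (d * of_int (A i j)) *\<^sub>L e j + (d * of_int (A i j)) *\<^sub>L e j"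
      by (simp add: scl_add_left[symmetric])
    ultimately show ?thesis by (simp add: numeral_2_eq_2)
  qed
  have eij: "\<lblot>e j, f i\<rblot> = 0" using ef ij by simp
  have u3: "lbr_pow u (r + 3) (e i) = lbr_pow (e j) (r + 3) (e i)" for r
  proof (induction r)
    case 0
    have "lbr_pow u 3 (e i) = \<lblot>u, lbr_pow u 2 (e i)\<rblot>" by (simp add: eval_nat_numeral)
    also have "\<dots> = \<lblot>e j, lbr_pow (e j) 2 (e i)\<rblot>"
      unfolding u2 using f[of 0] fij eij
      by (simp add: u_def lbr_add_left lbr_add_right lbr_diff_right numeral_2_eq_2)
    finally show ?case by (simp add: eval_nat_numeral)
  next
    case (Suc r)
    then show ?case using f[of "Suc r"] by (simp add: u_def lbr_add_left eval_nat_numeral)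
  qed
  have "nat (1 - A j i) = nat (- A j i - 2) + 3" using ij by auto
  then show "lbr_pow u (nat (1 - A j i)) (e i) = 0"
    using u3[of "nat (- A j i - 2)"] serre_e[of j i] ij by simp
qed

end

section \<open>Functions on words as a module\<close>

text \<open>The Lie algebra acts from the right: the operator of a bracket \<open>[s, t]\<close> applies \<open>s\<close> first.\<close>

primrec lie_act :: "('g \<Rightarrow> ('w \<Rightarrow> complex) \<Rightarrow> 'w \<Rightarrow> complex) \<Rightarrow> 'g lie_term \<Rightarrow>
    ('w \<Rightarrow> complex) \<Rightarrow> 'w \<Rightarrow> complex" where
  "lie_act \<rho> (Gen g) = \<rho> g"
| "lie_act \<rho> Zero = (\<lambda>\<xi> w. 0)"
| "lie_act \<rho> (Add s t) = (\<lambda>\<xi> w. lie_act \<rho> s \<xi> w + lie_act \<rho> t \<xi> w)"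
| "lie_act \<rho> (Scale c t) = (\<lambda>\<xi> w. c * lie_act \<rho> t \<xi> w)"
| "lie_act \<rho> (Br s t) =
    (\<lambda>\<xi> w. lie_act \<rho> t (lie_act \<rho> s \<xi>) w - lie_act \<rho> s (lie_act \<rho> t \<xi>) w)"

definition lin_op :: "(('w \<Rightarrow> complex) \<Rightarrow> 'w \<Rightarrow> complex) \<Rightarrow> bool" where
  "lin_op T \<longleftrightarrow> (\<forall>c \<xi> \<eta>. T (\<lambda>w. c * \<xi> w + \<eta> w) = (\<lambda>w. c * T \<xi> w + T \<eta> w))"

lemma lin_opD: "lin_op T \<Longrightarrow> T (\<lambda>w. c * \<xi> w + \<eta> w) = (\<lambda>w. c * T \<xi> w + T \<eta> w)"
  by (simp add: lin_op_def)

lemma lin_op_zero: "lin_op T \<Longrightarrow> T (\<lambda>w. 0) = (\<lambda>w. 0)"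
  using lin_opD[of T "-1" "\<lambda>w. 0" "\<lambda>w. 0"] by simp

lemma lin_op_scale: "lin_op T \<Longrightarrow> T (\<lambda>w. c * \<xi> w) = (\<lambda>w. c * T \<xi> w)"
  using lin_opD[of T c \<xi> "\<lambda>w. 0"] lin_op_zero[of T] by simp

lemma lin_op_add: "lin_op T \<Longrightarrow> T (\<lambda>w. \<xi> w + \<eta> w) = (\<lambda>w. T \<xi> w + T \<eta> w)"
  using lin_opD[of T 1 \<xi> \<eta>] by simp

lemma lin_op_diff: "lin_op T \<Longrightarrow> T (\<lambda>w. \<xi> w - \<eta> w) = (\<lambda>w. T \<xi> w - T \<eta> w)"
  using lin_opD[of T "-1" \<eta> \<xi>] by simp

lemma lin_op_lie_act:
  assumes "\<And>g. g \<in> X \<Longrightarrow> lin_op (\<rho> g)" "t \<in> lie_terms X"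
  shows "lin_op (lie_act \<rho> t)"
  using assms(2)
proof (induction t)
  case (Br s t)
  then show ?case by (simp add: lin_op_def) (simp add: algebra_simps)
qed (use assms(1) in \<open>auto simp: lin_op_def algebra_simps\<close>)

lemma lie_act_subst: "lie_act \<rho> (lie_subst \<sigma> t) = lie_act (\<lambda>g. lie_act \<rho> (\<sigma> g)) t"
  by (induction t) simp_all

text \<open>The Lie algebra axioms hold for linear operators on all functions, but the relators are
  only required to act as zero on \<open>U\<close>. Invariance of \<open>U\<close> is used for the
  congruence of brackets, where the hypothesis for one factor is applied to the image under the
  other.\<close>

lemma lie_act_sound:
  assumes lin: "\<And>g. g \<in> X \<Longrightarrow> lin_op (\<rho> g)"
    and U: "\<And>c \<xi> \<eta>. \<xi> \<in> U \<Longrightarrow> \<eta> \<in> U \<Longrightarrow> (\<lambda>w. c * \<xi> w + \<eta> w) \<in> U" "(\<lambda>w. 0) \<in> U"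
    and inv: "\<And>g \<xi>. g \<in> X \<Longrightarrow> \<xi> \<in> U \<Longrightarrow> \<rho> g \<xi> \<in> U"
    and R: "\<And>r \<xi>. r \<in> R \<Longrightarrow> r \<in> lie_terms X \<Longrightarrow> \<xi> \<in> U \<Longrightarrow> lie_act \<rho> r \<xi> = (\<lambda>w. 0)"
    and "(s, t) \<in> lie_rel X R" "\<xi> \<in> U"
  shows "lie_act \<rho> s \<xi> = lie_act \<rho> t \<xi>"
proof -
  have U': "(\<lambda>w. \<xi> w + \<eta> w) \<in> U" "(\<lambda>w. c * \<xi> w) \<in> U" "(\<lambda>w. \<xi> w - \<eta> w) \<in> U"
    if "\<xi> \<in> U" "\<eta> \<in> U" for \<xi> \<eta> c
    using U(1)[OF that, of 1] U(1)[OF that(1) U(2), of c] U(1)[OF that(2,1), of "-1"] by simp_all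
  have inv': "lie_act \<rho> t \<xi> \<in> U" if "t \<in> lie_terms X" "\<xi> \<in> U" for t \<xi>
    using that by (induction t arbitrary: \<xi>) (auto intro: inv U U')
  have lin': "lin_op (lie_act \<rho> t)" if "t \<in> lie_terms X" for t
    using lin_op_lie_act[of X \<rho>] lin that by blast
  note lin_simps = lin_op_add[OF lin'] lin_op_scale[OF lin'] lin_op_diff[OF lin']
  have "\<forall>\<xi>\<in>U. lie_act \<rho> s \<xi> = lie_act \<rho> t \<xi>"
    using assms(6)
  proof (induction rule: lie_rel.induct)
    case (br_cong s s' t t')
    have *: "s' \<in> lie_terms X" "t' \<in> lie_terms X"
      using br_cong.hyps lie_rel_in_lie_terms by metis+
    show ?case
    proof
      fix \<xi> assume \<xi>: "\<xi> \<in> U"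
      then show "lie_act \<rho> (Br s t) \<xi> = lie_act \<rho> (Br s' t') \<xi>"
        using br_cong.IH inv'[OF *(1) \<xi>] inv'[OF *(2) \<xi>] by simp
    qed
  qed (auto simp: fun_eq_iff lin_simps R algebra_simps)
  then show ?thesis using assms(7) by blast
qed

section \<open>The dual Verma module over the free algebra\<close>

definition word_weight :: "('i \<Rightarrow> 'i \<Rightarrow> int) \<Rightarrow> 'i \<Rightarrow> 'i list \<Rightarrow> complex" where
  "word_weight A i w = (\<Sum>j\<leftarrow>w. of_int (A i j))"

lemma word_weight_simps [simp]:
  "word_weight A i [] = 0"
  "word_weight A i (j # w) = of_int (A i j) + word_weight A i w"
  "word_weight A i (v @ w) = word_weight A i v + word_weight A i w"
  by (simp_all add: word_weight_def)

text \<open>The dual of the Verma module with lowest weight \<open>0\<close>, whose basis vectors are the words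
  \<open>e\<^sub>j\<^sub>1 \<dots> e\<^sub>j\<^sub>k\<close> applied to the lowest weight vector: there
  \<open>f\<^sub>i (e\<^sub>j w) = e\<^sub>j (f\<^sub>i w) - \<delta>\<^sub>i\<^sub>j h\<^sub>i w\<close> and \<open>h\<^sub>i\<close> is diagonal.\<close>

primrec word_f :: "('i \<Rightarrow> 'i \<Rightarrow> int) \<Rightarrow> 'i \<Rightarrow> 'i list \<Rightarrow> ('i list \<Rightarrow> complex) \<Rightarrow> complex" where
  "word_f A i [] = (\<lambda>\<xi>. 0)"
| "word_f A i (j # w) =
    (\<lambda>\<xi>. word_f A i w (\<lambda>v. \<xi> (j # v)) - (if i = j then word_weight A i w * \<xi> w else 0))"

primrec word_op :: "('i \<Rightarrow> 'i \<Rightarrow> int) \<Rightarrow> 'i chevalley_gen \<Rightarrow>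
    ('i list \<Rightarrow> complex) \<Rightarrow> 'i list \<Rightarrow> complex" where
  "word_op A (E i) = (\<lambda>\<xi> w. \<xi> (i # w))"
| "word_op A (F i) = (\<lambda>\<xi> w. word_f A i w \<xi>)"

lemma word_f_lin: "word_f A i w (\<lambda>v. c * \<xi> v + \<eta> v) = c * word_f A i w \<xi> + word_f A i w \<eta>"
  by (induction w arbitrary: \<xi> \<eta>) (auto simp: algebra_simps)

lemma lin_word_op: "lin_op (word_op A g)"
  by (cases g) (auto simp: lin_op_def word_f_lin)

lemma lin_word_act: "lin_op (lie_act (word_op A) t)"
  using lin_op_lie_act[of UNIV "word_op A" t] lin_word_op by (auto simp: lie_terms_def)

text \<open>The transposed form of [h_i, f_j] = -a_ij f_j: \<open>f j\<close> removes one letter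
  \<open>j\<close> from a word, which lowers its weight by \<open>A i j\<close>.\<close>

lemma word_f_weight:
  "word_f A j w (\<lambda>v. word_weight A i v * \<xi> v) = (word_weight A i w - of_int (A i j)) * word_f A j w \<xi>"
proof (induction w arbitrary: \<xi>)
  case (Cons k w)
  have "word_f A j w (\<lambda>v. (of_int (A i k) + word_weight A i v) * \<xi> (k # v)) =
      of_int (A i k) * word_f A j w (\<lambda>v. \<xi> (k # v)) +
      word_f A j w (\<lambda>v. word_weight A i v * \<xi> (k # v))"
    using word_f_lin[of A j w "of_int (A i k)" "\<lambda>v. \<xi> (k # v)"
      "\<lambda>v. word_weight A i v * \<xi> (k # v)"] by (simp add: distrib_right)
  then show ?case by (simp add: Cons) (simp add: algebra_simps)
qed simp

lemma word_act_h: "lie_act (word_op A) (chevalley_h i) \<xi> w = word_weight A i w * \<xi> w"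
  by simp

text \<open>Separated from the Serre relators because these hold on all functions on words, whereas
  the Serre relations of the \<open>e i\<close> hold only on a submodule.\<close>

definition km_base_relators :: "'i set \<Rightarrow> ('i \<Rightarrow> 'i \<Rightarrow> int) \<Rightarrow> 'i chevalley_gen lie_term set" where
  "km_base_relators I A =
    {Br (chevalley_h i) (chevalley_h j) | i j. i \<in> I \<and> j \<in> I} \<union>
    {Br (Gen (E i)) (Gen (F j)) | i j. i \<in> I \<and> j \<in> I \<and> i \<noteq> j} \<union>
    {Add (Br (chevalley_h i) (Gen (E j))) (Scale (- of_int (A i j)) (Gen (E j))) | i j.
      i \<in> I \<and> j \<in> I} \<union>
    {Add (Br (chevalley_h i) (Gen (F j))) (Scale (of_int (A i j)) (Gen (F j))) | i j.
      i \<in> I \<and> j \<in> I}"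

abbreviation serre_term :: "('i \<Rightarrow> 'i \<Rightarrow> int) \<Rightarrow> ('i \<Rightarrow> 'g) \<Rightarrow> 'i \<Rightarrow> 'i \<Rightarrow> 'g lie_term" where
  "serre_term A G i j \<equiv> ad_pow (Gen (G i)) (nat (1 - A i j)) (Gen (G j))"

lemma kac_moody_relators_eq:
  "kac_moody_relators I A = km_base_relators I A \<union>
    {serre_term A E i j | i j. i \<in> I \<and> j \<in> I \<and> i \<noteq> j} \<union>
    {serre_term A F i j | i j. i \<in> I \<and> j \<in> I \<and> i \<noteq> j}"
  unfolding kac_moody_relators_def km_base_relators_def by simp

lemma chevalley_gens_iff [simp]:
  "E i \<in> chevalley_gens I \<longleftrightarrow> i \<in> I" "F i \<in> chevalley_gens I \<longleftrightarrow> i \<in> I"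
  by (auto simp: chevalley_gens_def)

lemma lie_emb_ad_pow:
  "s \<in> lie_terms X \<Longrightarrow> t \<in> lie_terms X \<Longrightarrow>
    lie_emb X R (ad_pow s k t) = lbr_pow (lie_emb X R s) k (lie_emb X R t)"
  by (induction k) (simp_all add: lie_emb_Br)

lemma km_rels_presented:
  assumes "generalized_cartan_matrix I A" "km_base_relators I A \<subseteq> R"
  shows "km_rels I A (\<lambda>i. lie_emb (chevalley_gens I) R (Gen (E i)))
    (\<lambda>i. lie_emb (chevalley_gens I) R (Gen (F i)))"
proof -
  let ?v = "\<lambda>g. lie_emb (chevalley_gens I) R (Gen g)"
  have rel: "lie_val ?v r = 0" if "r \<in> km_base_relators I A" for r
    using that assms(2) by (intro lie_emb_relator) (auto simp: km_base_relators_def)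
  show ?thesis
  proof
    fix i j assume ij: "i \<in> I" "j \<in> I"
    show "\<lblot>\<lblot>?v (E i), ?v (F i)\<rblot>, \<lblot>?v (E j), ?v (F j)\<rblot>\<rblot> = 0"
      using rel[of "Br (chevalley_h i) (chevalley_h j)"] ij by (auto simp: km_base_relators_def)
    show "\<lblot>?v (E i), ?v (F j)\<rblot> = 0" if "i \<noteq> j"
      using rel[of "Br (Gen (E i)) (Gen (F j))"] ij that by (auto simp: km_base_relators_def)
    show "\<lblot>\<lblot>?v (E i), ?v (F i)\<rblot>, ?v (E j)\<rblot> = of_int (A i j) *\<^sub>L ?v (E j)"
      using rel[of "Add (Br (chevalley_h i) (Gen (E j))) (Scale (- of_int (A i j)) (Gen (E j)))"] ij
      by (auto simp: km_base_relators_def)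
    show "\<lblot>\<lblot>?v (E i), ?v (F i)\<rblot>, ?v (F j)\<rblot> = (- of_int (A i j)) *\<^sub>L ?v (F j)"
      using rel[of "Add (Br (chevalley_h i) (Gen (F j))) (Scale (of_int (A i j)) (Gen (F j)))"] ij
      by (auto simp: km_base_relators_def eq_neg_iff_add_eq_0)
  qed fact
qed

lemma km_serre_presented:
  assumes "generalized_cartan_matrix I A"
  shows "km_serre I A (\<lambda>i. lie_emb (chevalley_gens I) (kac_moody_relators I A) (Gen (E i)))
    (\<lambda>i. lie_emb (chevalley_gens I) (kac_moody_relators I A) (Gen (F i)))"
proof -
  let ?v = "\<lambda>g. lie_emb (chevalley_gens I) (kac_moody_relators I A) (Gen g)"
  have rel: "lie_val ?v r = 0" if "r \<in> kac_moody_relators I A" "r \<in> lie_terms (chevalley_gens I)" for r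
    using that by (rule lie_emb_relator)
  have "lie_val ?v (serre_term A E i j) = 0 \<and> lie_val ?v (serre_term A F i j) = 0"
    if "i \<in> I" "j \<in> I" "i \<noteq> j" for i j
  proof -
    have "serre_term A E i j \<in> kac_moody_relators I A" "serre_term A F i j \<in> kac_moody_relators I A"
      unfolding kac_moody_relators_eq using that by blast+
    then show ?thesis using that by (auto intro!: rel)
  qed
  moreover have "km_base_relators I A \<subseteq> kac_moody_relators I A"
    unfolding kac_moody_relators_eq by blast
  ultimately show ?thesis
    by (intro km_serre.intro km_serre_axioms.intro km_rels_presented[OF assms])
      (simp_all add: lie_val_ad_pow)
qed

lemma word_act_base:
  assumes "(s, t) \<in> lie_rel (chevalley_gens I) (km_base_relators I A)"
  shows "lie_act (word_op A) s \<xi> = lie_act (word_op A) t \<xi>"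
  by (rule lie_act_sound[where U = UNIV, OF lin_word_op _ _ _ _ assms])
    (auto simp: km_base_relators_def fun_eq_iff word_f_weight left_diff_distrib distrib_right)

lemma word_act_commute:
  assumes "(Br s t, Zero) \<in> lie_rel (chevalley_gens I) (km_base_relators I A)"
  shows "lie_act (word_op A) t (lie_act (word_op A) s \<xi>) = lie_act (word_op A) s (lie_act (word_op A) t \<xi>)"
  using word_act_base[OF assms, of \<xi>] by (simp add: fun_eq_iff)

context
  fixes I :: "'i set" and A :: "'i \<Rightarrow> 'i \<Rightarrow> int"
  assumes gcm: "generalized_cartan_matrix I A"
begin

private abbreviation "X \<equiv> chevalley_gens I"
private abbreviation "R \<equiv> km_base_relators I A"
private abbreviation "\<kappa> \<equiv> lie_emb X R"
private abbreviation "act \<equiv> lie_act (word_op A)"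

interpretation b: km_rels I A "\<lambda>i. \<kappa> (Gen (E i))" "\<lambda>i. \<kappa> (Gen (F i))"
  by (rule km_rels_presented[OF gcm]) simp

text \<open>Stated in the algebra without Serre relations, so that it yields commuting operators on
  the whole space of functions.\<close>

lemma serre_term_commute_base:
  assumes "i \<in> I" "j \<in> I" "k \<in> I" "i \<noteq> j"
  shows "(Br (Gen (F k)) (serre_term A E i j), Zero) \<in> lie_rel X R"
    and "(Br (Gen (E k)) (serre_term A F i j), Zero) \<in> lie_rel X R"
  using assms b.f_serre_e[of i j k] km_rels.f_serre_e[OF b.swapped, of i j k]
  by (simp_all add: lie_emb_eq_0_iff[symmetric] lie_emb_Br lie_emb_ad_pow)

text \<open>The Serre term commutes with every \<open>e k\<close>, so its action at
  \<open>k # w\<close> is its action at \<open>w\<close>, down to the empty word, where every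
  \<open>f\<close> vanishes. A letter outside \<open>I\<close> is simply skipped by the
  \<open>f i\<close> with i in \<open>I\<close>.\<close>

lemma word_act_serre_F:
  assumes "i \<in> I" "j \<in> I" "i \<noteq> j"
  shows "act (serre_term A F i j) \<xi> w = 0"
proof (induction w arbitrary: \<xi>)
  case Nil
  have "act t \<xi> [] = 0" if "t \<in> lie_terms (F ` I)" for t
    using that by (induction t arbitrary: \<xi>) auto
  then show ?case using assms by simp
next
  case (Cons k w)
  have "act (serre_term A F i j) \<xi> (k # w) = act (serre_term A F i j) (\<lambda>v. \<xi> (k # v)) w"
  proof (cases "k \<in> I")
    case True
    show ?thesis
      using word_act_commute[OF serre_term_commute_base(2)[OF assms(1,2) True assms(3)], of \<xi>]
      by (simp add: fun_eq_iff)
  next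
    case False
    have "act t \<xi> (k # w) = act t (\<lambda>v. \<xi> (k # v)) w" if "t \<in> lie_terms (F ` I)" for t \<xi> w
      using that
    proof (induction t arbitrary: \<xi> w)
      case (Gen g)
      then show ?case using False by auto
    next
      case (Br s t)
      then have "(\<lambda>v. act s \<xi> (k # v)) = act s (\<lambda>v. \<xi> (k # v))"
          "(\<lambda>v. act t \<xi> (k # v)) = act t (\<lambda>v. \<xi> (k # v))"
        by auto
      then show ?case using Br by simp
    qed auto
    then show ?thesis using assms by simp
  qed
  then show ?case using Cons by simp
qed

text \<open>The Serre element is a weight vector: bracketing it with a coroot gives a multiple of
  it. Hence its kernel is stable under the operator of the coroot, which is multiplication by the
  weight of the word.\<close>

lemma word_act_serre_E_weight:
  assumes "i \<in> I" "j \<in> I" "k \<in> I" "act (serre_term A E i j) \<xi> = (\<lambda>w. 0)"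
  shows "act (serre_term A E i j) (\<lambda>v. word_weight A k v * \<xi> v) = (\<lambda>w. 0)"
proof -
  let ?S = "serre_term A E i j"
  have *: "\<exists>c. \<kappa> (Br (chevalley_h k) (ad_pow (Gen (E i)) r (Gen (E j)))) =
      \<kappa> (Scale c (ad_pow (Gen (E i)) r (Gen (E j))))" for r
  proof (induction r)
    case 0
    show ?case
      using b.he[of k j] assms by (intro exI[of _ "of_int (A k j)"]) (simp add: lie_emb_Br lie_emb_Scale)
  next
    case (Suc r)
    let ?x = "\<kappa> (Gen (E i))" and ?y = "\<kappa> (ad_pow (Gen (E i)) r (Gen (E j)))"
      and ?h = "\<kappa> (chevalley_h k)"
    obtain c where "\<lblot>?h, ?y\<rblot> = c *\<^sub>L ?y"
      using Suc assms by (auto simp: lie_emb_Br[of "chevalley_h k"] lie_emb_Scale)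
    moreover have "\<lblot>?h, ?x\<rblot> = of_int (A k i) *\<^sub>L ?x"
      using b.he[of k i] assms by (simp add: lie_emb_Br)
    ultimately have "\<lblot>?h, \<lblot>?x, ?y\<rblot>\<rblot> = (of_int (A k i) + c) *\<^sub>L \<lblot>?x, ?y\<rblot>"
      using lbr_leibniz[of ?h ?x ?y] by (simp add: scl_add_left)
    then show ?case
      using assms by (intro exI[of _ "of_int (A k i) + c"])
        (simp add: lie_emb_Br[of "chevalley_h k"] lie_emb_Br[of "Gen (E i)"] lie_emb_Scale)
  qed
  obtain c where "\<kappa> (Br (chevalley_h k) ?S) = \<kappa> (Scale c ?S)"
    using * by blast
  then have "(Br (chevalley_h k) ?S, Scale c ?S) \<in> lie_rel X R"
    using assms by (simp add: lie_emb_eq_iff)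
  from word_act_base[OF this, of \<xi>]
  have "act ?S (act (chevalley_h k) \<xi>) w = 0" for w
    using assms(4) unfolding lie_act.simps(5)[of _ "chevalley_h k" ?S]
    by (simp add: fun_eq_iff lin_op_zero[OF lin_word_act])
  moreover have "act (chevalley_h k) \<xi> = (\<lambda>v. word_weight A k v * \<xi> v)"
    by (simp add: word_act_h fun_eq_iff)
  ultimately show ?thesis by (simp add: fun_eq_iff)
qed

text \<open>A function on words is a linear form on the free associative algebra. The condition says
  that the form vanishes on all products w S v with a Serre element S: \<open>w\<close> is the
  prefix, and v is the argument at which the resulting function is evaluated.\<close>

definition serre_functions :: "('i list \<Rightarrow> complex) set" where
  "serre_functions = {\<xi>. \<forall>w i j. set w \<subseteq> I \<longrightarrow> i \<in> I \<longrightarrow> j \<in> I \<longrightarrow> i \<noteq> j \<longrightarrow>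
    act (serre_term A E i j) (\<lambda>v. \<xi> (w @ v)) = (\<lambda>v. 0)}"

lemma serre_functionsD:
  assumes "\<xi> \<in> serre_functions" "set w \<subseteq> I" "i \<in> I" "j \<in> I" "i \<noteq> j"
  shows "act (serre_term A E i j) (\<lambda>v. \<xi> (w @ v)) = (\<lambda>v. 0)"
  using assms by (simp add: serre_functions_def)

lemma serre_functions_shift:
  assumes "\<xi> \<in> serre_functions" "l \<in> I"
  shows "(\<lambda>v. \<xi> (l # v)) \<in> serre_functions"
  using serre_functionsD[OF assms(1), of "l # _"] assms(2)
  by (simp add: serre_functions_def)

lemma serre_functions_weight:
  assumes "\<xi> \<in> serre_functions" "set w \<subseteq> I" "i \<in> I" "j \<in> I" "i \<noteq> j" "k \<in> I"
  shows "act (serre_term A E i j) (\<lambda>v. word_weight A k (w @ v) * \<xi> (w @ v)) = (\<lambda>v. 0)"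
proof -
  have 0: "act (serre_term A E i j) (\<lambda>v. \<xi> (w @ v)) = (\<lambda>v. 0)"
    using assms by (auto simp: serre_functions_def)
  have "act (serre_term A E i j)
      (\<lambda>v. word_weight A k w * \<xi> (w @ v) + word_weight A k v * \<xi> (w @ v)) = (\<lambda>v. 0)"
    using word_act_serre_E_weight[OF assms(3,4,6) 0] 0 by (simp add: lin_opD[OF lin_word_act])
  then show ?thesis by (simp add: distrib_right)
qed

text \<open>Move \<open>f k\<close> through the prefix \<open>w\<close> letter by letter. Behind the
  prefix it meets the Serre element, with which it commutes; each letter \<open>k\<close> that it
  passes leaves a weight factor, and \<open>serre_functions_weight\<close> deals with that.\<close>

lemma serre_functions_F:
  assumes "\<xi> \<in> serre_functions" "k \<in> I"
  shows "(\<lambda>w. word_f A k w \<xi>) \<in> serre_functions"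
proof -
  have "act (serre_term A E i j) (\<lambda>v. word_f A k (w @ v) \<xi>) = (\<lambda>v. 0)"
    if "set w \<subseteq> I" and ij: "i \<in> I" "j \<in> I" "i \<noteq> j" for w i j
    using that(1) assms(1)
  proof (induction w arbitrary: \<xi>)
    case Nil
    have "act (serre_term A E i j) \<xi> = (\<lambda>v. 0)"
      using serre_functionsD[OF Nil(2), of "[]"] ij by simp
    then show ?case
      using word_act_commute[OF serre_term_commute_base(1)[OF ij(1,2) assms(2) ij(3)], of \<xi>]
        lin_op_zero[OF lin_word_op, of A "F k"]
      by simp
  next
    case (Cons l w)
    have shift: "(\<lambda>v. \<xi> (l # v)) \<in> serre_functions"
      using Cons.prems by (auto intro: serre_functions_shift)
    show ?case
    proof (cases "k = l")
      case True
      show ?thesis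
        using Cons.IH[OF _ shift] Cons.prems serre_functions_weight[OF Cons.prems(2) _ ij assms(2), of w] True
        by (simp add: lin_op_diff[OF lin_word_act])
    next
      case False
      then show ?thesis using Cons.IH[OF _ shift] Cons.prems by simp
    qed
  qed
  then show ?thesis by (auto simp: serre_functions_def)
qed

theorem word_act_kac_moody:
  assumes "(s, t) \<in> lie_rel X (kac_moody_relators I A)" "\<xi> \<in> serre_functions"
  shows "act s \<xi> = act t \<xi>"
proof (rule lie_act_sound[where U = serre_functions, OF lin_word_op _ _ _ _ assms])
  show "(\<lambda>w. c * \<xi> w + \<eta> w) \<in> serre_functions" if "\<xi> \<in> serre_functions" "\<eta> \<in> serre_functions" for c \<xi> \<eta>
    using that by (auto simp: serre_functions_def lin_opD[OF lin_word_act])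
  show "(\<lambda>w. 0) \<in> serre_functions"
    by (auto simp: serre_functions_def lin_op_zero[OF lin_word_act])
  show "word_op A g \<xi> \<in> serre_functions" if "g \<in> X" "\<xi> \<in> serre_functions" for g \<xi>
  proof (cases g)
    case (E l)
    then show ?thesis
      using that by (auto intro: serre_functions_shift)
  next
    case (F l)
    then show ?thesis using that serre_functions_F by auto
  qed
  show "act r \<xi> = (\<lambda>w. 0)"
    if r: "r \<in> kac_moody_relators I A" "r \<in> lie_terms X" and \<xi>: "\<xi> \<in> serre_functions" for r \<xi>
  proof -
    consider "r \<in> R" | i j where "r = serre_term A E i j" "i \<in> I" "j \<in> I" "i \<noteq> j"
      | i j where "r = serre_term A F i j" "i \<in> I" "j \<in> I" "i \<noteq> j"
      using r by (auto simp: kac_moody_relators_eq)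
    then show ?thesis
    proof cases
      case 1
      then show ?thesis
        using word_act_base[OF lie_rel.relator[OF 1 r(2)]] by simp
    next
      case 2
      then show ?thesis
        using serre_functionsD[OF \<xi>, of "[]"] by simp
    next
      case 3
      then show ?thesis using word_act_serre_F by (simp add: fun_eq_iff)
    qed
  qed
qed

end

section \<open>Injectivity by passing to leading terms\<close>

definition lin_form :: "('a::complex_lie \<Rightarrow> complex) \<Rightarrow> bool" where
  "lin_form l \<longleftrightarrow> (\<forall>x y. l (x + y) = l x + l y) \<and> (\<forall>c x. l (c *\<^sub>L x) = c * l x)"

lemma lin_form_add: "lin_form l \<Longrightarrow> l (x + y) = l x + l y"
  and lin_form_scl: "lin_form l \<Longrightarrow> l (c *\<^sub>L x) = c * l x"
  by (simp_all add: lin_form_def)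

lemma lin_form_zero: "lin_form l \<Longrightarrow> l 0 = 0"
  using lin_form_scl[of l 0 0] by simp

lemma lin_form_minus: "lin_form l \<Longrightarrow> l (- x) = - l x"
  using lin_form_scl[of l "-1" x] by simp

lemma lin_form_diff: "lin_form l \<Longrightarrow> l (x - y) = l x - l y"
  using lin_form_add[of l x "- y"] lin_form_minus[of l y] by simp

lemma lin_form_lbr: "lin_form l \<Longrightarrow> lin_form (\<lambda>y. l \<lblot>x, y\<rblot>)"
  by (simp add: lin_form_def lbr_add_right)

lemma separating_form:
  assumes "cl.subspace S" "x \<notin> S"
  obtains l where "lin_form l" "\<And>y. y \<in> S \<Longrightarrow> l y = 0" "l x = 1"
proof -
  interpret c: vector_space "(*) :: complex \<Rightarrow> complex \<Rightarrow> complex"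
    by unfold_locales (simp_all add: algebra_simps)
  interpret p: vector_space_pair "scl :: complex \<Rightarrow> 'a \<Rightarrow> 'a" "(*) :: complex \<Rightarrow> complex \<Rightarrow> complex" ..
  obtain B where B: "B \<subseteq> S" "cl.independent B" "S \<subseteq> cl.span B"
    using cl.maximal_independent_subset[of S] by blast
  have "cl.span B = S"
    using B cl.span_minimal[OF B(1) assms(1)] by blast
  then have ind: "cl.independent (insert x B)"
    using B(2) assms(2) by (simp add: cl.independent_insert)
  then obtain l where l: "Vector_Spaces.linear scl (*) l" "\<forall>b\<in>insert x B. l b = (if b = x then 1 else 0)"
    using p.linear_independent_extend[OF ind, of "\<lambda>b. if b = x then 1 else 0"] by blast
  interpret l: Vector_Spaces.linear scl "(*)" l by fact
  have "l b = 0" if "b \<in> B" for b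
  proof -
    have "b \<noteq> x" using that B(1) assms(2) by blast
    then show ?thesis using l(2) that by simp
  qed
  then have "l y = 0" if "y \<in> cl.span B" for y
    using that by (rule l.eq_0_on_span)
  moreover have "lin_form l" using l.add l.scale by (simp add: lin_form_def)
  ultimately show thesis using that[of l] l(2) \<open>cl.span B = S\<close> by simp
qed

section \<open>The degree filtration and Dynkin's identity\<close>

primrec lie_deg :: "'g lie_term \<Rightarrow> nat" where
  "lie_deg (Gen g) = 1"
| "lie_deg Zero = 1"
| "lie_deg (Add s t) = max (lie_deg s) (lie_deg t)"
| "lie_deg (Scale c t) = lie_deg t"
| "lie_deg (Br s t) = lie_deg s + lie_deg t"

text \<open>\<open>Zero\<close> has degree 1 rather than 0, so no term has degree 0. Hence
  \<open>lie_filt 0\<close> is trivial, and this is where the descent in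
  \<open>shifted_injective\<close> ends.\<close>

lemma lie_deg_pos: "0 < lie_deg t"
  by (induction t) auto

lemma lie_deg_neq_0 [simp]: "lie_deg t \<noteq> 0"
  using lie_deg_pos[of t] by simp

text \<open>The derivation of the free Lie algebra that multiplies a homogeneous element by its
  degree. It is defined on terms, since it need not respect inhomogeneous relations such as the
  electrical ones.\<close>

primrec lie_deriv :: "'g lie_term \<Rightarrow> 'g lie_term" where
  "lie_deriv (Gen g) = Gen g"
| "lie_deriv Zero = Zero"
| "lie_deriv (Add s t) = Add (lie_deriv s) (lie_deriv t)"
| "lie_deriv (Scale c t) = Scale c (lie_deriv t)"
| "lie_deriv (Br s t) = Add (Br (lie_deriv s) t) (Br s (lie_deriv t))"

lemma lie_deg_deriv [simp]: "lie_deg (lie_deriv t) = lie_deg t"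
  by (induction t) auto

lemma lie_deriv_in_lie_terms [simp]: "t \<in> lie_terms X \<Longrightarrow> lie_deriv t \<in> lie_terms X"
  by (induction t) auto

lemma lie_deg_ad_pow [simp]: "lie_deg (ad_pow (Gen i) m (Gen j)) = Suc m"
  by (induction m) auto

text \<open>Right-normed bracketing has no natural value at the empty word. This is why Dynkin's
  identity is split into one lemma for nonempty words and one for the empty word.\<close>

fun right_bracket :: "('i \<Rightarrow> 'a) \<Rightarrow> 'i list \<Rightarrow> 'a::complex_lie" where
  "right_bracket u [] = 0"
| "right_bracket u [i] = u i"
| "right_bracket u (i # j # w) = \<lblot>u i, right_bracket u (j # w)\<rblot>"

lemma right_bracket_Cons: "w \<noteq> [] \<Longrightarrow> right_bracket u (i # w) = \<lblot>u i, right_bracket u w\<rblot>"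
  by (cases w) auto

lemma right_bracket_append:
  "w \<noteq> [] \<Longrightarrow> right_bracket u (v @ w) = foldr (\<lambda>i. lbr (u i)) v (right_bracket u w)"
  by (induction v) (auto simp: right_bracket_Cons)

context
  fixes X :: "'i set" and R :: "'i lie_term set"
begin

private abbreviation "\<tau> \<equiv> lie_emb X R"
private abbreviation "u \<equiv> \<lambda>i. \<tau> (Gen i)"

definition lie_filt :: "nat \<Rightarrow> 'i lie_prod set" where
  "lie_filt d = cl.span (\<tau> ` {t \<in> lie_terms X. lie_deg t \<le> d})"

lemma lie_filt_subspace: "cl.subspace (lie_filt d)"
  unfolding lie_filt_def by (rule cl.subspace_span)

lemmas lie_filt_closed = cl.subspace_add[OF lie_filt_subspace] cl.subspace_diff[OF lie_filt_subspace]
  cl.subspace_scale[OF lie_filt_subspace] cl.subspace_0[OF lie_filt_subspace]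
  cl.subspace_neg[OF lie_filt_subspace]

lemma lie_filt_0: "lie_filt 0 = {0}"
  by (simp add: lie_filt_def)

lemma lie_filt_mono: "x \<in> lie_filt a \<Longrightarrow> a \<le> b \<Longrightarrow> x \<in> lie_filt b"
  unfolding lie_filt_def using cl.span_mono[of "\<tau> ` {t \<in> lie_terms X. lie_deg t \<le> a}" "\<tau> ` {t \<in> lie_terms X. lie_deg t \<le> b}"]
  by fastforce

lemma lie_filtI: "t \<in> lie_terms X \<Longrightarrow> lie_deg t \<le> d \<Longrightarrow> \<tau> t \<in> lie_filt d"
  unfolding lie_filt_def by (rule cl.span_base) blast

lemma lie_filt_lbr:
  assumes "x \<in> lie_filt a" "y \<in> lie_filt b"
  shows "\<lblot>x, y\<rblot> \<in> lie_filt (a + b)"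
  using assms(1) unfolding lie_filt_def[of a]
proof (induction rule: cl.span_induct_alt)
  case base
  then show ?case by (simp add: lie_filt_closed)
next
  case (step c x x')
  then obtain s where s: "s \<in> lie_terms X" "lie_deg s \<le> a" "x = \<tau> s" by auto
  have "\<lblot>x, y\<rblot> \<in> lie_filt (a + b)"
    using assms(2) unfolding lie_filt_def[of b]
  proof (induction rule: cl.span_induct_alt)
    case base
    then show ?case by (simp add: lie_filt_closed)
  next
    case (step c y y')
    then obtain t where t: "t \<in> lie_terms X" "lie_deg t \<le> b" "y = \<tau> t" by auto
    then have "\<lblot>x, y\<rblot> = \<tau> (Br s t)" using s by (simp add: lie_emb_Br)
    also have "\<dots> \<in> lie_filt (a + b)" using s t by (intro lie_filtI) auto
    finally show ?case using step by (simp add: lbr_add_right lie_filt_closed)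
  qed
  then show ?case using step by (simp add: lbr_add_left lie_filt_closed)
qed

text \<open>Linear combinations of terms are again terms without increase of degree, so the span
  consists of values of terms; \<open>d \<ge> 1\<close> leaves room for \<open>Zero\<close>.\<close>

lemma lie_filt_term:
  assumes "x \<in> lie_filt d" "d \<ge> 1"
  shows "\<exists>t\<in>lie_terms X. lie_deg t \<le> d \<and> x = \<tau> t"
  using assms(1) unfolding lie_filt_def
proof (induction rule: cl.span_induct_alt)
  case base
  then show ?case using assms(2) by (intro bexI[of _ Zero]) (auto simp: lie_emb_Zero)
next
  case (step c x y)
  then obtain s t where "s \<in> lie_terms X" "lie_deg s \<le> d" "x = \<tau> s"
      "t \<in> lie_terms X" "lie_deg t \<le> d" "y = \<tau> t"
    by auto
  then show ?case
    by (intro bexI[of _ "Add (Scale c s) t"]) (auto simp: lie_emb_Add lie_emb_Scale)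
qed

text \<open>Euler's identity modulo lower degree. The bound \<open>d\<close> may exceed the formal
  degree of a subterm of a sum; then both summands already lie in \<open>lie_filt (d - 1)\<close>,
  which is what \<open>reduce\<close> takes care of.\<close>

lemma lie_deriv_leading:
  assumes "t \<in> lie_terms X" "lie_deg t \<le> d"
  shows "\<tau> (lie_deriv t) - of_nat d *\<^sub>L \<tau> t \<in> lie_filt (d - 1)"
  using assms
proof (induction t arbitrary: d)
  have reduce: "\<tau> (lie_deriv t) - of_nat d *\<^sub>L \<tau> t \<in> lie_filt (d - 1)"
    if t: "t \<in> lie_terms X" "lie_deg t \<le> d"
      and eq: "\<tau> (lie_deriv t) - of_nat (lie_deg t) *\<^sub>L \<tau> t \<in> lie_filt (lie_deg t - 1)" for t d
  proof (cases "lie_deg t = d")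
    case False
    then show ?thesis
      using t by (intro lie_filt_closed lie_filtI) auto
  qed (use eq in simp)
  {
    case (Gen i)
    show ?case by (rule reduce) (use Gen in \<open>simp_all add: lie_filt_closed(4)\<close>)
  next
    case Zero
    show ?case by (rule reduce) (use Zero in \<open>simp_all add: lie_filt_closed(4) lie_emb_Zero\<close>)
  next
    case (Add s t)
    have "(\<tau> (lie_deriv s) - of_nat d *\<^sub>L \<tau> s) + (\<tau> (lie_deriv t) - of_nat d *\<^sub>L \<tau> t) \<in> lie_filt (d - 1)"
      by (intro lie_filt_closed(1) Add.IH) (use Add.prems in auto)
    then show ?case using Add.prems by (simp add: lie_emb_Add algebra_simps)
  next
    case (Scale c t)
    have "c *\<^sub>L (\<tau> (lie_deriv t) - of_nat d *\<^sub>L \<tau> t) \<in> lie_filt (d - 1)"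
      by (intro lie_filt_closed(3) Scale.IH) (use Scale.prems in auto)
    then show ?case using Scale.prems by (simp add: lie_emb_Scale algebra_simps)
  next
    case (Br s t)
    let ?a = "lie_deg s" and ?b = "lie_deg t"
    have "\<lblot>\<tau> (lie_deriv s) - of_nat ?a *\<^sub>L \<tau> s, \<tau> t\<rblot> \<in> lie_filt (?a - 1 + ?b)"
      using Br by (intro lie_filt_lbr lie_filtI) auto
    moreover have "\<lblot>\<tau> s, \<tau> (lie_deriv t) - of_nat ?b *\<^sub>L \<tau> t\<rblot> \<in> lie_filt (?a + (?b - 1))"
      using Br by (intro lie_filt_lbr lie_filtI) auto
    ultimately have sum: "\<lblot>\<tau> (lie_deriv s) - of_nat ?a *\<^sub>L \<tau> s, \<tau> t\<rblot> +
        \<lblot>\<tau> s, \<tau> (lie_deriv t) - of_nat ?b *\<^sub>L \<tau> t\<rblot> \<in> lie_filt (?a + ?b - 1)"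
      using lie_deg_pos[of s] lie_deg_pos[of t] by (simp add: lie_filt_closed)
    show ?case
      by (rule reduce) (use Br.prems sum in
        \<open>auto simp: lie_emb_Br lie_emb_Add lbr_diff_left lbr_diff_right algebra_simps\<close>)
  }
qed

lemma right_bracket_filt: "set w \<subseteq> X \<Longrightarrow> right_bracket u w \<in> lie_filt (length w)"
proof (induction w)
  case (Cons i w)
  have u: "u i \<in> lie_filt 1" using Cons.prems by (intro lie_filtI) auto
  show ?case
  proof (cases "w = []")
    case False
    then show ?thesis using lie_filt_lbr[OF u Cons.IH] Cons.prems by (simp add: right_bracket_Cons)
  qed (use u in simp)
qed (simp add: lie_filt_closed)

lemma foldr_lbr_filt:
  "set v \<subseteq> X \<Longrightarrow> y \<in> lie_filt d \<Longrightarrow> foldr (\<lambda>i. lbr (u i)) v y \<in> lie_filt (length v + d)"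
proof (induction v)
  case (Cons i v)
  have "u i \<in> lie_filt 1" using Cons.prems by (intro lie_filtI) auto
  from lie_filt_lbr[OF this Cons.IH] Cons.prems show ?case by simp
qed simp

lemma lin_form_foldr: "lin_form l \<Longrightarrow> lin_form (\<lambda>x. l (foldr (\<lambda>i. lbr (u i)) v x))"
proof (induction v arbitrary: l)
  case (Cons i v)
  then show ?case using lin_form_lbr[OF Cons.prems, of "u i"] Cons.IH by simp
qed simp

private abbreviation "shift_act \<equiv> lie_act (\<lambda>i \<xi> w. \<xi> (i # w))"

text \<open>Prepending the letter i to the argument amounts to replacing \<open>l\<close> by its
  composite with ad u_i. Hence the operator of a Lie term t turns the inner bracket into its bracket
  with t. The values of \<open>\<xi>\<close> are known on short words only: \<open>m\<close> is the
  cutoff, and \<open>q\<close> is the length used up by operators applied before.\<close>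

lemma dynkin_nonempty:
  assumes "t \<in> lie_terms X" "lin_form l"
    and "\<And>w. w \<noteq> [] \<Longrightarrow> set w \<subseteq> X \<Longrightarrow> length w + q \<le> m \<Longrightarrow> \<xi> w = l (right_bracket u w)"
    and "w \<noteq> []" "set w \<subseteq> X" "length w + lie_deg t + q \<le> m"
  shows "shift_act t \<xi> w = l \<lblot>\<tau> t, right_bracket u w\<rblot>"
  using assms
proof (induction t arbitrary: l \<xi> q w)
  case (Gen i)
  then show ?case by (simp add: right_bracket_Cons)
next
  case Zero
  then show ?case by (simp add: lin_form_zero lie_emb_Zero)
next
  case (Add s t)
  have "shift_act s \<xi> w = l \<lblot>\<tau> s, right_bracket u w\<rblot>"
    by (rule Add.IH(1)) (use Add.prems in auto)
  moreover have "shift_act t \<xi> w = l \<lblot>\<tau> t, right_bracket u w\<rblot>"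
    by (rule Add.IH(2)) (use Add.prems in auto)
  ultimately show ?case using Add.prems by (simp add: lie_emb_Add lbr_add_left lin_form_add)
next
  case (Scale c t)
  have "shift_act t \<xi> w = l \<lblot>\<tau> t, right_bracket u w\<rblot>"
    by (rule Scale.IH) (use Scale.prems in auto)
  then show ?case using Scale.prems by (simp add: lie_emb_Scale lin_form_scl)
next
  case (Br s t)
  have s: "shift_act s \<xi> w = l \<lblot>\<tau> s, right_bracket u w\<rblot>"
    if "w \<noteq> []" "set w \<subseteq> X" "length w + lie_deg s + q \<le> m" for w
    by (rule Br.IH(1)) (use Br.prems that in auto)
  have t: "shift_act t \<xi> w = l \<lblot>\<tau> t, right_bracket u w\<rblot>"
    if "w \<noteq> []" "set w \<subseteq> X" "length w + lie_deg t + q \<le> m" for w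
    by (rule Br.IH(2)) (use Br.prems that in auto)
  have "shift_act s (shift_act t \<xi>) w = l \<lblot>\<tau> t, \<lblot>\<tau> s, right_bracket u w\<rblot>\<rblot>"
    by (rule Br.IH(1)[OF _ lin_form_lbr, where q = "lie_deg t + q"]) (use Br.prems t in auto)
  moreover have "shift_act t (shift_act s \<xi>) w = l \<lblot>\<tau> s, \<lblot>\<tau> t, right_bracket u w\<rblot>\<rblot>"
    by (rule Br.IH(2)[OF _ lin_form_lbr, where q = "lie_deg s + q"]) (use Br.prems s in auto)
  moreover have "l \<lblot>\<lblot>\<tau> s, \<tau> t\<rblot>, right_bracket u w\<rblot> =
      l \<lblot>\<tau> s, \<lblot>\<tau> t, right_bracket u w\<rblot>\<rblot> - l \<lblot>\<tau> t, \<lblot>\<tau> s, right_bracket u w\<rblot>\<rblot>"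
    using lbr_leibniz[of "\<tau> s" "\<tau> t" "right_bracket u w"] Br.prems(2) by (simp add: lin_form_add)
  ultimately show ?case using Br.prems by (simp add: lie_emb_Br)
qed

text \<open>Dynkin's identity: evaluating right-normed brackets on the associative expansion of a Lie
  element of degree \<open>d\<close> multiplies it by \<open>d\<close>. Here it is read off the value at the empty word.\<close>

lemma dynkin:
  assumes "t \<in> lie_terms X" "lin_form l"
    and "\<And>w. w \<noteq> [] \<Longrightarrow> set w \<subseteq> X \<Longrightarrow> length w + q \<le> m \<Longrightarrow> \<xi> w = l (right_bracket u w)"
    and "lie_deg t + q \<le> m"
  shows "shift_act t \<xi> [] = l (\<tau> (lie_deriv t))"
  using assms
proof (induction t arbitrary: l \<xi> q)
  case (Gen i)
  then show ?case by simp
next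
  case Zero
  then show ?case by (simp add: lin_form_zero lie_emb_Zero)
next
  case (Add s t)
  have "shift_act s \<xi> [] = l (\<tau> (lie_deriv s))"
    by (rule Add.IH(1)) (use Add.prems in auto)
  moreover have "shift_act t \<xi> [] = l (\<tau> (lie_deriv t))"
    by (rule Add.IH(2)) (use Add.prems in auto)
  ultimately show ?case using Add.prems by (simp add: lie_emb_Add lin_form_add)
next
  case (Scale c t)
  have "shift_act t \<xi> [] = l (\<tau> (lie_deriv t))"
    by (rule Scale.IH) (use Scale.prems in auto)
  then show ?case using Scale.prems by (simp add: lie_emb_Scale lin_form_scl)
next
  case (Br s t)
  have s: "shift_act s \<xi> w = l \<lblot>\<tau> s, right_bracket u w\<rblot>"
    if "w \<noteq> []" "set w \<subseteq> X" "length w + lie_deg s + q \<le> m" for w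
    by (rule dynkin_nonempty[where q = q]) (use Br.prems that in auto)
  have t: "shift_act t \<xi> w = l \<lblot>\<tau> t, right_bracket u w\<rblot>"
    if "w \<noteq> []" "set w \<subseteq> X" "length w + lie_deg t + q \<le> m" for w
    by (rule dynkin_nonempty[where q = q]) (use Br.prems that in auto)
  \<comment> \<open>At nonempty words the inner operator is an adjoint action, which is absorbed
    into the linear form; the induction hypothesis at the empty word then applies to the outer one.
    The two contributions add up to the derivation of the bracket.\<close>
  have "shift_act s (shift_act t \<xi>) [] = l \<lblot>\<tau> t, \<tau> (lie_deriv s)\<rblot>"
    by (rule Br.IH(1)[OF _ lin_form_lbr, where q = "lie_deg t + q"]) (use Br.prems t in auto)
  moreover have "shift_act t (shift_act s \<xi>) [] = l \<lblot>\<tau> s, \<tau> (lie_deriv t)\<rblot>"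
    by (rule Br.IH(2)[OF _ lin_form_lbr, where q = "lie_deg s + q"]) (use Br.prems s in auto)
  ultimately show ?case
    using Br.prems lbr_antisym[of "\<tau> (lie_deriv s)" "\<tau> t"]
    by (simp add: lie_emb_Add lie_emb_Br lin_form_diff)
qed

end

section \<open>Leading terms of the shifted operators\<close>

lemma shift_act_local:
  assumes "\<And>v. length v \<le> n \<Longrightarrow> \<xi> v = \<eta> v" "length w + lie_deg t \<le> n"
  shows "lie_act (\<lambda>i \<xi> w. \<xi> (i # w)) t \<xi> w = lie_act (\<lambda>i \<xi> w. \<xi> (i # w)) t \<eta> w"
  using assms
proof (induction t arbitrary: \<xi> \<eta> w n)
  case (Br s t)
  let ?act = "lie_act (\<lambda>i \<xi> w. \<xi> (i # w))"
  have "?act t (?act s \<xi>) w = ?act t (?act s \<eta>) w"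
    using Br.prems(2) by (intro Br.IH(2)[of "n - lie_deg s"] Br.IH(1)[of n] Br.prems(1)) auto
  moreover have "?act s (?act t \<xi>) w = ?act s (?act t \<eta>) w"
    using Br.prems(2) by (intro Br.IH(1)[of "n - lie_deg t"] Br.IH(2)[of n] Br.prems(1)) auto
  ultimately show ?case by simp
next
  case (Add s t)
  show ?case
    using Add.IH(1)[OF Add.prems(1)] Add.IH(2)[OF Add.prems(1)] Add.prems(2) by simp
next
  case (Scale c t)
  show ?case
    using Scale.IH[OF Scale.prems(1)] Scale.prems(2) by simp
qed auto

lemma word_f_local:
  assumes "\<And>v. length v < length w \<Longrightarrow> \<xi> v = 0"
  shows "word_f A i w \<xi> = 0"
  using assms by (induction w arbitrary: \<xi>) auto

text \<open>The generators \<open>f\<^sub>i\<close> lower the degree, so they do not affect leading terms.\<close>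

lemma shifted_act_leading:
  assumes "\<And>v. length v + q < m \<Longrightarrow> \<xi> v = 0"
  shows "(length w + lie_deg t + q < m \<longrightarrow>
      lie_act (\<lambda>i \<xi> w. \<xi> (i # w) + c i * word_f A (p i) w \<xi>) t \<xi> w = 0) \<and>
    (length w + lie_deg t + q \<le> m \<longrightarrow>
      lie_act (\<lambda>i \<xi> w. \<xi> (i # w) + c i * word_f A (p i) w \<xi>) t \<xi> w =
      lie_act (\<lambda>i \<xi> w. \<xi> (i # w)) t \<xi> w)"
  using assms
proof (induction t arbitrary: \<xi> w q)
  case (Gen i)
  have "word_f A (p i) w \<xi> = 0" if "length w + 1 + q \<le> m"
    using that by (intro word_f_local Gen) auto
  then show ?case using Gen by auto
next
  case (Br s t)
  let ?T = "lie_act (\<lambda>i \<xi> w. \<xi> (i # w) + c i * word_f A (p i) w \<xi>)"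
    and ?act = "lie_act (\<lambda>i \<xi> w. \<xi> (i # w))"
  have s: "(length w + lie_deg s + q < m \<longrightarrow> ?T s \<xi> w = 0) \<and>
      (length w + lie_deg s + q \<le> m \<longrightarrow> ?T s \<xi> w = ?act s \<xi> w)" for w
    by (rule Br.IH(1)) (rule Br.prems)
  have t: "(length w + lie_deg t + q < m \<longrightarrow> ?T t \<xi> w = 0) \<and>
      (length w + lie_deg t + q \<le> m \<longrightarrow> ?T t \<xi> w = ?act t \<xi> w)" for w
    by (rule Br.IH(2)) (rule Br.prems)
  have ts: "(length w + lie_deg t + (q + lie_deg s) < m \<longrightarrow> ?T t (?T s \<xi>) w = 0) \<and>
      (length w + lie_deg t + (q + lie_deg s) \<le> m \<longrightarrow> ?T t (?T s \<xi>) w = ?act t (?T s \<xi>) w)" for w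
    by (rule Br.IH(2)) (use s in \<open>simp add: algebra_simps\<close>)
  have st: "(length w + lie_deg s + (q + lie_deg t) < m \<longrightarrow> ?T s (?T t \<xi>) w = 0) \<and>
      (length w + lie_deg s + (q + lie_deg t) \<le> m \<longrightarrow> ?T s (?T t \<xi>) w = ?act s (?T t \<xi>) w)" for w
    by (rule Br.IH(1)) (use t in \<open>simp add: algebra_simps\<close>)
  have "?act t (?T s \<xi>) w = ?act t (?act s \<xi>) w" if "length w + lie_deg t + (q + lie_deg s) \<le> m"
    by (rule shift_act_local[of "m - (q + lie_deg s)"]) (use that s in auto)
  moreover have "?act s (?T t \<xi>) w = ?act s (?act t \<xi>) w" if "length w + lie_deg s + (q + lie_deg t) \<le> m"
    by (rule shift_act_local[of "m - (q + lie_deg t)"]) (use that t in auto)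
  ultimately show ?case using ts[of w] st[of w] by (auto simp: algebra_simps)
next
  case (Add s t)
  let ?T = "lie_act (\<lambda>i \<xi> w. \<xi> (i # w) + c i * word_f A (p i) w \<xi>)"
    and ?act = "lie_act (\<lambda>i \<xi> w. \<xi> (i # w))"
  have "(length w + lie_deg s + q < m \<longrightarrow> ?T s \<xi> w = 0) \<and>
      (length w + lie_deg s + q \<le> m \<longrightarrow> ?T s \<xi> w = ?act s \<xi> w)"
    by (rule Add.IH(1)) (rule Add.prems)
  moreover have "(length w + lie_deg t + q < m \<longrightarrow> ?T t \<xi> w = 0) \<and>
      (length w + lie_deg t + q \<le> m \<longrightarrow> ?T t \<xi> w = ?act t \<xi> w)"
    by (rule Add.IH(2)) (rule Add.prems)
  ultimately show ?case by auto
next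
  case (Scale d t)
  let ?T = "lie_act (\<lambda>i \<xi> w. \<xi> (i # w) + c i * word_f A (p i) w \<xi>)"
    and ?act = "lie_act (\<lambda>i \<xi> w. \<xi> (i # w))"
  have "(length w + lie_deg t + q < m \<longrightarrow> ?T t \<xi> w = 0) \<and>
      (length w + lie_deg t + q \<le> m \<longrightarrow> ?T t \<xi> w = ?act t \<xi> w)"
    by (rule Scale.IH) (rule Scale.prems)
  then show ?case by auto
qed auto

text \<open>The associative expansion of the iterated bracket consists of words with exactly m + 1
  letters.\<close>

lemma shift_act_ad_pow_zero:
  assumes "\<And>v. length v = Suc m \<Longrightarrow> \<xi> (v @ w) = 0"
  shows "lie_act (\<lambda>i \<xi> w. \<xi> (i # w)) (ad_pow (Gen i) m (Gen j)) \<xi> w = 0"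
  using assms
proof (induction m arbitrary: \<xi> w)
  case 0
  then show ?case using "0"[of "[j]"] by simp
next
  case (Suc m)
  have "lie_act (\<lambda>i \<xi> w. \<xi> (i # w)) (ad_pow (Gen i) m (Gen j)) (\<lambda>v. \<xi> (i # v)) w = 0"
    by (rule Suc.IH) (use Suc.prems[of "i # _"] in simp)
  moreover have "lie_act (\<lambda>i \<xi> w. \<xi> (i # w)) (ad_pow (Gen i) m (Gen j)) \<xi> (i # w) = 0"
    by (rule Suc.IH) (use Suc.prems[of "_ @ [i]"] in simp)
  ultimately show ?case by simp
qed

text \<open>Substitution is evaluation in the presented algebra of the target, so the universal
  property applies.\<close>

lemma lie_subst_sound:
  assumes \<sigma>: "\<And>g. g \<in> X \<Longrightarrow> \<sigma> g \<in> lie_terms Y"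
    and R: "\<And>r. r \<in> R \<Longrightarrow> r \<in> lie_terms X \<Longrightarrow> (lie_subst \<sigma> r, Zero) \<in> lie_rel Y Q"
    and st: "(s, t) \<in> lie_rel X R"
  shows "(lie_subst \<sigma> s, lie_subst \<sigma> t) \<in> lie_rel Y Q"
proof -
  let ?M = "presented_lie_algebra Y Q"
  have *: "lie_eval ?M (\<lambda>g. lie_class Y Q (\<sigma> g)) t = lie_class Y Q (lie_subst \<sigma> t)"
    if "t \<in> lie_terms X" for t
    using that \<sigma> by (rule lie_eval_presented)
  have mem: "lie_subst \<sigma> t \<in> lie_terms Y" if "t \<in> lie_terms X" for t
    using that \<sigma> by (rule lie_subst_in_lie_terms)
  have "lie_eval ?M (\<lambda>g. lie_class Y Q (\<sigma> g)) s = lie_eval ?M (\<lambda>g. lie_class Y Q (\<sigma> g)) t"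
  proof (rule lie_eval_sound[OF lie_algebra_presented _ _ st])
    show "lie_eval ?M (\<lambda>g. lie_class Y Q (\<sigma> g)) r = \<zero>\<^bsub>?M\<^esub>" if "r \<in> R" "r \<in> lie_terms X" for r
      using R[OF that] * mem that by (simp add: presented_zero[of Zero] lie_class_eq_iff)
  qed (use \<sigma> in auto)
  then show ?thesis
    using st * mem lie_rel_in_lie_terms[OF st] by (simp add: lie_class_eq_iff)
qed

abbreviation shifted_gen :: "('i \<Rightarrow> complex) \<Rightarrow> ('i \<Rightarrow> 'i) \<Rightarrow> 'i \<Rightarrow> 'i chevalley_gen lie_term" where
  "shifted_gen c p i \<equiv> Add (Gen (E i)) (Scale (c i) (Gen (F (p i))))"

theorem shifted_injective:
  fixes I :: "'i set" and A :: "'i \<Rightarrow> 'i \<Rightarrow> int" and b :: "'i \<Rightarrow> 'i \<Rightarrow> complex"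
    and c :: "'i \<Rightarrow> complex" and p :: "'i \<Rightarrow> 'i"
  defines "R \<equiv> electrical_relators I A b" and "Q \<equiv> kac_moody_relators I A" and "Y \<equiv> chevalley_gens I"
  assumes gcm: "generalized_cartan_matrix I A"
    and p: "\<And>i. i \<in> I \<Longrightarrow> p i \<in> I"
    and rel: "\<And>r. r \<in> R \<Longrightarrow> r \<in> lie_terms I \<Longrightarrow> (lie_subst (shifted_gen c p) r, Zero) \<in> lie_rel Y Q"
    and t: "t \<in> lie_terms I" "(lie_subst (shifted_gen c p) t, Zero) \<in> lie_rel Y Q"
  shows "(t, Zero) \<in> lie_rel I R"
proof -
  let ?\<iota> = "lie_emb I R" and ?\<phi> = "lie_subst (shifted_gen c p)"
  let ?u = "\<lambda>i. ?\<iota> (Gen i)"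
  let ?filt = "lie_filt I R"
  let ?act = "lie_act (\<lambda>i \<xi> w. \<xi> (i # w))"
  \<comment> \<open>The electrical relation equates the Serre element, formally of degree 2 - a_ij,
    with a multiple of one generator.\<close>
  have serre_filt: "?\<iota> (ad_pow (Gen i) (nat (1 - A i j)) (Gen j)) \<in> ?filt 1"
    if ij: "i \<in> I" "j \<in> I" "i \<noteq> j" for i j
  proof -
    let ?S = "ad_pow (Gen i) (nat (1 - A i j)) (Gen j)" and ?x = "if A i j = -1 then 2 * b i j else 0"
    have "Add ?S (Scale ?x (Gen i)) \<in> R"
      unfolding R_def electrical_relators_def using ij by blast
    then have "?\<iota> (Add ?S (Scale ?x (Gen i))) = 0"
      using ij by (simp add: lie_emb_eq_0_iff lie_rel.relator)
    then have "?\<iota> ?S = - (?x *\<^sub>L ?u i)"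
      using ij by (simp add: lie_emb_Add lie_emb_Scale eq_neg_iff_add_eq_0)
    then show ?thesis using ij by (auto intro!: lie_filt_closed lie_filtI)
  qed
  \<comment> \<open>Descent on the filtration: an element of the kernel lying in one step of the
    filtration must lie in the step below.\<close>
  have "?\<iota> t = 0" if "?\<iota> t \<in> ?filt d" "t \<in> lie_terms I" "(?\<phi> t, Zero) \<in> lie_rel Y Q" for t d
    using that
  proof (induction d)
    case 0
    then show ?case by (simp add: lie_filt_0)
  next
    case (Suc d)
    show ?case
    proof (cases "?\<iota> t \<in> ?filt d")
      case True
      then show ?thesis using Suc by blast
    next
      case False
      obtain l where l: "lin_form l" "\<And>y. y \<in> ?filt d \<Longrightarrow> l y = 0" "l (?\<iota> t) = 1"
        using separating_form[OF lie_filt_subspace False] by blast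
      obtain s where s: "s \<in> lie_terms I" "lie_deg s \<le> Suc d" "?\<iota> t = ?\<iota> s"
        using lie_filt_term[OF Suc.prems(1)] by auto
      \<comment> \<open>Since \<open>l\<close> kills \<open>?filt d\<close>, this function is
        supported on words of length exactly d + 1. It is cut off above that length, where nothing
        is known about \<open>l\<close> and the Serre condition could fail.\<close>
      define \<xi> where "\<xi> w = (if set w \<subseteq> I \<and> length w \<le> Suc d then l (right_bracket ?u w) else 0)" for w
      have \<xi>: "\<xi> \<in> serre_functions I A"
        unfolding serre_functions_def[OF gcm]
      proof (intro CollectI allI impI ext)
        fix v i j w
        assume v: "set v \<subseteq> I" and ij: "i \<in> I" "j \<in> I" "i \<noteq> j"
        define m where "m = nat (1 - A i j)"
        have "A i j \<le> 0" using gcm ij by (simp add: generalized_cartan_matrix_def)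
        then have m: "m \<ge> 1" by (simp add: m_def)
        let ?S = "ad_pow (Gen i) m (Gen j)"
        let ?l = "\<lambda>x. l (foldr (\<lambda>i. lbr (?u i)) v x)"
        have S: "?\<iota> ?S \<in> ?filt 1" using serre_filt ij by (simp add: m_def)
        have "?act ?S (\<lambda>x. \<xi> (v @ x)) w = 0"
        proof (cases "set w \<subseteq> I \<and> length w + Suc m + length v \<le> Suc d")
          case True
          have shift: "\<xi> (v @ w) = ?l (right_bracket ?u w)"
            if "w \<noteq> []" "set w \<subseteq> I" "length w + length v \<le> Suc d" for w
            using that v by (simp add: \<xi>_def right_bracket_append)
          note lin = lin_form_foldr[OF l(1), of I R v]
          show ?thesis
          proof (cases "w = []")
            case False
            \<comment> \<open>In the electrical algebra the Serre element has degree 1, not m + 1.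
              As m is positive, the total degree with the prefix \<open>v\<close> is at most d, and
              there \<open>l\<close> vanishes.\<close>
            have "\<lblot>?\<iota> ?S, right_bracket ?u w\<rblot> \<in> ?filt (1 + length w)"
              using True by (intro lie_filt_lbr S right_bracket_filt) auto
            from foldr_lbr_filt[OF v this] have "?l \<lblot>?\<iota> ?S, right_bracket ?u w\<rblot> = 0"
              using True m by (intro l(2)) (erule lie_filt_mono, simp)
            moreover have "?act ?S (\<lambda>x. \<xi> (v @ x)) w = ?l \<lblot>?\<iota> ?S, right_bracket ?u w\<rblot>"
              by (rule dynkin_nonempty[OF _ lin, where q = "length v" and m = "Suc d"])
                (use shift True False ij in auto)
            ultimately show ?thesis by simp
          next
            case w: True
            \<comment> \<open>At the empty word the Serre element contributes through its
              derivation. Modulo degree m this is m + 1 times the element, which has degree 1 and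
              thus at most m.\<close>
            have "?\<iota> (lie_deriv ?S) - of_nat (Suc m) *\<^sub>L ?\<iota> ?S \<in> ?filt (Suc m - 1)"
              using ij by (intro lie_deriv_leading) auto
            moreover have "of_nat (Suc m) *\<^sub>L ?\<iota> ?S \<in> ?filt m"
              using S m by (intro lie_filt_closed) (erule lie_filt_mono)
            ultimately have "?\<iota> (lie_deriv ?S) \<in> ?filt m"
              using lie_filt_closed(1) by fastforce
            from foldr_lbr_filt[OF v this] have "?l (?\<iota> (lie_deriv ?S)) = 0"
              using True m by (intro l(2)) (erule lie_filt_mono, simp)
            moreover have "?act ?S (\<lambda>x. \<xi> (v @ x)) [] = ?l (?\<iota> (lie_deriv ?S))"
              by (rule dynkin[OF _ lin, where q = "length v" and m = "Suc d"])
                (use shift True w ij in auto)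
            ultimately show ?thesis using w by simp
          qed
        next
          case False
          \<comment> \<open>Every word in the expansion is beyond the cutoff or contains a letter
            outside \<open>I\<close>.\<close>
          then show ?thesis by (intro shift_act_ad_pow_zero) (auto simp: \<xi>_def)
        qed
        moreover have "lie_act (word_op A) (serre_term A E i j) = ?act ?S"
        proof -
          have "serre_term A E i j = lie_subst (\<lambda>i. Gen (E i)) ?S"
            unfolding m_def[symmetric] by (induction m) auto
          then show ?thesis by (simp add: lie_act_subst)
        qed
        ultimately show "lie_act (word_op A) (serre_term A E i j) (\<lambda>x. \<xi> (v @ x)) w = 0" by simp
      qed
      have "(s, t) \<in> lie_rel I R" using s Suc.prems by (simp add: lie_emb_eq_iff[symmetric])
      then have "(?\<phi> s, ?\<phi> t) \<in> lie_rel Y Q"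
        by (intro lie_subst_sound[of I _ Y R]) (use p rel in \<open>auto simp: Y_def\<close>)
      then have "(?\<phi> s, Zero) \<in> lie_rel Y Q" using Suc.prems(3) by (rule lie_rel.trans)
      then have "lie_act (word_op A) (?\<phi> s) \<xi> [] = 0"
        using word_act_kac_moody[OF gcm _ \<xi>] by (simp add: Y_def Q_def)
      also have "lie_act (word_op A) (?\<phi> s) = lie_act (\<lambda>i \<xi> w. \<xi> (i # w) + c i * word_f A (p i) w \<xi>) s"
        by (simp add: lie_act_subst)
      also have "\<dots> \<xi> [] = ?act s \<xi> []"
      proof -
        have "\<xi> v = 0" if "length v + 0 < Suc d" for v
        proof (cases "set v \<subseteq> I")
          case True
          have "right_bracket ?u v \<in> ?filt d"
            using that by (intro lie_filt_mono[OF right_bracket_filt[OF True]]) simp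
          then show ?thesis by (simp add: \<xi>_def l(2))
        qed (simp add: \<xi>_def)
        from shifted_act_leading[of 0 "Suc d" \<xi> "[]" s c A p, OF this] s(2) show ?thesis by simp
      qed
      also have "\<dots> = l (?\<iota> (lie_deriv s))"
        by (rule dynkin[OF s(1) l(1), where q = 0 and m = "Suc d"]) (use s(2) in \<open>auto simp: \<xi>_def\<close>)
      also have "\<dots> = of_nat (Suc d)"
      proof -
        have "l (?\<iota> (lie_deriv s) - of_nat (Suc d) *\<^sub>L ?\<iota> s) = 0"
          using lie_deriv_leading[OF s(1,2), of R] by (intro l(2)) simp
        then show ?thesis
          using l(1,3) s(3) by (simp add: lin_form_diff lin_form_scl)
      qed
      finally show ?thesis by (metis of_nat_neq_0)
    qed
  qed
  moreover have "?\<iota> t \<in> ?filt (lie_deg t)" using t by (intro lie_filtI) auto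
  ultimately have "?\<iota> t = 0" using t by blast
  then show ?thesis using t by (simp add: lie_emb_eq_0_iff)
qed

section \<open>Electrical Lie algebras inside Kac--Moody algebras\<close>

lemma defines_injective_hom_cong:
  assumes "\<And>i. i \<in> I \<Longrightarrow> v i = w i" "defines_injective_hom L u I M v"
  shows "defines_injective_hom L u I M w"
  using assms unfolding defines_injective_hom_def by auto

lemma lie_emb_shifted_gen:
  assumes "i \<in> I" "p i \<in> I"
  shows "lie_emb (chevalley_gens I) Q (shifted_gen c p i) =
    lie_emb (chevalley_gens I) Q (Gen (E i)) + c i *\<^sub>L lie_emb (chevalley_gens I) Q (Gen (F (p i)))"
  using assms by (simp add: lie_emb_Add lie_emb_Scale)

lemma lie_emb_subst:
  assumes "t \<in> lie_terms X" "\<And>g. g \<in> X \<Longrightarrow> \<sigma> g \<in> lie_terms Y"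
  shows "lie_emb Y Q (lie_subst \<sigma> t) = lie_val (\<lambda>g. lie_emb Y Q (\<sigma> g)) t"
proof -
  have "lie_subst \<sigma> t \<in> lie_terms Y" if "t \<in> lie_terms X" for t
    using that assms(2) by (rule lie_subst_in_lie_terms)
  with assms(1) show ?thesis
    by (induction t) (simp_all add: lie_emb_Zero lie_emb_Add lie_emb_Scale lie_emb_Br)
qed

lemma electrical_relators_vanish:
  fixes I :: "'i set" and A :: "'i \<Rightarrow> 'i \<Rightarrow> int" and b :: "'i \<Rightarrow> 'i \<Rightarrow> complex"
    and c :: "'i \<Rightarrow> complex" and p :: "'i \<Rightarrow> 'i"
  defines "Y \<equiv> chevalley_gens I" and "Q \<equiv> kac_moody_relators I A"
  defines "u \<equiv> \<lambda>i. lie_emb Y Q (Gen (E i)) + c i *\<^sub>L lie_emb Y Q (Gen (F (p i)))"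
  assumes p: "\<And>i. i \<in> I \<Longrightarrow> p i \<in> I"
    and rel: "\<And>i j. i \<in> I \<Longrightarrow> j \<in> I \<Longrightarrow> i \<noteq> j \<Longrightarrow>
      lbr_pow (u i) (nat (1 - A i j)) (u j) + (if A i j = -1 then 2 * b i j else 0) *\<^sub>L u i = 0"
    and r: "r \<in> electrical_relators I A b" "r \<in> lie_terms I"
  shows "(lie_subst (shifted_gen c p) r, Zero) \<in> lie_rel Y Q"
proof -
  have mem: "shifted_gen c p i \<in> lie_terms Y" if "i \<in> I" for i
    using that p by (simp add: Y_def)
  obtain i j where ij: "i \<in> I" "j \<in> I" "i \<noteq> j"
    and r_eq: "r = Add (ad_pow (Gen i) (nat (1 - A i j)) (Gen j))
        (Scale (if A i j = -1 then 2 * b i j else 0) (Gen i))"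
    using r(1) unfolding electrical_relators_def by blast
  have "lie_emb Y Q (lie_subst (shifted_gen c p) r) = lie_val (\<lambda>i. lie_emb Y Q (shifted_gen c p i)) r"
    using r(2) mem by (rule lie_emb_subst)
  also have "\<dots> = lbr_pow (u i) (nat (1 - A i j)) (u j) + (if A i j = -1 then 2 * b i j else 0) *\<^sub>L u i"
    unfolding r_eq using ij p by (simp add: lie_val_ad_pow Y_def u_def lie_emb_shifted_gen)
  also have "\<dots> = 0" using ij by (rule rel)
  finally show ?thesis
    using lie_subst_in_lie_terms[OF r(2) mem] by (simp add: lie_emb_eq_0_iff)
qed

lemma shifted_hom_kac_moody:
  fixes I :: "'i set" and A :: "'i \<Rightarrow> 'i \<Rightarrow> int" and b :: "'i \<Rightarrow> 'i \<Rightarrow> complex"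
    and c :: "'i \<Rightarrow> complex" and p :: "'i \<Rightarrow> 'i"
  defines "Y \<equiv> chevalley_gens I" and "Q \<equiv> kac_moody_relators I A"
  assumes gcm: "generalized_cartan_matrix I A"
    and p: "\<And>i. i \<in> I \<Longrightarrow> p i \<in> I"
    and rel: "\<And>r. r \<in> electrical_relators I A b \<Longrightarrow> r \<in> lie_terms I \<Longrightarrow>
      (lie_subst (shifted_gen c p) r, Zero) \<in> lie_rel Y Q"
  shows "defines_injective_hom (electrical I A b) (elec_u I A b) I (kac_moody I A)
    (\<lambda>i. lie_class Y Q (shifted_gen c p i))"
proof -
  have mem: "shifted_gen c p i \<in> lie_terms Y" if "i \<in> I" for i
    using that p by (simp add: Y_def)
  have eval: "lie_eval (presented_lie_algebra Y Q) (\<lambda>i. lie_class Y Q (shifted_gen c p i)) t =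
      \<zero>\<^bsub>presented_lie_algebra Y Q\<^esub> \<longleftrightarrow> (lie_subst (shifted_gen c p) t, Zero) \<in> lie_rel Y Q"
    if "t \<in> lie_terms I" for t
    using lie_eval_presented[OF that mem] lie_subst_in_lie_terms[OF that mem]
    by (simp add: presented_zero[of Zero] lie_class_eq_iff)
  show ?thesis
    unfolding electrical_def elec_u_def kac_moody_def Y_def[symmetric] Q_def[symmetric]
  proof (rule defines_injective_homI[OF lie_algebra_presented])
    show "lie_class Y Q (shifted_gen c p i) \<in> carrier (presented_lie_algebra Y Q)" if "i \<in> I" for i
      using mem[OF that] by simp
    show "lie_eval (presented_lie_algebra Y Q) (\<lambda>i. lie_class Y Q (shifted_gen c p i)) r =
        \<zero>\<^bsub>presented_lie_algebra Y Q\<^esub>" if "r \<in> electrical_relators I A b" "r \<in> lie_terms I" for r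
      using eval rel that by simp
    show "(t, Zero) \<in> lie_rel I (electrical_relators I A b)"
      if "t \<in> lie_terms I" "lie_eval (presented_lie_algebra Y Q) (\<lambda>i. lie_class Y Q (shifted_gen c p i)) t =
        \<zero>\<^bsub>presented_lie_algebra Y Q\<^esub>" for t
      using shifted_injective[OF gcm p, where c = c and b = b] rel that eval by (simp add: Y_def Q_def)
  qed
qed

lemma km_shifted_gen:
  assumes "i \<in> I" "j \<in> I"
  shows "km_e I A i \<oplus>\<^bsub>kac_moody I A\<^esub> x \<odot>\<^bsub>kac_moody I A\<^esub> km_f I A j =
    lie_class (chevalley_gens I) (kac_moody_relators I A) (Add (Gen (E i)) (Scale x (Gen (F j))))"
  using assms by (simp add: km_e_def km_f_def kac_moody_def presented_add presented_smult)

text \<open>Brings a generator without parent into the common shape, with coefficient 0.\<close>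

lemma km_e_shifted_gen:
  assumes "i \<in> I" "j \<in> I"
  shows "km_e I A i =
    lie_class (chevalley_gens I) (kac_moody_relators I A) (Add (Gen (E i)) (Scale 0 (Gen (F j))))"
proof -
  have "lie_emb (chevalley_gens I) (kac_moody_relators I A) (Gen (E i)) =
      lie_emb (chevalley_gens I) (kac_moody_relators I A) (Add (Gen (E i)) (Scale 0 (Gen (F j))))"
    using assms by (simp add: lie_emb_Add lie_emb_Scale)
  then show ?thesis
    using assms by (simp add: km_e_def lie_emb_eq_iff lie_class_eq_iff)
qed

text \<open>Along an edge one end is the parent of the other. The relation for the ordered pair (i,
  j) is the first or the second half of \<open>shifted_adjacent\<close>, depending on which end is
  the parent.\<close>

lemma (in km_serre) shifted_simply_laced:
  assumes ij: "i \<in> I" "j \<in> I" "i \<noteq> j" and sym: "A i j = A j i"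
    and adj: "A i j = -1 \<Longrightarrow>
      p j = i \<and> c j = b i j \<and>
        (c i = 0 \<or> p i \<in> I \<and> p i \<noteq> i \<and> p i \<noteq> j \<and> A i (p i) = -1 \<and> A (p i) i = -1) \<or>
      p i = j \<and> c i = b i j \<and>
        (c j = 0 \<or> p j \<in> I \<and> p j \<noteq> j \<and> p j \<noteq> i \<and> A j (p j) = -1 \<and> A (p j) j = -1)"
    and nonadj: "A i j \<noteq> -1 \<Longrightarrow> A i j = 0 \<and>
      (c j = 0 \<or> p j \<in> I \<and> p j \<noteq> i) \<and> (c i = 0 \<or> p i \<in> I \<and> p i \<noteq> j) \<and>
      (c i = 0 \<or> c j = 0 \<or> p i = p j \<or> A (p i) (p j) = 0)"
  shows "lbr_pow (e i + c i *\<^sub>L f (p i)) (nat (1 - A i j)) (e j + c j *\<^sub>L f (p j)) +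
    (if A i j = -1 then 2 * b i j else 0) *\<^sub>L (e i + c i *\<^sub>L f (p i)) = 0"
proof (cases "A i j = -1")
  case True
  from adj[OF True] consider
      (child) "p j = i" "c j = b i j"
        "c i = 0 \<or> p i \<in> I \<and> p i \<noteq> i \<and> p i \<noteq> j \<and> A i (p i) = -1 \<and> A (p i) i = -1"
    | (parent) "p i = j" "c i = b i j"
        "c j = 0 \<or> p j \<in> I \<and> p j \<noteq> j \<and> p j \<noteq> i \<and> A j (p j) = -1 \<and> A (p j) j = -1"
    by blast
  then show ?thesis
  proof cases
    case child
    then show ?thesis
      using True sym shifted_adjacent(1)[OF ij True _ child(3), of "b i j"] by (simp add: numeral_2_eq_2)
  next
    case parent
    then show ?thesis
      using True sym shifted_adjacent(2)[OF ij(2,1) ij(3)[symmetric] _ True parent(3), of "b i j"]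
      by (simp add: numeral_2_eq_2)
  qed
next
  case False
  then show ?thesis
    using nonadj[OF False] shifted_commute[of i j c p] ij by simp
qed

lemma rank2_injective_hom:
  fixes A :: "nat \<Rightarrow> nat \<Rightarrow> int" and b :: "nat \<Rightarrow> nat \<Rightarrow> complex"
  defines "I \<equiv> {1, 2}"
  assumes gcm: "generalized_cartan_matrix I A" and A21: "A 2 1 \<le> -2"
  shows "defines_injective_hom (electrical I A b) (elec_u I A b) I (kac_moody I A)
    (\<lambda>i. if i = 1 then km_e I A 1
      else km_e I A 2 \<oplus>\<^bsub>kac_moody I A\<^esub> b 1 2 \<odot>\<^bsub>kac_moody I A\<^esub> km_f I A 1)"
proof -
  \<comment> \<open>Node 1 is the parent of node 2. It has no parent itself, which is expressed by
    the coefficient 0.\<close>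
  define c :: "nat \<Rightarrow> complex" where "c i = (if i = 1 then 0 else b 1 2)" for i
  interpret km_serre I A "\<lambda>i. lie_emb (chevalley_gens I) (kac_moody_relators I A) (Gen (E i))"
      "\<lambda>i. lie_emb (chevalley_gens I) (kac_moody_relators I A) (Gen (F i))"
    using gcm by (rule km_serre_presented)
  have I: "1 \<in> I" "2 \<in> I" "I = {1, 2}" by (simp_all add: I_def)
  have "defines_injective_hom (electrical I A b) (elec_u I A b) I (kac_moody I A)
      (\<lambda>i. lie_class (chevalley_gens I) (kac_moody_relators I A) (shifted_gen c (\<lambda>_. 1) i))"
  proof (rule shifted_hom_kac_moody[OF gcm I(1)], rule electrical_relators_vanish[OF I(1)])
    fix i j assume ij: "i \<in> I" "j \<in> I" "i \<noteq> j"
    let ?e = "\<lambda>i. lie_emb (chevalley_gens I) (kac_moody_relators I A) (Gen (E i))"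
      and ?f = "\<lambda>i. lie_emb (chevalley_gens I) (kac_moody_relators I A) (Gen (F i))"
    consider "i = 1" "j = 2" | "i = 2" "j = 1" using ij by (auto simp: I_def)
    then show "lbr_pow (?e i + c i *\<^sub>L ?f 1) (nat (1 - A i j)) (?e j + c j *\<^sub>L ?f 1) +
        (if A i j = - 1 then 2 * b i j else 0) *\<^sub>L (?e i + c i *\<^sub>L ?f 1) = 0"
    proof cases
      case 1
      then show ?thesis
        using shifted_rank2(1)[OF I(1,2) _ A21, of "b 1 2"]
        by (cases "A 1 2 = -1") (simp_all add: c_def)
    next
      case 2
      then show ?thesis
        using shifted_rank2(2)[OF I(1,2) _ A21, of "b 1 2"] A21 by (simp add: c_def)
    qed
  qed
  then show ?thesis
  proof (rule defines_injective_hom_cong[rotated])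
    fix i assume "i \<in> I"
    then show "lie_class (chevalley_gens I) (kac_moody_relators I A) (shifted_gen c (\<lambda>_. 1) i) =
        (if i = 1 then km_e I A 1
          else km_e I A 2 \<oplus>\<^bsub>kac_moody I A\<^esub> b 1 2 \<odot>\<^bsub>kac_moody I A\<^esub> km_f I A 1)"
      using km_e_shifted_gen[OF I(1,1), of A] km_shifted_gen[OF I(2,1)] by (auto simp: I(3) c_def)
  qed
qed

section \<open>Type D as a rooted tree\<close>

definition D_parent :: "nat \<Rightarrow> nat \<Rightarrow> nat" where
  "D_parent n i = (if i = 1 then 1 else if i \<le> n - 2 then i - 1 else n - 2)"

text \<open>With the Dynkin diagram rooted at node 1, its edges are the pairs of a node and its
  parent. Node 1 is its own parent by convention, hence the guards against 1.\<close>

lemma cartan_D_parent: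
  assumes "n \<ge> 3" "i \<in> {1..n}" "j \<in> {1..n}" "i \<noteq> j"
  shows "cartan_D n i j = (if j \<noteq> 1 \<and> D_parent n j = i \<or> i \<noteq> 1 \<and> D_parent n i = j then -1 else 0)"
proof -
  have 1: "(\<exists>k\<in>{1..n-2}. {i, j} = {k, k + 1}) \<longleftrightarrow> (j = i + 1 \<and> i \<le> n - 2) \<or> (i = j + 1 \<and> j \<le> n - 2)"
    using assms by (auto simp: doubleton_eq_iff)
  have 2: "{i, j} = {n - 2, n} \<longleftrightarrow> i = n - 2 \<and> j = n \<or> i = n \<and> j = n - 2"
    by (auto simp: doubleton_eq_iff)
  have "(\<exists>k\<in>{1..n-2}. {i, j} = {k, k + 1}) \<or> {i, j} = {n - 2, n} \<longleftrightarrow>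
      j \<noteq> 1 \<and> D_parent n j = i \<or> i \<noteq> 1 \<and> D_parent n i = j"
    unfolding 1 2 D_parent_def using assms by (auto split: if_splits; linarith)
  then show ?thesis using assms(4) by (simp add: cartan_D_def)
qed

lemma gcm_cartan_D: "generalized_cartan_matrix {1..n} (cartan_D n)"
  by (auto simp: generalized_cartan_matrix_def cartan_D_def insert_commute)

lemma cartan_D_sym: "cartan_D n i j = cartan_D n j i"
  by (simp add: cartan_D_def insert_commute)

lemma D_parent_mem: "n \<ge> 3 \<Longrightarrow> i \<in> {1..n} \<Longrightarrow> D_parent n i \<in> {1..n}"
  by (auto simp: D_parent_def)

lemma D_parent_less: "n \<ge> 3 \<Longrightarrow> i \<in> {1..n} \<Longrightarrow> i \<noteq> 1 \<Longrightarrow> D_parent n i < i"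
  by (auto simp: D_parent_def)

lemma D_relators_vanish:
  fixes b :: "nat \<Rightarrow> nat \<Rightarrow> complex"
  defines "c \<equiv> \<lambda>n i. if i = 1 then 0 else b (D_parent n i) i"
  assumes n: "n \<ge> 3" and b: "edge_parameters {1..n} (cartan_D n) b"
    and r: "r \<in> electrical_relators {1..n} (cartan_D n) b" "r \<in> lie_terms {1..n}"
  shows "(lie_subst (shifted_gen (c n) (D_parent n)) r, Zero) \<in>
    lie_rel (chevalley_gens {1..n}) (kac_moody_relators {1..n} (cartan_D n))"
proof (rule electrical_relators_vanish[OF D_parent_mem[OF n] _ r])
  let ?A = "cartan_D n" and ?p = "D_parent n"
  interpret km_serre "{1..n}" ?A
      "\<lambda>i. lie_emb (chevalley_gens {1..n}) (kac_moody_relators {1..n} ?A) (Gen (E i))"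
      "\<lambda>i. lie_emb (chevalley_gens {1..n}) (kac_moody_relators {1..n} ?A) (Gen (F i))"
    by (rule km_serre_presented[OF gcm_cartan_D])
  note A = cartan_D_parent[OF n] and mem = D_parent_mem[OF n] and less = D_parent_less[OF n]
  fix i j assume ij: "i \<in> {1..n}" "j \<in> {1..n}" "i \<noteq> j"
  have child: "c n i = 0 \<or> ?p i \<in> {1..n} \<and> ?p i \<noteq> i \<and> ?p i \<noteq> j \<and> ?A i (?p i) = -1 \<and> ?A (?p i) i = -1"
    if "i \<in> {1..n}" "j \<in> {1..n}" "j \<noteq> 1" "?p j = i" for i j
  proof (cases "i = 1")
    case False
    have "?p i < i" "i < j" using less[of i] less[of j] that False by auto
    then show ?thesis
      using mem[OF that(1)] A[of i "?p i"] A[of "?p i" i] that False by auto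
  qed (simp add: c_def)
  have nonadj: "?p i = ?p j \<or> ?A (?p i) (?p j) = 0"
    if "i \<noteq> 1" "j \<noteq> 1" "?p i \<noteq> j" "?p j \<noteq> i"
  proof (cases "?p i = ?p j")
    case False
    \<comment> \<open>Two distinct nodes with the same parent are the leaves n - 1 and n, and a leaf
      is not the parent of \<open>k\<close>. So the \<open>f\<close> of two distinct parents
      commute; this depends on rooting the tree at the end far from the branch.\<close>
    have *: "?p (?p k) \<noteq> ?p l"
      if "k \<in> {1..n}" "l \<in> {1..n}" "l \<noteq> 1" "?p k \<noteq> 1" "?p k \<noteq> l" for k l
      using that n by (auto simp: D_parent_def split: if_splits)
    show ?thesis
      using A[OF mem[OF ij(1)] mem[OF ij(2)] False] *[of j i] *[of i j] ij that by auto
  qed simp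
  show "lbr_pow (lie_emb (chevalley_gens {1..n}) (kac_moody_relators {1..n} ?A) (Gen (E i)) +
        c n i *\<^sub>L lie_emb (chevalley_gens {1..n}) (kac_moody_relators {1..n} ?A) (Gen (F (?p i))))
      (nat (1 - ?A i j))
      (lie_emb (chevalley_gens {1..n}) (kac_moody_relators {1..n} ?A) (Gen (E j)) +
        c n j *\<^sub>L lie_emb (chevalley_gens {1..n}) (kac_moody_relators {1..n} ?A) (Gen (F (?p j)))) +
      (if ?A i j = - 1 then 2 * b i j else 0) *\<^sub>L
      (lie_emb (chevalley_gens {1..n}) (kac_moody_relators {1..n} ?A) (Gen (E i)) +
        c n i *\<^sub>L lie_emb (chevalley_gens {1..n}) (kac_moody_relators {1..n} ?A) (Gen (F (?p i)))) = 0"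
  proof (rule shifted_simply_laced[OF ij cartan_D_sym])
    assume adj: "?A i j = -1"
    then have "b i j = b j i" using b ij by (auto simp: edge_parameters_def)
    moreover have "j \<noteq> 1 \<and> ?p j = i \<or> i \<noteq> 1 \<and> ?p i = j"
      using A[OF ij] adj by (auto split: if_splits)
    ultimately show "?p j = i \<and> c n j = b i j \<and>
        (c n i = 0 \<or> ?p i \<in> {1..n} \<and> ?p i \<noteq> i \<and> ?p i \<noteq> j \<and> ?A i (?p i) = -1 \<and> ?A (?p i) i = -1) \<or>
      ?p i = j \<and> c n i = b i j \<and>
        (c n j = 0 \<or> ?p j \<in> {1..n} \<and> ?p j \<noteq> j \<and> ?p j \<noteq> i \<and> ?A j (?p j) = -1 \<and> ?A (?p j) j = -1)"
      using child[of i j] child[of j i] ij by (auto simp: c_def)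
  next
    assume "?A i j \<noteq> -1"
    then have "?A i j = 0" "j = 1 \<or> ?p j \<noteq> i" "i = 1 \<or> ?p i \<noteq> j"
      using A[OF ij] by (auto split: if_splits)
    then show "?A i j = 0 \<and> (c n j = 0 \<or> ?p j \<in> {1..n} \<and> ?p j \<noteq> i) \<and>
      (c n i = 0 \<or> ?p i \<in> {1..n} \<and> ?p i \<noteq> j) \<and>
      (c n i = 0 \<or> c n j = 0 \<or> ?p i = ?p j \<or> ?A (?p i) (?p j) = 0)"
      using mem[OF ij(1)] mem[OF ij(2)] nonadj by (cases "i = 1"; cases "j = 1") (auto simp: c_def)
  qed
qed

lemma D_injective_hom_kac_moody:
  fixes n :: nat and b :: "nat \<Rightarrow> nat \<Rightarrow> complex"
  defines "I \<equiv> {1..n}" and "A \<equiv> cartan_D n"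
  assumes n: "n \<ge> 3" and b: "edge_parameters I A b"
  shows "defines_injective_hom (electrical I A b) (elec_u I A b) I (kac_moody I A)
    (\<lambda>i. if i = 1 then km_e I A 1
      else if i \<le> n - 2 then
        km_e I A i \<oplus>\<^bsub>kac_moody I A\<^esub> b (i - 1) i \<odot>\<^bsub>kac_moody I A\<^esub> km_f I A (i - 1)
      else km_e I A i \<oplus>\<^bsub>kac_moody I A\<^esub> b (n - 2) i \<odot>\<^bsub>kac_moody I A\<^esub> km_f I A (n - 2))"
proof -
  have "defines_injective_hom (electrical I A b) (elec_u I A b) I (kac_moody I A)
      (\<lambda>i. lie_class (chevalley_gens I) (kac_moody_relators I A)
        (shifted_gen (\<lambda>i. if i = 1 then 0 else b (D_parent n i) i) (D_parent n) i))"
    using D_parent_mem[OF n] D_relators_vanish[OF n b[unfolded I_def A_def]]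
    unfolding I_def A_def by (intro shifted_hom_kac_moody gcm_cartan_D)
  then show ?thesis
  proof (rule defines_injective_hom_cong[rotated])
    fix i assume i: "i \<in> I"
    let ?v = "\<lambda>j x. km_e I A i \<oplus>\<^bsub>kac_moody I A\<^esub> x \<odot>\<^bsub>kac_moody I A\<^esub> km_f I A j"
    have 1: "1 \<in> I" using n by (simp add: I_def)
    have gen: "lie_class (chevalley_gens I) (kac_moody_relators I A)
        (Add (Gen (E i)) (Scale x (Gen (F (D_parent n i))))) = ?v (D_parent n i) x" for x
      using i D_parent_mem[OF n i[unfolded I_def]] by (simp add: km_shifted_gen I_def)
    show "lie_class (chevalley_gens I) (kac_moody_relators I A)
        (shifted_gen (\<lambda>i. if i = 1 then 0 else b (D_parent n i) i) (D_parent n) i) =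
      (if i = 1 then km_e I A 1 else if i \<le> n - 2 then ?v (i - 1) (b (i - 1) i)
       else ?v (n - 2) (b (n - 2) i))"
    proof (cases "i = 1")
      case True
      then show ?thesis using km_e_shifted_gen[OF 1 1, of A] by (simp add: D_parent_def)
    next
      case False
      then show ?thesis unfolding gen by (simp add: D_parent_def)
    qed
  qed
qed

section \<open>The affine cycle\<close>

lemma affine_A_injective_hom:
  fixes n :: nat and b :: "nat \<Rightarrow> nat \<Rightarrow> complex"
  defines "I \<equiv> {0..<n}" and "A \<equiv> cartan_affine_A n"
  assumes n: "n \<ge> 2" and b: "edge_parameters I A b"
    and b0: "\<And>i j. i \<in> I \<Longrightarrow> j \<in> I \<Longrightarrow> A i j \<noteq> -1 \<Longrightarrow> b i j = 0"
  shows "defines_injective_hom (electrical I A b) (elec_u I A b) I (kac_moody I A)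
    (\<lambda>i. km_e I A i \<oplus>\<^bsub>kac_moody I A\<^esub>
      b ((i + n - 1) mod n) i \<odot>\<^bsub>kac_moody I A\<^esub> km_f I A ((i + n - 1) mod n))"
proof -
  define p where "p i = (i + n - 1) mod n" for i
  define c where "c i = b (p i) i" for i
  have p: "p i = (if i = 0 then n - 1 else i - 1)" if "i \<in> I" for i
  proof (cases "i = 0")
    case False
    then obtain k where "i = Suc k" by (cases i) auto
    then show ?thesis using that by (simp add: p_def I_def)
  qed (use n in \<open>simp add: p_def\<close>)
  have mem: "p i \<in> I" if "i \<in> I" for i using n by (simp add: p_def I_def)
  have next_iff: "j = (i + 1) mod n \<longleftrightarrow> p j = i" if "i \<in> I" "j \<in> I" for i j
    using that n p[OF that(2)] by (cases "i = n - 1") (auto simp: I_def)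
  have A: "A i j = (if n = 2 then -2 else if p j = i \<or> p i = j then -1 else 0)"
    if "i \<in> I" "j \<in> I" "i \<noteq> j" for i j
    unfolding A_def cartan_affine_A_def next_iff[OF that(1,2)] next_iff[OF that(2,1)]
    using that by simp
  have sym: "A i j = A j i" for i j by (auto simp: A_def cartan_affine_A_def)
  have gcm: "generalized_cartan_matrix I A"
    by (auto simp: generalized_cartan_matrix_def A_def cartan_affine_A_def)
  interpret km_serre I A "\<lambda>i. lie_emb (chevalley_gens I) (kac_moody_relators I A) (Gen (E i))"
      "\<lambda>i. lie_emb (chevalley_gens I) (kac_moody_relators I A) (Gen (F i))"
    using gcm by (rule km_serre_presented)
  have "defines_injective_hom (electrical I A b) (elec_u I A b) I (kac_moody I A)
      (\<lambda>i. lie_class (chevalley_gens I) (kac_moody_relators I A) (shifted_gen c p i))"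
  proof (rule shifted_hom_kac_moody[OF gcm mem], assumption, rule electrical_relators_vanish[OF mem], assumption)
    fix i j assume ij: "i \<in> I" "j \<in> I" "i \<noteq> j"
    let ?e = "\<lambda>i. lie_emb (chevalley_gens I) (kac_moody_relators I A) (Gen (E i))"
      and ?f = "\<lambda>i. lie_emb (chevalley_gens I) (kac_moody_relators I A) (Gen (F i))"
    show "lbr_pow (?e i + c i *\<^sub>L ?f (p i)) (nat (1 - A i j)) (?e j + c j *\<^sub>L ?f (p j)) +
        (if A i j = - 1 then 2 * b i j else 0) *\<^sub>L (?e i + c i *\<^sub>L ?f (p i)) = 0"
    proof (cases "n = 2")
      case True
      \<comment> \<open>For n = 2 the off-diagonal entries are -2, so no pair carries a parameter
        and the relations are the Serre relations themselves.\<close>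
      have "c k = 0" if "k \<in> I" for k
        unfolding c_def using that mem[OF that] True
        by (intro b0) (auto simp: A_def cartan_affine_A_def)
      then show ?thesis using A[OF ij] True serre_e[OF ij] ij by simp
    next
      case False
      \<comment> \<open>For n at least 3 the predecessor map is a cyclic permutation without fixed
        points and 2-cycles. Being injective, it carries nonadjacent nodes to nonadjacent nodes, so
        the corresponding \<open>f\<close> commute.\<close>
      have p_neq: "p k \<noteq> k" "p (p k) \<noteq> k" if "k \<in> I" for k
        using that n False p[OF that] p[OF mem[OF that]] by (auto simp: I_def split: if_splits)
      have p_inj: "p k = p l \<Longrightarrow> k = l" if "k \<in> I" "l \<in> I" for k l
        using that n p[OF that(1)] p[OF that(2)] by (auto simp: I_def split: if_splits)
      have Ap: "A k (p k) = -1" "A (p k) k = -1" if "k \<in> I" for k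
        using that mem[OF that] p_neq[OF that] A[of k "p k"] A[of "p k" k] False by auto
      show ?thesis
      proof (rule shifted_simply_laced[OF ij sym])
        assume adj: "A i j = -1"
        then have "b i j = b j i" using b ij by (auto simp: edge_parameters_def)
        moreover have "p j = i \<or> p i = j"
          using A[OF ij] adj by (auto split: if_splits)
        ultimately show "p j = i \<and> c j = b i j \<and>
            (c i = 0 \<or> p i \<in> I \<and> p i \<noteq> i \<and> p i \<noteq> j \<and> A i (p i) = -1 \<and> A (p i) i = -1) \<or>
          p i = j \<and> c i = b i j \<and>
            (c j = 0 \<or> p j \<in> I \<and> p j \<noteq> j \<and> p j \<noteq> i \<and> A j (p j) = -1 \<and> A (p j) j = -1)"
          using ij mem p_neq Ap by (auto simp: c_def)
      next
        assume "A i j \<noteq> -1"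
        then have *: "A i j = 0" "p j \<noteq> i" "p i \<noteq> j"
          using A[OF ij] False by (auto split: if_splits)
        then have "p i \<noteq> p j" "p (p j) \<noteq> p i" "p (p i) \<noteq> p j"
          using p_inj[of i j] p_inj[of "p j" i] p_inj[of "p i" j] ij mem by auto
        then have "A (p i) (p j) = 0"
          using A[OF mem[OF ij(1)] mem[OF ij(2)]] False by simp
        then show "A i j = 0 \<and> (c j = 0 \<or> p j \<in> I \<and> p j \<noteq> i) \<and> (c i = 0 \<or> p i \<in> I \<and> p i \<noteq> j) \<and>
            (c i = 0 \<or> c j = 0 \<or> p i = p j \<or> A (p i) (p j) = 0)"
          using * ij mem by simp
      qed
    qed
  qed
  then show ?thesis
    by (rule defines_injective_hom_cong[rotated])
      (use mem in \<open>simp add: km_shifted_gen c_def p_def\<close>)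
qed

section \<open>Ideals meeting the Cartan subalgebra trivially\<close>

lemma lbr_pow_eq_0_mono: "lbr_pow z a x = 0 \<Longrightarrow> a \<le> b \<Longrightarrow> lbr_pow z b x = 0"
  using funpow_add[of "b - a" a "lbr z"] by simp

text \<open>One application of ad z to a bracket lowers one of the two exponents by the Leibniz
  rule, so the induction runs on their sum.\<close>

lemma lbr_pow_lbr_eq_0:
  assumes "lbr_pow z a x = 0" "lbr_pow z b y = 0"
  shows "lbr_pow z (a + b) \<lblot>x, y\<rblot> = 0"
  using assms
proof (induction "a + b" arbitrary: a b x y)
  case 0
  then show ?case by simp
next
  case (Suc n)
  show ?case
  proof (cases "a = 0 \<or> b = 0")
    case True
    then show ?thesis using Suc.prems by auto
  next
    case False
    then obtain a' b' where ab: "a = Suc a'" "b = Suc b'" by (auto simp: gr0_conv_Suc)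
    have "lbr_pow z (a' + b) \<lblot>\<lblot>z, x\<rblot>, y\<rblot> = 0"
      by (rule Suc.hyps(1)) (use Suc ab in \<open>simp_all add: funpow_swap1\<close>)
    moreover have "lbr_pow z (a + b') \<lblot>x, \<lblot>z, y\<rblot>\<rblot> = 0"
      by (rule Suc.hyps(1)) (use Suc ab in \<open>simp_all add: funpow_swap1\<close>)
    ultimately have "lbr_pow z n \<lblot>z, \<lblot>x, y\<rblot>\<rblot> = 0"
      using Suc.hyps(2) ab lbr_leibniz[of z x y] by (simp add: lbr_pow_add lbr_add_right)
    moreover have "lbr_pow z (a + b) \<lblot>x, y\<rblot> = lbr_pow z n \<lblot>z, \<lblot>x, y\<rblot>\<rblot>"
      unfolding Suc.hyps(2)[symmetric] by (simp add: funpow_swap1)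
    ultimately show ?thesis by simp
  qed
qed

lemma lbr_span:
  assumes "cl.subspace S" "\<And>y. y \<in> B \<Longrightarrow> \<lblot>z, y\<rblot> \<in> S" "x \<in> cl.span B"
  shows "\<lblot>z, x\<rblot> \<in> S"
  using assms(3)
proof (induction rule: cl.span_induct_alt)
  case (step c x y)
  then show ?case using assms(1,2) by (simp add: lbr_add_right cl.subspace_add cl.subspace_scale)
qed (use assms(1) in \<open>simp add: cl.subspace_0\<close>)

text \<open>For \<open>\<beta>\<close> different from \<open>\<alpha>\<close> choose i at which they
  differ. Subtracting \<open>\<alpha> i\<close> times the sum from its bracket with
  \<open>z i\<close> removes the \<open>\<alpha>\<close> component and multiplies that of
  \<open>\<beta>\<close> by a nonzero scalar. Weights are functions on the whole index type;
  vanishing off \<open>I\<close> guarantees that distinct ones differ at an index in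
  \<open>I\<close>.\<close>

lemma weight_components:
  fixes g :: "('i \<Rightarrow> complex) \<Rightarrow> 'a::complex_lie" and z :: "'i \<Rightarrow> 'a"
  assumes "finite \<Lambda>" "cl.subspace K"
    and K: "\<And>i x. i \<in> I \<Longrightarrow> x \<in> K \<Longrightarrow> \<lblot>z i, x\<rblot> \<in> K"
    and "\<And>i \<alpha>. i \<in> I \<Longrightarrow> \<alpha> \<in> \<Lambda> \<Longrightarrow> \<lblot>z i, g \<alpha>\<rblot> = \<alpha> i *\<^sub>L g \<alpha>"
    and "\<And>i \<alpha>. i \<notin> I \<Longrightarrow> \<alpha> \<in> \<Lambda> \<Longrightarrow> \<alpha> i = 0"
    and "(\<Sum>\<alpha>\<in>\<Lambda>. g \<alpha>) \<in> K"
  shows "\<forall>\<beta>\<in>\<Lambda>. g \<beta> \<in> K"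
  using assms(1,4-)
proof (induction \<Lambda> arbitrary: g rule: finite_induct)
  case empty
  then show ?case by simp
next
  case (insert \<alpha> \<Lambda>)
  let ?x = "\<Sum>\<gamma>\<in>insert \<alpha> \<Lambda>. g \<gamma>"
  have \<Lambda>: "g \<beta> \<in> K" if \<beta>: "\<beta> \<in> \<Lambda>" for \<beta>
  proof -
    have "\<beta> \<noteq> \<alpha>" using \<beta> insert.hyps by auto
    then obtain i where i: "\<beta> i \<noteq> \<alpha> i" by auto
    then have "i \<in> I" using insert.prems(2)[of i] \<beta> by force
    let ?g = "\<lambda>\<gamma>. (\<gamma> i - \<alpha> i) *\<^sub>L g \<gamma>"
    have "\<forall>\<gamma>\<in>\<Lambda>. ?g \<gamma> \<in> K"
    proof (rule insert.IH)
      show "\<lblot>z k, ?g \<gamma>\<rblot> = \<gamma> k *\<^sub>L ?g \<gamma>" if "k \<in> I" "\<gamma> \<in> \<Lambda>" for k \<gamma>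
        using insert.prems(1) that by (simp add: mult.commute)
      show "\<gamma> k = 0" if "k \<notin> I" "\<gamma> \<in> \<Lambda>" for k \<gamma>
        using insert.prems(2) that by blast
      have "\<lblot>z i, ?x\<rblot> = (\<Sum>\<gamma>\<in>insert \<alpha> \<Lambda>. \<gamma> i *\<^sub>L g \<gamma>)"
        unfolding lbr_sum_right using insert.prems(1) \<open>i \<in> I\<close> by (intro sum.cong) auto
      then have "\<lblot>z i, ?x\<rblot> - \<alpha> i *\<^sub>L ?x = (\<Sum>\<gamma>\<in>insert \<alpha> \<Lambda>. ?g \<gamma>)"
        by (simp only: cl.scale_sum_right sum_subtractf[symmetric] cl.scale_left_diff_distrib)
      also have "\<dots> = (\<Sum>\<gamma>\<in>\<Lambda>. ?g \<gamma>)"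
        using insert.hyps by simp
      finally show "(\<Sum>\<gamma>\<in>\<Lambda>. ?g \<gamma>) \<in> K"
        using insert.prems(3) K[OF \<open>i \<in> I\<close> insert.prems(3)] assms(2)
        by (metis cl.subspace_diff cl.subspace_scale)
    qed
    then have "?g \<beta> \<in> K" using \<beta> by blast
    from cl.subspace_scale[OF assms(2) this, of "inverse (\<beta> i - \<alpha> i)"]
    show ?thesis using i by simp
  qed
  have "g \<alpha> = ?x - (\<Sum>\<gamma>\<in>\<Lambda>. g \<gamma>)" using insert.hyps by simp
  also have "\<dots> \<in> K"
    by (rule cl.subspace_diff[OF assms(2) insert.prems(3) cl.subspace_sum[OF assms(2) \<Lambda>]])
  finally show ?case using \<Lambda> by simp
qed

section \<open>Right-normed brackets of given length and weight\<close>

context km_serre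
begin

text \<open>The length is recorded besides the weight because the weight is seen only through its
  values on the coroots, and these do not determine the length if the Cartan matrix is
  singular.\<close>

definition root_span :: "nat \<Rightarrow> ('i \<Rightarrow> complex) \<Rightarrow> 'a set" where
  "root_span m \<alpha> = cl.span {right_bracket e w | w. set w \<subseteq> I \<and> length w = m \<and>
     (\<forall>k\<in>I. word_weight A k w = \<alpha> k)}"

lemma root_span_base:
  "set w \<subseteq> I \<Longrightarrow> length w = m \<Longrightarrow> (\<And>k. k \<in> I \<Longrightarrow> word_weight A k w = \<alpha> k) \<Longrightarrow>
    right_bracket e w \<in> root_span m \<alpha>"
  unfolding root_span_def by (rule cl.span_base) blast

lemma root_span_subspace: "cl.subspace (root_span m \<alpha>)"
  unfolding root_span_def by (rule cl.subspace_span)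

lemma h_right_bracket:
  "i \<in> I \<Longrightarrow> set w \<subseteq> I \<Longrightarrow>
    \<lblot>\<lblot>e i, f i\<rblot>, right_bracket e w\<rblot> = word_weight A i w *\<^sub>L right_bracket e w"
proof (induction w)
  case (Cons j w)
  show ?case
  proof (cases "w = []")
    case False
    then show ?thesis
      using Cons he[of i j] lbr_leibniz[of "\<lblot>e i, f i\<rblot>" "e j" "right_bracket e w"]
      by (simp add: right_bracket_Cons scl_add_left)
  qed (use Cons he in simp)
qed simp

lemma h_root_span:
  assumes "i \<in> I" "x \<in> root_span m \<alpha>"
  shows "\<lblot>\<lblot>e i, f i\<rblot>, x\<rblot> = \<alpha> i *\<^sub>L x"
  using assms(2) unfolding root_span_def
proof (induction rule: cl.span_induct_alt)
  case (step c x y)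
  then have "\<lblot>\<lblot>e i, f i\<rblot>, x\<rblot> = \<alpha> i *\<^sub>L x" using h_right_bracket assms(1) by auto
  then show ?case using step by (simp add: lbr_add_right scl_add_right mult.commute)
qed simp

lemma e_root_span:
  assumes "j \<in> I" "x \<in> root_span m \<alpha>" "m \<ge> 1" "\<And>k. k \<in> I \<Longrightarrow> \<beta> k = \<alpha> k + of_int (A k j)"
  shows "\<lblot>e j, x\<rblot> \<in> root_span (Suc m) \<beta>"
  using assms(2) unfolding root_span_def[of m]
proof (induction rule: cl.span_induct_alt)
  case base
  then show ?case by (simp add: cl.subspace_0[OF root_span_subspace])
next
  case (step c x y)
  then obtain w where w: "set w \<subseteq> I" "length w = m" "\<forall>k\<in>I. word_weight A k w = \<alpha> k"
      "x = right_bracket e w" by blast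
  then have "\<lblot>e j, x\<rblot> = right_bracket e (j # w)"
    using assms(3) by (subst right_bracket_Cons) auto
  also have "\<dots> \<in> root_span (Suc m) \<beta>"
    using w assms(1,4) by (intro root_span_base) auto
  finally show ?case
    using step by (simp add: lbr_add_right cl.subspace_add cl.subspace_scale root_span_subspace)
qed

text \<open>Commuting \<open>f i\<close> with the first letter gives a coroot term, which is scalar
  on the remaining bracket, plus the first letter applied to the induction hypothesis. Length 2 is
  exceptional, since there \<open>f i\<close> sends the inner letter into the Cartan part.\<close>

lemma f_right_bracket:
  assumes "i \<in> I" "set w \<subseteq> I" "w \<noteq> []" "\<And>k. k \<in> I \<Longrightarrow> \<beta> k = word_weight A k w - of_int (A k i)"
  shows "\<lblot>f i, right_bracket e w\<rblot> \<in> (if length w = 1 then cl.span ((\<lambda>k. \<lblot>e k, f k\<rblot>) ` I)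
    else root_span (length w - 1) \<beta>)"
  using assms(2-)
proof (induction w arbitrary: \<beta>)
  case Nil
  then show ?case by simp
next
  case (Cons j w)
  have j: "j \<in> I" using Cons.prems by simp
  note fij = fe[OF assms(1) j]
  show ?case
  proof (cases "w = []")
    case True
    have "\<lblot>f i, e i\<rblot> \<in> cl.span ((\<lambda>k. \<lblot>e k, f k\<rblot>) ` I)"
      unfolding lbr_antisym[of "f i" "e i"] using assms(1) by (simp add: cl.span_neg cl.span_base)
    then show ?thesis using True fij by (cases "i = j") (auto simp: cl.span_zero)
  next
    case w: False
    note sub = root_span_subspace[of "length w" \<beta>]
    let ?x = "right_bracket e w"
    have "\<lblot>\<lblot>f i, e j\<rblot>, ?x\<rblot> \<in> root_span (length w) \<beta>"
    proof (cases "i = j")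
      case True
      have "?x \<in> root_span (length w) \<beta>"
        using Cons.prems True by (intro root_span_base) auto
      then show ?thesis
        using h_right_bracket[of i w] Cons.prems True lbr_antisym[of "f i" "e i"] assms(1)
        by (auto intro!: cl.subspace_neg[OF sub] cl.subspace_scale[OF sub])
    qed (use fij cl.subspace_0[OF sub] in simp)
    moreover have "\<lblot>e j, \<lblot>f i, ?x\<rblot>\<rblot> \<in> root_span (length w) \<beta>"
    proof (cases "length w = 1")
      case True
      then obtain k where k: "w = [k]" by (auto simp: length_Suc_conv)
      show ?thesis
      proof (cases "i = k")
        case True
        have "e j \<in> root_span (length w) \<beta>"
          using root_span_base[of "[j]" 1 \<beta>] Cons.prems k True by auto
        then show ?thesis
          using k True lbr_h_e[of i j] assms(1) j lbr_antisym[of "f i" "e i"]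
          by (auto intro!: cl.subspace_scale[OF root_span_subspace])
      qed (use k fe[of i k] assms(1) Cons.prems cl.subspace_0[OF sub] in simp)
    next
      case False
      then have len: "length w - 1 \<ge> 1" using w by (cases w) (auto simp: Suc_le_eq)
      have "\<lblot>f i, ?x\<rblot> \<in> root_span (length w - 1) (\<lambda>k. word_weight A k w - of_int (A k i))"
        using Cons.IH[of "\<lambda>k. word_weight A k w - of_int (A k i)"] Cons.prems w False by simp
      moreover have "Suc (length w - 1) = length w" using w by simp
      ultimately show ?thesis
        using e_root_span[OF j _ len, of _ _ \<beta>] Cons.prems(3) by (auto simp: algebra_simps)
    qed
    ultimately have "\<lblot>f i, \<lblot>e j, ?x\<rblot>\<rblot> \<in> root_span (length w) \<beta>"
      using lbr_leibniz[of "f i" "e j" ?x] cl.subspace_add[OF sub] by simp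
    then show ?thesis using w by (simp add: right_bracket_Cons)
  qed
qed

lemma f_root_span:
  assumes "i \<in> I" "x \<in> root_span m \<alpha>" "m \<ge> 1" "\<And>k. k \<in> I \<Longrightarrow> \<beta> k = \<alpha> k - of_int (A k i)"
  shows "\<lblot>f i, x\<rblot> \<in> (if m = 1 then cl.span ((\<lambda>k. \<lblot>e k, f k\<rblot>) ` I) else root_span (m - 1) \<beta>)"
proof -
  let ?S = "if m = 1 then cl.span ((\<lambda>k. \<lblot>e k, f k\<rblot>) ` I) else root_span (m - 1) \<beta>"
  have sub: "cl.subspace ?S" by (simp add: root_span_subspace)
  show ?thesis
    using assms(2) unfolding root_span_def[of m]
  proof (induction rule: cl.span_induct_alt)
    case base
    then show ?case using cl.subspace_0[OF sub] by simp
  next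
    case (step c x y)
    then obtain w where w: "set w \<subseteq> I" "length w = m" "\<forall>k\<in>I. word_weight A k w = \<alpha> k"
        "x = right_bracket e w" by blast
    have "\<lblot>f i, x\<rblot> \<in> ?S"
      using f_right_bracket[OF assms(1) w(1), of \<beta>] w assms(3,4) by fastforce
    then show ?case
      using step cl.subspace_add[OF sub] cl.subspace_scale[OF sub] by (simp only: lbr_add_right lbr_scl_right)
  qed
qed

text \<open>On a generator this is a Serre relation or antisymmetry; the Leibniz rule carries it to
  brackets, with an exponent that depends on the element.\<close>

lemma e_nilpotent:
  assumes "i \<in> I" "x \<in> root_span m \<alpha>"
  shows "\<exists>N. lbr_pow (e i) N x = 0"
proof -
  have gen: "\<exists>N. lbr_pow (e i) N (e j) = 0" if "j \<in> I" for j
  proof (cases "i = j")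
    case True
    then show ?thesis by (intro exI[of _ 1]) simp
  qed (use serre_e[OF assms(1) that] in blast)
  have word: "\<exists>N. lbr_pow (e i) N (right_bracket e w) = 0" if "set w \<subseteq> I" for w
    using that
  proof (induction w)
    case (Cons j w)
    then obtain N M where NM: "lbr_pow (e i) N (right_bracket e w) = 0" "lbr_pow (e i) M (e j) = 0"
      using gen[of j] by auto
    show ?case
    proof (cases "w = []")
      case False
      then show ?thesis
        using lbr_pow_lbr_eq_0[OF NM(2,1)] by (auto simp: right_bracket_Cons)
    qed (use NM in auto)
  qed simp
  show ?thesis
    using assms(2) unfolding root_span_def
  proof (induction rule: cl.span_induct_alt)
    case base
    then show ?case by (intro exI[of _ 0]) simp
  next
    case (step c x y)
    then obtain N M where NM: "lbr_pow (e i) N x = 0" "lbr_pow (e i) M y = 0"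
      using word by blast
    then have "lbr_pow (e i) (N + M) x = 0" "lbr_pow (e i) (N + M) y = 0"
      by (auto intro: lbr_pow_eq_0_mono)
    then show ?case by (intro exI[of _ "N + M"]) (simp add: lbr_pow_add)
  qed
qed

text \<open>A vector killed by all \<open>f\<^sub>i\<close> has antidominant weight, so its height, a positive combination
  of the values of its weight on the coroots, is not positive.\<close>

lemma ideal_root_span_eq_0:
  fixes c :: "'i \<Rightarrow> real"
  assumes "finite I" and K: "cl.subspace K" "\<And>i x. i \<in> I \<Longrightarrow> x \<in> K \<Longrightarrow> \<lblot>f i, x\<rblot> \<in> K"
      "\<And>x. x \<in> K \<Longrightarrow> x \<in> cl.span ((\<lambda>k. \<lblot>e k, f k\<rblot>) ` I) \<Longrightarrow> x = 0"
    and c: "\<And>i. i \<in> I \<Longrightarrow> c i \<ge> 0" "\<And>j. j \<in> I \<Longrightarrow> (\<Sum>i\<in>I. c i * of_int (A i j)) = 1"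
    and x: "x \<in> K" "x \<in> root_span (Suc m) \<alpha>"
  shows "x = 0"
  using x
proof (induction m arbitrary: x \<alpha>)
  have step: "x = 0" if x: "x \<in> K" "x \<in> root_span (Suc m) \<alpha>"
    and fx: "\<And>i. i \<in> I \<Longrightarrow> \<lblot>f i, x\<rblot> = 0" for m x \<alpha>
  proof (rule ccontr)
    assume "x \<noteq> 0"
    have "{right_bracket e w | w. set w \<subseteq> I \<and> length w = Suc m \<and> (\<forall>k\<in>I. word_weight A k w = \<alpha> k)} \<noteq> {}"
      using x(2) \<open>x \<noteq> 0\<close> unfolding root_span_def by (metis cl.span_empty singletonD)
    then obtain w where w: "set w \<subseteq> I" "length w = Suc m" "\<And>k. k \<in> I \<Longrightarrow> word_weight A k w = \<alpha> k"
      by blast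
    \<comment> \<open>If the coroot value were positive, the scalars in \<open>sl2_lower\<close>
      would never vanish. A vanishing power of ad \<open>e i\<close> on \<open>x\<close> could then
      be lowered step by step to \<open>x = 0\<close>, against local nilpotency.\<close>
    have le: "(\<Sum>j\<leftarrow>w. A i j) \<le> 0" if i: "i \<in> I" for i
    proof (rule ccontr)
      assume pos: "\<not> (\<Sum>j\<leftarrow>w. A i j) \<le> 0"
      have \<alpha>: "\<alpha> i = of_int (\<Sum>j\<leftarrow>w. A i j)"
      proof -
        have "word_weight A i w = of_int (\<Sum>j\<leftarrow>w. A i j)" by (induction w) simp_all
        then show ?thesis using w(3)[OF i] by simp
      qed
      have nz: "\<alpha> i + of_nat r \<noteq> 0" for r
      proof -
        have "(\<Sum>j\<leftarrow>w. A i j) + int r \<noteq> 0" using pos by simp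
        then have "of_int ((\<Sum>j\<leftarrow>w. A i j) + int r) \<noteq> (0::complex)"
          by (metis of_int_eq_0_iff)
        then show ?thesis unfolding \<alpha> by simp
      qed
      have down: "lbr_pow (e i) r x = 0" if "lbr_pow (e i) (Suc r) x = 0" for r
      proof -
        have "(- of_nat (Suc r) * (\<alpha> i + of_nat r)) *\<^sub>L lbr_pow (e i) r x = 0"
          using sl2_lower[of "e i" "f i" "\<lblot>e i, f i\<rblot>" x "\<alpha> i" r] that fx[OF i] he[OF i i] diag[OF i]
            h_root_span[OF i x(2)] by simp
        then show ?thesis
          using nz[of r] of_nat_neq_0[of r, where 'a = complex]
          by (simp add: cl.scale_eq_0_iff del: of_nat_Suc)
      qed
      have "x = 0" if "lbr_pow (e i) N x = 0" for N
        using that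
      proof (induction N)
        case (Suc N)
        then show ?case using down by blast
      qed simp
      then show False using e_nilpotent[OF i x(2)] \<open>x \<noteq> 0\<close> by blast
    qed
    \<comment> \<open>Each letter contributes 1 by the choice of \<open>c\<close>, so the
      combination computes the height.\<close>
    have "(\<Sum>i\<in>I. c i * of_int (\<Sum>j\<leftarrow>w. A i j)) = of_nat (length w)"
      using w(1)
    proof (induction w)
      case (Cons j w)
      then show ?case using c(2)[of j] by (simp add: distrib_left sum.distrib)
    qed simp
    moreover have "(\<Sum>i\<in>I. c i * of_int (\<Sum>j\<leftarrow>w. A i j)) \<le> 0"
      using c(1) le by (intro sum_nonpos mult_nonneg_nonpos) auto
    ultimately show False using w(2) by simp
  qed
  {
    case 0
    have "\<lblot>f i, x\<rblot> = 0" if "i \<in> I" for i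
      using f_root_span[OF that 0(2) _ HOL.refl] K(2)[OF that 0(1)] K(3) by simp
    then show ?case using step 0 by blast
  next
    case (Suc m)
    have "\<lblot>f i, x\<rblot> = 0" if "i \<in> I" for i
      using f_root_span[OF that Suc.prems(2) _ HOL.refl] K(2)[OF that Suc.prems(1)] Suc.IH by simp
    then show ?case using step Suc.prems by blast
  }
qed

end

section \<open>Triangular decomposition and weight components\<close>

context km_serre
begin

definition triangular :: "'a set" where
  "triangular = cl.span ({right_bracket e w | w. w \<noteq> [] \<and> set w \<subseteq> I} \<union> (\<lambda>k. \<lblot>e k, f k\<rblot>) ` I \<union>
     {right_bracket f w | w. w \<noteq> [] \<and> set w \<subseteq> I})"

lemma triangular_subspace: "cl.subspace triangular"
  unfolding triangular_def by (rule cl.subspace_span)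

lemma triangular_base:
  "w \<noteq> [] \<Longrightarrow> set w \<subseteq> I \<Longrightarrow> right_bracket e w \<in> triangular"
  "k \<in> I \<Longrightarrow> \<lblot>e k, f k\<rblot> \<in> triangular"
  "w \<noteq> [] \<Longrightarrow> set w \<subseteq> I \<Longrightarrow> right_bracket f w \<in> triangular"
  unfolding triangular_def by (rule cl.span_base, blast)+

lemma span_h_swapped: "cl.span ((\<lambda>k. \<lblot>f k, e k\<rblot>) ` I) \<subseteq> cl.span ((\<lambda>k. \<lblot>e k, f k\<rblot>) ` I)"
proof (rule cl.span_minimal)
  show "(\<lambda>k. \<lblot>f k, e k\<rblot>) ` I \<subseteq> cl.span ((\<lambda>k. \<lblot>e k, f k\<rblot>) ` I)"
  proof
    fix x assume "x \<in> (\<lambda>k. \<lblot>f k, e k\<rblot>) ` I"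
    then obtain k where "k \<in> I" "x = - \<lblot>e k, f k\<rblot>" using lbr_antisym by blast
    then show "x \<in> cl.span ((\<lambda>k. \<lblot>e k, f k\<rblot>) ` I)" by (simp add: cl.span_neg cl.span_base)
  qed
qed simp

lemma triangular_swapped_subset: "km_serre.triangular I f e \<subseteq> triangular"
  unfolding km_serre.triangular_def[OF swapped']
proof (rule cl.span_minimal[OF _ triangular_subspace])
  have "cl.span ((\<lambda>k. \<lblot>e k, f k\<rblot>) ` I) \<subseteq> triangular"
    by (rule cl.span_minimal[OF _ triangular_subspace]) (auto intro: triangular_base)
  then have "(\<lambda>k. \<lblot>f k, e k\<rblot>) ` I \<subseteq> triangular"
    using span_h_swapped cl.span_superset by blast
  then show "{right_bracket f w | w. w \<noteq> [] \<and> set w \<subseteq> I} \<union> (\<lambda>k. \<lblot>f k, e k\<rblot>) ` I \<union>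
      {right_bracket e w | w. w \<noteq> [] \<and> set w \<subseteq> I} \<subseteq> triangular"
    by (auto intro: triangular_base)
qed

lemma f_triangular:
  assumes "i \<in> I" "x \<in> triangular"
  shows "\<lblot>f i, x\<rblot> \<in> triangular"
proof -
  note sub = triangular_subspace
  have "\<lblot>f i, y\<rblot> \<in> triangular"
    if "y \<in> {right_bracket e w | w. w \<noteq> [] \<and> set w \<subseteq> I} \<union> (\<lambda>k. \<lblot>e k, f k\<rblot>) ` I \<union>
     {right_bracket f w | w. w \<noteq> [] \<and> set w \<subseteq> I}" for y
    using that
  proof (elim UnE)
    assume "y \<in> {right_bracket e w | w. w \<noteq> [] \<and> set w \<subseteq> I}"
    then obtain w where w: "y = right_bracket e w" "w \<noteq> []" "set w \<subseteq> I" by blast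
    define \<beta> :: "'i \<Rightarrow> complex" where "\<beta> k = word_weight A k w - of_int (A k i)" for k
    have "cl.span ((\<lambda>k. \<lblot>e k, f k\<rblot>) ` I) \<subseteq> triangular"
      by (rule cl.span_minimal[OF _ sub]) (auto intro: triangular_base)
    moreover have "root_span (length w - 1) \<beta> \<subseteq> triangular" if "length w \<noteq> 1"
      unfolding root_span_def
    proof (rule cl.span_minimal[OF _ sub], safe)
      fix v assume "set v \<subseteq> I" "length v = length w - 1"
      then show "right_bracket e v \<in> triangular"
        using that w(2) by (intro triangular_base) (cases w; auto)
    qed
    ultimately show ?thesis
      using f_right_bracket[OF assms(1) w(3,2), of \<beta>] w(1) by (auto simp: \<beta>_def split: if_splits)
  next
    assume "y \<in> (\<lambda>k. \<lblot>e k, f k\<rblot>) ` I"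
    then obtain k where k: "k \<in> I" "y = \<lblot>e k, f k\<rblot>" by blast
    have "right_bracket f [i] \<in> triangular" using assms(1) by (intro triangular_base) auto
    then show ?thesis
      using lbr_h_f[OF k(1) assms(1)] k(2) cl.subspace_scale[OF sub] by simp
  next
    assume "y \<in> {right_bracket f w | w. w \<noteq> [] \<and> set w \<subseteq> I}"
    then obtain w where w: "y = right_bracket f w" "w \<noteq> []" "set w \<subseteq> I" by blast
    then have "\<lblot>f i, y\<rblot> = right_bracket f (i # w)" by (simp add: right_bracket_Cons)
    then show ?thesis using w assms(1) by (simp add: triangular_base del: right_bracket.simps)
  qed
  then show ?thesis
    using assms(2) unfolding triangular_def[symmetric]
    by (intro lbr_span[OF sub, of _ "f i" x]) (auto simp: triangular_def)
qed

lemma triangular_swapped: "km_serre.triangular I f e = triangular"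
  using triangular_swapped_subset km_serre.triangular_swapped_subset[OF swapped'] by blast

lemma e_triangular: "i \<in> I \<Longrightarrow> x \<in> triangular \<Longrightarrow> \<lblot>e i, x\<rblot> \<in> triangular"
  using km_serre.f_triangular[OF swapped'] by (simp add: triangular_swapped)

text \<open>The span is stable under the generators, hence under all values of terms because ad is a
  representation. A bracket then lies in it as soon as its second factor does.\<close>

lemma lie_val_triangular:
  assumes v: "\<And>i. i \<in> I \<Longrightarrow> v (E i) = e i" "\<And>i. i \<in> I \<Longrightarrow> v (F i) = f i"
    and t: "t \<in> lie_terms (chevalley_gens I)"
  shows "lie_val v t \<in> triangular"
proof -
  note sub = triangular_subspace
  have ad: "\<lblot>lie_val v t, x\<rblot> \<in> triangular" if "t \<in> lie_terms (chevalley_gens I)" "x \<in> triangular" for t x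
    using that
  proof (induction t arbitrary: x)
    case (Gen g)
    then show ?case by (cases g) (auto simp: v e_triangular f_triangular)
  next
    case (Br s t)
    have "\<lblot>\<lblot>lie_val v s, lie_val v t\<rblot>, x\<rblot> =
        \<lblot>lie_val v s, \<lblot>lie_val v t, x\<rblot>\<rblot> - \<lblot>lie_val v t, \<lblot>lie_val v s, x\<rblot>\<rblot>"
      using lbr_leibniz[of "lie_val v s" "lie_val v t" x] by simp
    then show ?case using Br by (simp add: cl.subspace_diff[OF sub])
  qed (auto simp: lbr_add_left cl.subspace_0[OF sub] cl.subspace_add[OF sub] cl.subspace_scale[OF sub])
  show ?thesis
    using t
  proof (induction t)
    case (Gen g)
    then show ?case
      using triangular_base(1)[of "[_]"] triangular_base(3)[of "[_]"] by (cases g) (auto simp: v)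
  next
    case (Br s t)
    then show ?case using ad by simp
  qed (auto simp: cl.subspace_0[OF sub] cl.subspace_add[OF sub] cl.subspace_scale[OF sub])
qed

text \<open>Zero off \<open>I\<close>, so that two weights are equal as functions exactly when they
  agree on the coroots of \<open>I\<close>.\<close>

definition root_of :: "'i list \<Rightarrow> 'i \<Rightarrow> complex" where
  "root_of w k = (if k \<in> I then word_weight A k w else 0)"

definition weight_part :: "('i \<Rightarrow> complex) \<Rightarrow> 'a set" where
  "weight_part \<alpha> = cl.span ({right_bracket e w | w. w \<noteq> [] \<and> set w \<subseteq> I \<and> root_of w = \<alpha>} \<union>
     {\<lblot>e k, f k\<rblot> | k. k \<in> I \<and> \<alpha> = (\<lambda>_. 0)} \<union>
     {right_bracket f w | w. w \<noteq> [] \<and> set w \<subseteq> I \<and> root_of w = (\<lambda>k. - \<alpha> k)})"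

lemma h_weight_part:
  assumes "i \<in> I" "x \<in> weight_part \<alpha>"
  shows "\<lblot>\<lblot>e i, f i\<rblot>, x\<rblot> = \<alpha> i *\<^sub>L x"
  using assms(2) unfolding weight_part_def
proof (induction rule: cl.span_induct_alt)
  case (step c x y)
  have "\<lblot>\<lblot>e i, f i\<rblot>, x\<rblot> = \<alpha> i *\<^sub>L x"
    using step(1)
  proof (elim UnE)
    assume "x \<in> {right_bracket f w | w. w \<noteq> [] \<and> set w \<subseteq> I \<and> root_of w = (\<lambda>k. - \<alpha> k)}"
    then obtain w where w: "x = right_bracket f w" "set w \<subseteq> I" "root_of w i = - \<alpha> i" by auto
    have "\<lblot>\<lblot>f i, e i\<rblot>, x\<rblot> = (- \<alpha> i) *\<^sub>L x"
      using km_serre.h_right_bracket[OF swapped' assms(1) w(2)] w assms(1) by (simp add: root_of_def)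
    then show ?thesis by (simp add: lbr_antisym[of "f i" "e i"])
  qed (use h_right_bracket hh assms(1) in \<open>auto simp: root_of_def\<close>)
  then show ?case using step by (simp add: lbr_add_right scl_add_right mult.commute)
qed simp

lemma triangular_decomp:
  assumes "x \<in> triangular"
  shows "\<exists>\<Lambda> g. finite \<Lambda> \<and> x = (\<Sum>\<alpha>\<in>\<Lambda>. g \<alpha>) \<and> (\<forall>\<alpha>\<in>\<Lambda>. g \<alpha> \<in> weight_part \<alpha> \<and> (\<forall>k. k \<notin> I \<longrightarrow> \<alpha> k = 0))"
  using assms unfolding triangular_def
proof (induction rule: cl.span_induct_alt)
  case base
  then show ?case by (intro exI[of _ "{}"]) auto
next
  case (step c x y)
  have sub: "cl.subspace (weight_part \<alpha>)" for \<alpha> by (simp add: weight_part_def)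
  obtain \<Lambda> g where g: "finite \<Lambda>" "y = (\<Sum>\<alpha>\<in>\<Lambda>. g \<alpha>)"
      "\<forall>\<alpha>\<in>\<Lambda>. g \<alpha> \<in> weight_part \<alpha> \<and> (\<forall>k. k \<notin> I \<longrightarrow> \<alpha> k = 0)"
    using step.IH by blast
  obtain \<beta> where \<beta>: "x \<in> weight_part \<beta>" "\<forall>k. k \<notin> I \<longrightarrow> \<beta> k = 0"
    using step(1)
  proof (elim UnE)
    assume "x \<in> {right_bracket e w | w. w \<noteq> [] \<and> set w \<subseteq> I}"
    then obtain w where "x = right_bracket e w" "w \<noteq> []" "set w \<subseteq> I" by blast
    then have "x \<in> weight_part (root_of w)" unfolding weight_part_def by (intro cl.span_base) blast
    then show ?thesis by (rule that) (simp add: root_of_def)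
  next
    assume "x \<in> (\<lambda>k. \<lblot>e k, f k\<rblot>) ` I"
    then have "x \<in> weight_part (\<lambda>_. 0)" unfolding weight_part_def by (intro cl.span_base) blast
    then show ?thesis by (rule that) simp
  next
    assume "x \<in> {right_bracket f w | w. w \<noteq> [] \<and> set w \<subseteq> I}"
    then obtain w where w: "x = right_bracket f w" "w \<noteq> []" "set w \<subseteq> I" by blast
    have "root_of w = (\<lambda>k. - (- root_of w k))" by simp
    with w have "x \<in> weight_part (\<lambda>k. - root_of w k)"
      unfolding weight_part_def by (intro cl.span_base) blast
    then show ?thesis by (rule that) (simp add: root_of_def)
  qed
  \<comment> \<open>The weight of the new summand may already occur in \<open>\<Lambda>\<close>, in
    which case the components are added.\<close>
  define g' where "g' \<alpha> = (if \<alpha> = \<beta> then c *\<^sub>L x else 0) + (if \<alpha> \<in> \<Lambda> then g \<alpha> else 0)" for \<alpha>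
  have "(\<Sum>\<alpha>\<in>insert \<beta> \<Lambda>. g' \<alpha>) = c *\<^sub>L x + (\<Sum>\<alpha>\<in>insert \<beta> \<Lambda>. if \<alpha> \<in> \<Lambda> then g \<alpha> else 0)"
    unfolding g'_def sum.distrib using g(1) by (simp add: sum.delta)
  also have "(\<Sum>\<alpha>\<in>insert \<beta> \<Lambda>. if \<alpha> \<in> \<Lambda> then g \<alpha> else 0) = y"
    unfolding g(2) using g(1) by (intro sum.mono_neutral_cong_right) auto
  finally have "c *\<^sub>L x + y = (\<Sum>\<alpha>\<in>insert \<beta> \<Lambda>. g' \<alpha>)" by simp
  moreover have "\<forall>\<alpha>\<in>insert \<beta> \<Lambda>. g' \<alpha> \<in> weight_part \<alpha> \<and> (\<forall>k. k \<notin> I \<longrightarrow> \<alpha> k = 0)"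
    unfolding g'_def using g(3) \<beta>
    by (auto intro!: cl.subspace_add[OF sub] cl.subspace_scale[OF sub] cl.subspace_0[OF sub])
  ultimately show ?case using g(1) by (intro exI[of _ "insert \<beta> \<Lambda>"] exI[of _ g']) simp
qed

text \<open>Stable under \<open>e i\<close> and \<open>f i\<close>, \<open>K\<close> is stable under
  the coroots and therefore contains the weight components of its elements in
  \<open>triangular\<close>. A component of positive height vanishes by
  \<open>ideal_root_span_eq_0\<close>, one of negative height by the same lemma with
  \<open>e\<close> and \<open>f\<close> exchanged.\<close>

theorem ideal_eq_0:
  fixes c :: "'i \<Rightarrow> real"
  assumes "finite I" and K: "cl.subspace K" "\<And>i x. i \<in> I \<Longrightarrow> x \<in> K \<Longrightarrow> \<lblot>e i, x\<rblot> \<in> K"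
      "\<And>i x. i \<in> I \<Longrightarrow> x \<in> K \<Longrightarrow> \<lblot>f i, x\<rblot> \<in> K"
      "\<And>x. x \<in> K \<Longrightarrow> x \<in> cl.span ((\<lambda>k. \<lblot>e k, f k\<rblot>) ` I) \<Longrightarrow> x = 0"
    and c: "\<And>i. i \<in> I \<Longrightarrow> c i \<ge> 0" "\<And>j. j \<in> I \<Longrightarrow> (\<Sum>i\<in>I. c i * of_int (A i j)) = 1"
    and x: "x \<in> K" "x \<in> triangular"
  shows "x = 0"
proof -
  have height: "(\<Sum>k\<in>I. of_real (c k) * root_of w k) = of_nat (length w)" if "set w \<subseteq> I" for w
    using that
  proof (induction w)
    case (Cons j w)
    have "(\<Sum>k\<in>I. of_real (c k) * (of_int (A k j) :: complex)) = of_real (\<Sum>k\<in>I. c k * of_int (A k j))"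
      by simp
    also have "\<dots> = 1" using c(2)[of j] Cons.prems by simp
    finally show ?case
      using Cons by (simp add: root_of_def distrib_left sum.distrib)
  qed (simp add: root_of_def)
  have Kh: "\<lblot>\<lblot>e i, f i\<rblot>, x\<rblot> \<in> K" if "i \<in> I" "x \<in> K" for i x
  proof -
    have "\<lblot>\<lblot>e i, f i\<rblot>, x\<rblot> = \<lblot>e i, \<lblot>f i, x\<rblot>\<rblot> - \<lblot>f i, \<lblot>e i, x\<rblot>\<rblot>"
      using lbr_leibniz[of "e i" "f i" x] by simp
    then show ?thesis using K that by (simp add: cl.subspace_diff)
  qed
  \<comment> \<open>The height is positive on brackets of \<open>e\<close>, negative on brackets of
    \<open>f\<close> and zero on the coroots. So the generators of one weight part are all of one
    kind, and brackets among them have the same length.\<close>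
  have part: "y = 0" if y: "y \<in> K" "y \<in> weight_part \<alpha>" for y \<alpha>
  proof -
    consider (e) w where "w \<noteq> []" "set w \<subseteq> I" "root_of w = \<alpha>"
      | (f) w where "w \<noteq> []" "set w \<subseteq> I" "root_of w = (\<lambda>k. - \<alpha> k)"
      | (h) "\<And>w. w \<noteq> [] \<Longrightarrow> set w \<subseteq> I \<Longrightarrow> root_of w \<noteq> \<alpha> \<and> root_of w \<noteq> (\<lambda>k. - \<alpha> k)"
      by blast
    then show ?thesis
    proof cases
      case e
      let ?ht = "\<Sum>k\<in>I. of_real (c k) * \<alpha> k"
      have ht: "?ht = of_nat (length w)" using height[OF e(2)] e(3) by simp
      have "\<alpha> \<noteq> (\<lambda>_. 0)" using ht e(1) by (cases "\<alpha> = (\<lambda>_. 0)") auto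
      moreover have "length v = length w" if "set v \<subseteq> I" "root_of v = \<alpha>" for v
        using height[OF that(1)] that(2) ht by simp
      moreover have False if "set v \<subseteq> I" "root_of v = (\<lambda>k. - \<alpha> k)" for v
      proof -
        have "of_nat (length v) = - ?ht" using height[OF that(1)] that(2) by (simp add: sum_negf)
        then have "of_nat (length v + length w) = (0::complex)" using ht by simp
        then show False using e(1) by (simp only: of_nat_eq_0_iff) simp
      qed
      ultimately have "weight_part \<alpha> \<subseteq> root_span (length w) \<alpha>"
        unfolding weight_part_def root_span_def
        by (intro cl.span_mono) (auto simp: root_of_def)
      moreover have "length w = Suc (length w - 1)" using e(1) by simp
      ultimately show ?thesis
        using ideal_root_span_eq_0[OF \<open>finite I\<close> K(1,3,4) c] y by (metis subsetD)
    next
      case f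
      let ?ht = "\<Sum>k\<in>I. of_real (c k) * \<alpha> k"
      have "- ?ht = of_nat (length w)" using height[OF f(2)] f(3) by (simp add: sum_negf)
      then have ht: "?ht = - of_nat (length w)" by (metis minus_minus)
      have "\<alpha> \<noteq> (\<lambda>_. 0)" using ht f(1) by (cases "\<alpha> = (\<lambda>_. 0)") auto
      moreover have "length v = length w" if "set v \<subseteq> I" "root_of v = (\<lambda>k. - \<alpha> k)" for v
        using height[OF that(1)] that(2) ht by (simp add: sum_negf)
      moreover have "\<forall>k\<in>I. word_weight A k v = - \<alpha> k" if "root_of v = (\<lambda>k. - \<alpha> k)" for v
      proof
        fix k assume "k \<in> I"
        then show "word_weight A k v = - \<alpha> k" using fun_cong[OF that, of k] by (simp add: root_of_def)
      qed
      moreover have False if "set v \<subseteq> I" "root_of v = \<alpha>" for v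
      proof -
        have "of_nat (length v) = ?ht" using height[OF that(1)] that(2) by simp
        then have "of_nat (length v + length w) = (0::complex)" using ht by simp
        then show False using f(1) by (simp only: of_nat_eq_0_iff) simp
      qed
      ultimately have "weight_part \<alpha> \<subseteq> km_serre.root_span I A f (length w) (\<lambda>k. - \<alpha> k)"
        unfolding weight_part_def km_serre.root_span_def[OF swapped']
        by (intro cl.span_mono) blast
      moreover have "length w = Suc (length w - 1)" using f(1) by simp
      moreover have "x = 0" if "x \<in> K" "x \<in> cl.span ((\<lambda>k. \<lblot>f k, e k\<rblot>) ` I)" for x
        using K(4) that span_h_swapped by blast
      ultimately show ?thesis
        using km_serre.ideal_root_span_eq_0[OF swapped' \<open>finite I\<close> K(1,2) _ c] y by (metis subsetD)
    next
      case h
      have "weight_part \<alpha> \<subseteq> cl.span ((\<lambda>k. \<lblot>e k, f k\<rblot>) ` I)"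
        unfolding weight_part_def using h by (intro cl.span_mono) auto
      then show ?thesis using K(4) y by blast
    qed
  qed
  obtain \<Lambda> g where g: "finite \<Lambda>" "x = (\<Sum>\<alpha>\<in>\<Lambda>. g \<alpha>)"
      "\<forall>\<alpha>\<in>\<Lambda>. g \<alpha> \<in> weight_part \<alpha> \<and> (\<forall>k. k \<notin> I \<longrightarrow> \<alpha> k = 0)"
    using triangular_decomp[OF x(2)] by blast
  have "\<forall>\<alpha>\<in>\<Lambda>. g \<alpha> \<in> K"
    by (rule weight_components[where z = "\<lambda>i. \<lblot>e i, f i\<rblot>" and I = I])
      (use g x(1) K(1) Kh h_weight_part in auto)
  then show ?thesis unfolding g(2) using part g(3) by (intro sum.neutral) blast
qed

end

section \<open>The even orthogonal Lie algebra\<close>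

lemma so_even_simps [simp]:
  "\<zero>\<^bsub>so_even n\<^esub> = 0\<^sub>m (2 * n) (2 * n)"
  "X \<oplus>\<^bsub>so_even n\<^esub> Y = X + Y"
  "c \<odot>\<^bsub>so_even n\<^esub> X = c \<cdot>\<^sub>m X"
  "bracket (so_even n) X Y = X * Y - Y * X"
  by (simp_all add: so_even_def)

lemma so_form_carrier [simp]: "so_form n \<in> carrier_mat (2 * n) (2 * n)"
  by (simp add: so_form_def)

text \<open>Solved for the transposed side, the condition can be used as a rewrite rule that moves
  the form through a product.\<close>

lemma so_even_carrier:
  "X \<in> carrier (so_even n) \<longleftrightarrow> X \<in> carrier_mat (2 * n) (2 * n) \<and>
    transpose_mat X * so_form n = (-1) \<cdot>\<^sub>m (so_form n * X)"
proof (cases "X \<in> carrier_mat (2 * n) (2 * n)")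
  case True
  let ?J = "so_form n"
  have c: "transpose_mat X * ?J \<in> carrier_mat (2 * n) (2 * n)" "?J * X \<in> carrier_mat (2 * n) (2 * n)"
    using True mult_carrier_mat[OF so_form_carrier True] by auto
  have "Y + Z = 0\<^sub>m N N \<longleftrightarrow> Y = (-1) \<cdot>\<^sub>m Z" if "Y \<in> carrier_mat N N" "Z \<in> carrier_mat N N"
    for Y Z :: "complex mat" and N
    using that by (auto simp: mat_eq_iff eq_neg_iff_add_eq_0)
  from this[OF c] show ?thesis using True by (simp add: so_even_def)
qed (simp add: so_even_def)

lemma so_even_carrier_mat [simp]: "X \<in> carrier (so_even n) \<Longrightarrow> X \<in> carrier_mat (2 * n) (2 * n)"
  by (simp add: so_even_carrier)

lemma so_even_closed:
  assumes "X \<in> carrier (so_even n)" "Y \<in> carrier (so_even n)"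
  shows "X + Y \<in> carrier (so_even n)" "c \<cdot>\<^sub>m X \<in> carrier (so_even n)"
    "X * Y - Y * X \<in> carrier (so_even n)"
proof -
  let ?J = "so_form n" and ?N = "2 * n"
  have X: "X \<in> carrier_mat ?N ?N" "transpose_mat X * ?J = (-1) \<cdot>\<^sub>m (?J * X)"
    and Y: "Y \<in> carrier_mat ?N ?N" "transpose_mat Y * ?J = (-1) \<cdot>\<^sub>m (?J * Y)"
    using assms by (simp_all add: so_even_carrier)
  have J: "?J \<in> carrier_mat ?N ?N" by simp
  have [simp]: "a \<cdot>\<^sub>m (b \<cdot>\<^sub>m A) = (a * b) \<cdot>\<^sub>m A" for a b and A :: "complex mat"
    by auto
  have [simp]: "1 \<cdot>\<^sub>m A = A" for A :: "complex mat"
    by auto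
  have [simp]: "A * B \<in> carrier_mat ?N ?N" if "A \<in> carrier_mat ?N ?N" "B \<in> carrier_mat ?N ?N"
    for A B :: "complex mat"
    using that by (rule mult_carrier_mat)
  show "X + Y \<in> carrier (so_even n)"
    using X Y add_mult_distrib_mat[of "transpose_mat X" ?N ?N "transpose_mat Y" ?J ?N]
      mult_add_distrib_mat[OF J X(1) Y(1)]
      add_smult_distrib_left_mat[of "?J * X" ?N ?N "?J * Y" "-1"]
    by (simp add: so_even_carrier transpose_add[of _ ?N ?N])
  show "c \<cdot>\<^sub>m X \<in> carrier (so_even n)"
  proof -
    have "transpose_mat (c \<cdot>\<^sub>m X) = c \<cdot>\<^sub>m transpose_mat X" by auto
    then show ?thesis
      using X J by (simp add: so_even_carrier mult_smult_assoc_mat[of _ ?N ?N _ ?N]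
        mult_smult_distrib[of _ ?N ?N _ ?N] mult.commute)
  qed
  \<comment> \<open>Moving the form past two factors reverses their order, and the two signs cancel.
    A commutator therefore changes sign, as required.\<close>
  have anti: "transpose_mat (A * B) * ?J = ?J * (B * A)"
    if A: "A \<in> carrier_mat ?N ?N" "transpose_mat A * ?J = (-1) \<cdot>\<^sub>m (?J * A)"
      and B: "B \<in> carrier_mat ?N ?N" "transpose_mat B * ?J = (-1) \<cdot>\<^sub>m (?J * B)" for A B
  proof -
    have "transpose_mat (A * B) * ?J = transpose_mat B * (transpose_mat A * ?J)"
      using A B J by (simp add: transpose_mult[of _ ?N ?N] assoc_mult_mat[of _ ?N ?N _ ?N _ ?N])
    also have "\<dots> = (-1) \<cdot>\<^sub>m ((transpose_mat B * ?J) * A)"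
      using A(1) B(1) J unfolding A(2)
      by (simp add: mult_smult_distrib[of _ ?N ?N _ ?N] assoc_mult_mat[of _ ?N ?N _ ?N _ ?N])
    also have "\<dots> = ?J * (B * A)"
      using A(1) B(1) J unfolding B(2)
      by (simp add: mult_smult_assoc_mat[of _ ?N ?N _ ?N] assoc_mult_mat[of _ ?N ?N _ ?N _ ?N])
    finally show ?thesis .
  qed
  have "transpose_mat (X * Y - Y * X) = transpose_mat (X * Y) - transpose_mat (Y * X)"
    using X Y by (intro transpose_minus) auto
  then have "transpose_mat (X * Y - Y * X) * ?J = transpose_mat (X * Y) * ?J - transpose_mat (Y * X) * ?J"
    using X Y J by (simp add: minus_mult_distrib_mat[of _ ?N ?N _ _ ?N])
  also have "\<dots> = ?J * (Y * X) - ?J * (X * Y)"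
    using anti[OF X Y] anti[OF Y X] by simp
  also have "\<dots> = (-1) \<cdot>\<^sub>m (?J * (X * Y - Y * X))"
  proof -
    have "?J * (X * Y - Y * X) = ?J * (X * Y) - ?J * (Y * X)"
      using X Y J by (intro mult_minus_distrib_mat[of _ ?N ?N _ ?N]) auto
    moreover have "P - Q = (-1) \<cdot>\<^sub>m (Q - P)" if "P \<in> carrier_mat ?N ?N" "Q \<in> carrier_mat ?N ?N"
      for P Q :: "complex mat"
      using that by auto
    ultimately show ?thesis using X Y J by (metis mult_carrier_mat)
  qed
  finally show "X * Y - Y * X \<in> carrier (so_even n)"
    using X Y by (auto simp: so_even_carrier)
qed

lemma so_even_zero: "0\<^sub>m (2 * n) (2 * n) \<in> carrier (so_even n)"
  by (simp only: so_even_carrier zero_carrier_mat left_mult_zero_mat[OF so_form_carrier] zero_transpose_mat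
      right_mult_zero_mat[OF so_form_carrier] smult_zero_mat simp_thms)

lemma lie_algebra_so_even: "lie_algebra class_ring (so_even n)"
proof -
  let ?N = "2 * n" and ?G = "so_even n"
  note cm = so_even_carrier_mat
  have "abelian_group ?G"
  proof (rule abelian_groupI)
    fix X assume X: "X \<in> carrier ?G"
    show "\<exists>Y\<in>carrier ?G. Y \<oplus>\<^bsub>?G\<^esub> X = \<zero>\<^bsub>?G\<^esub>"
    proof
      show "(-1) \<cdot>\<^sub>m X \<in> carrier ?G" using X so_even_closed by blast
      show "(-1) \<cdot>\<^sub>m X \<oplus>\<^bsub>?G\<^esub> X = \<zero>\<^bsub>?G\<^esub>" using cm[OF X] by auto
    qed
  next
    fix X Y Z assume "X \<in> carrier ?G" "Y \<in> carrier ?G" "Z \<in> carrier ?G"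
    then show "X \<oplus>\<^bsub>?G\<^esub> Y \<oplus>\<^bsub>?G\<^esub> Z = X \<oplus>\<^bsub>?G\<^esub> (Y \<oplus>\<^bsub>?G\<^esub> Z)"
      by (simp add: assoc_add_mat[of _ ?N ?N])
  next
    fix X Y assume "X \<in> carrier ?G" "Y \<in> carrier ?G"
    then show "X \<oplus>\<^bsub>?G\<^esub> Y = Y \<oplus>\<^bsub>?G\<^esub> X"
      by (simp add: comm_add_mat[of _ ?N ?N])
  qed (auto simp: so_even_closed so_even_zero)
  then have "Module.module class_ring ?G"
  proof (intro Module.module.intro module_axioms.intro class_cring.is_cring)
    fix a b :: complex and X Y
    assume X: "X \<in> carrier ?G"
    show "(a \<oplus>\<^bsub>class_ring\<^esub> b) \<odot>\<^bsub>?G\<^esub> X = a \<odot>\<^bsub>?G\<^esub> X \<oplus>\<^bsub>?G\<^esub> b \<odot>\<^bsub>?G\<^esub> X"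
      using cm[OF X] by (auto simp: distrib_right)
    show "(a \<otimes>\<^bsub>class_ring\<^esub> b) \<odot>\<^bsub>?G\<^esub> X = a \<odot>\<^bsub>?G\<^esub> (b \<odot>\<^bsub>?G\<^esub> X)"
      using cm[OF X] by auto
    show "\<one>\<^bsub>class_ring\<^esub> \<odot>\<^bsub>?G\<^esub> X = X" using cm[OF X] by auto
    show "a \<odot>\<^bsub>?G\<^esub> X \<in> carrier ?G" using X by (simp add: so_even_closed)
    assume Y: "Y \<in> carrier ?G"
    show "a \<odot>\<^bsub>?G\<^esub> (X \<oplus>\<^bsub>?G\<^esub> Y) = a \<odot>\<^bsub>?G\<^esub> X \<oplus>\<^bsub>?G\<^esub> a \<odot>\<^bsub>?G\<^esub> Y"
      using cm[OF X] cm[OF Y] by (auto simp: distrib_left)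
  qed
  then show ?thesis
  proof (intro lie_algebra.intro lie_algebra_axioms.intro)
    fix X Y Z and c :: complex
    assume X: "X \<in> carrier ?G"
    show "bracket ?G X X = \<zero>\<^bsub>?G\<^esub>" using cm[OF X] by simp
    assume Y: "Y \<in> carrier ?G"
    show "bracket ?G X Y \<in> carrier ?G" using X Y by (simp add: so_even_closed)
    show "bracket ?G (c \<odot>\<^bsub>?G\<^esub> X) Y = c \<odot>\<^bsub>?G\<^esub> bracket ?G X Y"
      "bracket ?G X (c \<odot>\<^bsub>?G\<^esub> Y) = c \<odot>\<^bsub>?G\<^esub> bracket ?G X Y"
      using cm[OF X] cm[OF Y]
      by (simp_all add: mult_smult_assoc_mat[of _ ?N ?N _ ?N] mult_smult_distrib[of _ ?N ?N _ ?N])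
        (auto simp: right_diff_distrib)
    assume Z: "Z \<in> carrier ?G"
    note m = cm[OF X] cm[OF Y] cm[OF Z]
    have four: "A + B - (C + D) = A - C + (B - D)" "A - B - (C - D) = A - B - C + D"
      if "A \<in> carrier_mat ?N ?N" "B \<in> carrier_mat ?N ?N" "C \<in> carrier_mat ?N ?N" "D \<in> carrier_mat ?N ?N"
      for A B C D :: "complex mat"
      using that by auto
    show "bracket ?G (X \<oplus>\<^bsub>?G\<^esub> Y) Z = bracket ?G X Z \<oplus>\<^bsub>?G\<^esub> bracket ?G Y Z"
      using m by (simp add: add_mult_distrib_mat[of _ ?N ?N _ _ ?N] mult_add_distrib_mat[of _ ?N ?N _ ?N] four)
    show "bracket ?G X (Y \<oplus>\<^bsub>?G\<^esub> Z) = bracket ?G X Y \<oplus>\<^bsub>?G\<^esub> bracket ?G X Z"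
      using m by (simp add: add_mult_distrib_mat[of _ ?N ?N _ _ ?N] mult_add_distrib_mat[of _ ?N ?N _ ?N] four)
    have tri: "A * (B * C - C * B) - (B * C - C * B) * A =
        A * (B * C) - A * (C * B) - B * (C * A) + C * (B * A)"
      if "A \<in> carrier_mat ?N ?N" "B \<in> carrier_mat ?N ?N" "C \<in> carrier_mat ?N ?N" for A B C :: "complex mat"
    proof -
      have "A * (B * C - C * B) = A * (B * C) - A * (C * B)"
        using that by (intro mult_minus_distrib_mat[of _ ?N ?N _ ?N]) auto
      moreover have "(B * C - C * B) * A = B * (C * A) - C * (B * A)"
        using that by (simp add: minus_mult_distrib_mat[of _ ?N ?N _ _ ?N] assoc_mult_mat[of _ ?N ?N _ ?N _ ?N])
      ultimately show ?thesis
        using that four(2)[of "A * (B * C)" "A * (C * B)" "B * (C * A)" "C * (B * A)"] by auto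
    qed
    show "bracket ?G X (bracket ?G Y Z) \<oplus>\<^bsub>?G\<^esub> bracket ?G Y (bracket ?G Z X) \<oplus>\<^bsub>?G\<^esub>
        bracket ?G Z (bracket ?G X Y) = \<zero>\<^bsub>?G\<^esub>"
    proof -
      have six: "(A1 - A2 - B1 + B2) + (B1 - B3 - C1 + A2) + (C1 - B2 - A1 + B3) = 0\<^sub>m ?N ?N"
        if "A1 \<in> carrier_mat ?N ?N" "A2 \<in> carrier_mat ?N ?N" "B1 \<in> carrier_mat ?N ?N"
          "B2 \<in> carrier_mat ?N ?N" "B3 \<in> carrier_mat ?N ?N" "C1 \<in> carrier_mat ?N ?N"
        for A1 A2 B1 B2 B3 C1 :: "complex mat"
        using that by (intro eq_matI) auto
      show ?thesis
        using m six[of "X * (Y * Z)" "X * (Z * Y)" "Y * (Z * X)" "Z * (Y * X)" "Y * (X * Z)" "Z * (X * Y)"]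
        by (simp add: tri)
    qed
  qed
qed

section \<open>Commutators of root matrices\<close>

definition mat_comm :: "complex mat \<Rightarrow> complex mat \<Rightarrow> complex mat" where
  "mat_comm X Y = X * Y - Y * X"

lemma so_even_bracket: "bracket (so_even n) = mat_comm"
  by (intro ext) (simp add: mat_comm_def)

declare so_even_simps(4) [simp del]
declare so_even_bracket [simp]

lemma mat_comm_carrier [simp]:
  "X \<in> carrier_mat N N \<Longrightarrow> Y \<in> carrier_mat N N \<Longrightarrow> mat_comm X Y \<in> carrier_mat N N"
  by (simp add: mat_comm_def minus_carrier_mat mult_carrier_mat)

lemma mat_comm_diff_left:
  assumes "X \<in> carrier_mat N N" "Y \<in> carrier_mat N N" "Z \<in> carrier_mat N N"
  shows "mat_comm (X - Y) Z = mat_comm X Z - mat_comm Y Z"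
proof -
  have "A - B - (C - D) = A - C - (B - D)"
    if "A \<in> carrier_mat N N" "B \<in> carrier_mat N N" "C \<in> carrier_mat N N" "D \<in> carrier_mat N N"
    for A B C D :: "complex mat"
    using that by auto
  from this[of "X * Z" "Y * Z" "Z * X" "Z * Y"] show ?thesis
    using assms by (simp add: mat_comm_def minus_mult_distrib_mat[of _ N N _ _ N]
      mult_minus_distrib_mat[of _ N N _ N] mult_carrier_mat)
qed

lemma mat_comm_anti:
  assumes "X \<in> carrier_mat N N" "Y \<in> carrier_mat N N"
  shows "mat_comm Y X = (-1) \<cdot>\<^sub>m mat_comm X Y"
proof -
  have "A - B = (-1) \<cdot>\<^sub>m (B - A)" if "A \<in> carrier_mat N N" "B \<in> carrier_mat N N"
    for A B :: "complex mat"
    using that by auto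
  from this[of "Y * X" "X * Y"] show ?thesis
    using assms by (simp add: mat_comm_def mult_carrier_mat)
qed

lemma mat_comm_smult_right:
  assumes "X \<in> carrier_mat N N" "Y \<in> carrier_mat N N"
  shows "mat_comm X (c \<cdot>\<^sub>m Y) = c \<cdot>\<^sub>m mat_comm X Y"
proof -
  have "c \<cdot>\<^sub>m A - c \<cdot>\<^sub>m B = c \<cdot>\<^sub>m (A - B)" if "A \<in> carrier_mat N N" "B \<in> carrier_mat N N"
    for A B :: "complex mat"
    using that by (auto simp: right_diff_distrib)
  from this[of "X * Y" "Y * X"] show ?thesis
    using assms by (simp add: mat_comm_def mult_carrier_mat mult_smult_distrib[of _ N N _ N]
      mult_smult_assoc_mat[of _ N N _ N])
qed

lemma mat_comm_zero: "X \<in> carrier_mat N N \<Longrightarrow> mat_comm X (0\<^sub>m N N) = 0\<^sub>m N N"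
  by (simp add: mat_comm_def)

lemma elem_mat_carrier [simp]: "elem_mat N p q \<in> carrier_mat N N"
  by (simp add: elem_mat_def)

lemma elem_mat_index: "i < N \<Longrightarrow> j < N \<Longrightarrow> elem_mat N p q $$ (i, j) = (if i = p \<and> j = q then 1 else 0)"
  by (simp add: elem_mat_def)

lemma elem_mat_dim [simp]: "dim_row (elem_mat N p q) = N" "dim_col (elem_mat N p q) = N"
  by (simp_all add: elem_mat_def)

lemma elem_mat_mult:
  assumes "q < N"
  shows "elem_mat N p q * elem_mat N r s = (if q = r then elem_mat N p s else 0\<^sub>m N N)"
proof (rule eq_matI)
  fix i j assume ij: "i < dim_row (if q = r then elem_mat N p s else 0\<^sub>m N N)"
    "j < dim_col (if q = r then elem_mat N p s else 0\<^sub>m N N)"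
  then have ij: "i < N" "j < N" by (auto split: if_splits)
  have "(elem_mat N p q * elem_mat N r s) $$ (i, j) =
      (\<Sum>k\<in>{0..<N}. elem_mat N p q $$ (i, k) * elem_mat N r s $$ (k, j))"
    using ij by (simp add: scalar_prod_def)
  also have "\<dots> = (\<Sum>k\<in>{0..<N}. if k = q then (if i = p \<and> q = r \<and> j = s then 1 else 0) else 0)"
    using ij by (intro sum.cong) (auto simp: elem_mat_index)
  also have "\<dots> = (if i = p \<and> q = r \<and> j = s then 1 else 0)"
    using assms by simp
  finally show "(elem_mat N p q * elem_mat N r s) $$ (i, j) =
      (if q = r then elem_mat N p s else 0\<^sub>m N N) $$ (i, j)"
    using ij by (auto simp: elem_mat_index)
qed auto

text \<open>The index of the basis vector dual to the \<open>p\<close>-th one with respect to the form.\<close>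

definition so_star :: "nat \<Rightarrow> nat \<Rightarrow> nat" where
  "so_star n p = (if p < n then p + n else p - n)"

lemma so_star_props:
  assumes "p < 2 * n"
  shows "so_star n p < 2 * n" "so_star n (so_star n p) = p" "so_star n p \<noteq> p"
  using assms by (auto simp: so_star_def)

lemma so_star_eq_iff:
  "p < 2 * n \<Longrightarrow> q < 2 * n \<Longrightarrow> so_star n p = so_star n q \<longleftrightarrow> p = q"
  "p < 2 * n \<Longrightarrow> q < 2 * n \<Longrightarrow> so_star n p = q \<longleftrightarrow> p = so_star n q"
  by (auto simp: so_star_def)

text \<open>A diagonal matrix for q = p, zero if q is the star of p, and a root vector otherwise.
  All Chevalley generators have this form and the coroots are differences of such matrices, so one
  commutator formula serves for all relations.\<close>

definition so_root :: "nat \<Rightarrow> nat \<Rightarrow> nat \<Rightarrow> complex mat" where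
  "so_root n p q = elem_mat (2 * n) p q - elem_mat (2 * n) (so_star n q) (so_star n p)"

lemma so_root_carrier [simp]: "so_root n p q \<in> carrier_mat (2 * n) (2 * n)"
  by (simp add: so_root_def minus_carrier_mat)

lemma so_root_dim [simp]: "dim_row (so_root n p q) = 2 * n" "dim_col (so_root n p q) = 2 * n"
  by (simp_all add: so_root_def)

lemma so_root_star [simp]: "p < 2 * n \<Longrightarrow> so_root n p (so_star n p) = 0\<^sub>m (2 * n) (2 * n)"
  by (auto simp: so_root_def so_star_props)

lemma so_root_star' [simp]: "p < 2 * n \<Longrightarrow> so_root n (so_star n p) p = 0\<^sub>m (2 * n) (2 * n)"
  using so_root_star[of "so_star n p" n] by (simp add: so_star_props)

lemma so_root_flip:
  "p < 2 * n \<Longrightarrow> q < 2 * n \<Longrightarrow> so_root n (so_star n q) (so_star n p) = (-1) \<cdot>\<^sub>m so_root n p q"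
  by (auto simp: so_root_def so_star_props)

text \<open>The eight products of elementary matrices are grouped in pairs that the star exchanges;
  each pair is one root matrix.\<close>

lemma so_root_comm:
  assumes "p < 2 * n" "q < 2 * n" "r < 2 * n" "s < 2 * n"
  shows "mat_comm (so_root n p q) (so_root n r s) =
    (if q = r then so_root n p s else 0\<^sub>m (2 * n) (2 * n)) -
    (if p = s then so_root n r q else 0\<^sub>m (2 * n) (2 * n)) -
    (if q = so_star n s then so_root n p (so_star n r) else 0\<^sub>m (2 * n) (2 * n)) +
    (if p = so_star n r then so_root n (so_star n s) q else 0\<^sub>m (2 * n) (2 * n))"
proof -
  let ?N = "2 * n" and ?E = "elem_mat (2 * n)" and ?s = "so_star n"
  let ?if = "\<lambda>P A. if P then A else 0\<^sub>m ?N ?N :: complex mat"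
  have expand: "(A - B) * (C - D) - (C - D) * (A - B) =
      A * C - A * D - B * C + B * D - (C * A - C * B - D * A + D * B)"
    if "A \<in> carrier_mat ?N ?N" "B \<in> carrier_mat ?N ?N" "C \<in> carrier_mat ?N ?N" "D \<in> carrier_mat ?N ?N"
    for A B C D :: "complex mat"
  proof -
    have four: "A - B - (C - D) = A - C - B + D"
      if "A \<in> carrier_mat ?N ?N" "B \<in> carrier_mat ?N ?N" "C \<in> carrier_mat ?N ?N" "D \<in> carrier_mat ?N ?N"
      for A B C D :: "complex mat"
      using that by auto
    have "(A - B) * (C - D) = A * C - A * D - B * C + B * D"
      if "A \<in> carrier_mat ?N ?N" "B \<in> carrier_mat ?N ?N" "C \<in> carrier_mat ?N ?N" "D \<in> carrier_mat ?N ?N"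
      for A B C D :: "complex mat"
      using that four[of "A * C" "B * C" "A * D" "B * D"]
      by (simp add: minus_mult_distrib_mat[of _ ?N ?N _ _ ?N] mult_minus_distrib_mat[of _ ?N ?N _ ?N]
        mult_carrier_mat minus_carrier_mat)
    then show ?thesis using that by simp
  qed
  have sp: "?s p < ?N" "?s q < ?N" "?s r < ?N" "?s s < ?N" using assms so_star_props by auto
  have eqs: "?s p = r \<longleftrightarrow> p = ?s r" "?s p = ?s s \<longleftrightarrow> p = s" "s = p \<longleftrightarrow> p = s"
    "s = ?s q \<longleftrightarrow> q = ?s s" "?s r = p \<longleftrightarrow> p = ?s r" "?s r = ?s q \<longleftrightarrow> q = r"
    using assms so_star_eq_iff by (blast, blast, blast, metis, blast, metis)
  have "mat_comm (so_root n p q) (so_root n r s) =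
      ?if (q = r) (?E p s) - ?if (q = ?s s) (?E p (?s r)) - ?if (?s p = r) (?E (?s q) s) +
      ?if (?s p = ?s s) (?E (?s q) (?s r)) -
      (?if (s = p) (?E r q) - ?if (s = ?s q) (?E r (?s p)) - ?if (?s r = p) (?E (?s s) q) +
       ?if (?s r = ?s q) (?E (?s s) (?s p)))"
    unfolding mat_comm_def so_root_def
    by (subst expand) (use assms sp in \<open>simp_all add: elem_mat_mult\<close>)
  also have "\<dots> = ?if (q = r) (?E p s) - ?if (q = ?s s) (?E p (?s r)) - ?if (p = ?s r) (?E (?s q) s) +
      ?if (p = s) (?E (?s q) (?s r)) -
      (?if (p = s) (?E r q) - ?if (q = ?s s) (?E r (?s p)) - ?if (p = ?s r) (?E (?s s) q) +
       ?if (q = r) (?E (?s s) (?s p)))"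
    by (simp only: eqs)
  also have "\<dots> = ?if (q = r) (so_root n p s) - ?if (p = s) (so_root n r q) -
      ?if (q = ?s s) (so_root n p (?s r)) + ?if (p = ?s r) (so_root n (?s s) q)"
    using assms by (intro eq_matI) (auto simp: so_root_def so_star_props)
  finally show ?thesis .
qed


text \<open>The eigenvalue of the diagonal matrix \<open>so_root n p p\<close> on the basis vector
  with index \<open>q\<close>.\<close>

definition so_sign :: "nat \<Rightarrow> nat \<Rightarrow> nat \<Rightarrow> complex" where
  "so_sign n p q = (if p = q then 1 else if p = so_star n q then -1 else 0)"

lemma so_root_comm_diag:
  assumes "p < 2 * n" "r < 2 * n" "s < 2 * n"
  shows "mat_comm (so_root n p p) (so_root n r s) = (so_sign n p r - so_sign n p s) \<cdot>\<^sub>m so_root n r s"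
  unfolding so_root_comm[OF assms(1,1,2,3)]
  by (intro eq_matI) (use assms so_root_flip[of r n s] so_star_props(3)[OF assms(1), symmetric]
      so_star_props(3)[OF assms(2), symmetric] so_star_props(3)[OF assms(3), symmetric] in \<open>auto simp: so_sign_def so_star_props so_star_eq_iff\<close>)

text \<open>With \<open>so_col\<close>, the position of \<open>so_e n i\<close> as a root matrix.
  For i = n the column is the star of n - 1; this is how the sum in the last simple root
  appears.\<close>

definition so_row :: "nat \<Rightarrow> nat \<Rightarrow> nat" where
  "so_row n i = (if i < n then i - 1 else n - 2)"

definition so_col :: "nat \<Rightarrow> nat \<Rightarrow> nat" where
  "so_col n i = (if i < n then i else 2 * n - 1)"

lemma so_row_col_less:
  assumes "n \<ge> 3" "i \<in> {1..n}"
  shows "so_row n i < 2 * n" "so_col n i < 2 * n"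
  using assms by (auto simp: so_row_def so_col_def)

lemma so_e_root:
  assumes "n \<ge> 3" "i \<in> {1..n}"
  shows "so_e n i = so_root n (so_row n i) (so_col n i)"
proof (cases "i < n")
  case True
  then show ?thesis using assms by (simp add: so_e_def so_root_def so_row_def so_col_def so_star_def add.commute)
next
  case False
  obtain m where "n = m + 3" using assms(1) by (metis add.commute le_Suc_ex)
  then show ?thesis using assms False by (simp add: so_e_def so_root_def so_row_def so_col_def so_star_def)
qed

lemma transpose_elem_mat: "transpose_mat (elem_mat N p q) = elem_mat N q p"
  by (intro eq_matI) (auto simp: elem_mat_def)

lemma so_f_root:
  assumes "n \<ge> 3" "i \<in> {1..n}"
  shows "so_f n i = so_root n (so_col n i) (so_row n i)"
proof -
  have "transpose_mat (so_root n p q) = so_root n q p" for p q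
    unfolding so_root_def by (subst transpose_minus[of _ "2 * n" "2 * n"]) (simp_all add: transpose_elem_mat)
  then show ?thesis using so_e_root[OF assms] by (simp add: so_f_def)
qed

lemma so_h_root:
  assumes "n \<ge> 3" "i \<in> {1..n}"
  shows "mat_comm (so_e n i) (so_f n i) =
    so_root n (so_row n i) (so_row n i) - so_root n (so_col n i) (so_col n i)"
proof -
  have "so_row n i \<noteq> so_col n i" "so_col n i \<noteq> so_star n (so_row n i)" "so_row n i \<noteq> so_star n (so_col n i)"
    using assms by (auto simp: so_row_def so_col_def so_star_def)
  then show ?thesis
    using so_row_col_less[OF assms] so_root_carrier[of n "so_row n i" "so_row n i"]
    unfolding so_e_root[OF assms] so_f_root[OF assms]
    by (subst so_root_comm) (auto intro!: eq_matI simp: so_star_props)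
qed

text \<open>The diagonal entry at \<open>r\<close> of the matrix of the coroot with index
  \<open>i\<close>.\<close>

definition so_coroot :: "nat \<Rightarrow> nat \<Rightarrow> nat \<Rightarrow> complex" where
  "so_coroot n i r = so_sign n (so_row n i) r - so_sign n (so_col n i) r"

lemma so_h_comm:
  assumes "n \<ge> 3" "i \<in> {1..n}" "r < 2 * n" "s < 2 * n"
  shows "mat_comm (mat_comm (so_e n i) (so_f n i)) (so_root n r s) =
    (so_coroot n i r - so_coroot n i s) \<cdot>\<^sub>m so_root n r s"
  using so_row_col_less[OF assms(1,2)] assms(3,4)
  unfolding so_h_root[OF assms(1,2)]
  by (simp add: mat_comm_diff_left[of _ "2 * n"] so_root_comm_diag)
    (auto intro!: eq_matI simp: so_coroot_def algebra_simps)

lemma cartan_D_explicit: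
  assumes "n \<ge> 3" "i \<in> {1..n}" "j \<in> {1..n}"
  shows "cartan_D n i j = (if i = j then 2 else if j = i + 1 \<and> i \<le> n - 2 \<or> i = j + 1 \<and> j \<le> n - 2 \<or>
    i = n - 2 \<and> j = n \<or> i = n \<and> j = n - 2 then -1 else 0)"
proof -
  have "(\<exists>k\<in>{1..n-2}. {i, j} = {k, k + 1}) \<longleftrightarrow> (j = i + 1 \<and> i \<le> n - 2) \<or> (i = j + 1 \<and> j \<le> n - 2)"
    using assms by (auto simp: doubleton_eq_iff)
  then show ?thesis unfolding cartan_D_def by (auto simp: doubleton_eq_iff)
qed

lemma so_coroot_low:
  assumes "n \<ge> 3" "i \<in> {1..n}" "r < n"
  shows "so_coroot n i r = (if i < n then (if i = r + 1 then 1 else 0) - (if i = r then 1 else 0)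
    else if r = n - 2 \<or> r = n - 1 then 1 else 0)"
proof (cases "i < n")
  case True
  then have "so_row n i = r \<longleftrightarrow> i = r + 1" "so_col n i = r \<longleftrightarrow> i = r"
      "so_row n i \<noteq> so_star n r" "so_col n i \<noteq> so_star n r"
    using assms by (auto simp: so_row_def so_col_def so_star_def)
  then show ?thesis using True by (cases "i = r") (auto simp: so_coroot_def so_sign_def)
next
  case False
  then have "so_row n i = n - 2" "so_col n i = so_star n (n - 1)" "so_col n i \<noteq> r" "n - 2 \<noteq> so_star n r"
    using assms by (auto simp: so_row_def so_col_def so_star_def)
  moreover have "so_star n (n - 1) = so_star n r \<longleftrightarrow> r = n - 1"
    using assms by (auto simp: so_star_def)
  ultimately show ?thesis using False assms by (auto simp: so_coroot_def so_sign_def)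
qed

lemma so_coroot_root:
  assumes "n \<ge> 3" "i \<in> {1..n}" "j \<in> {1..n}"
  shows "so_coroot n i (so_row n j) - so_coroot n i (so_col n j) = of_int (cartan_D n i j)"
proof (cases "j < n")
  case True
  then have row: "so_row n j = j - 1" "so_col n j = j" "j - 1 < n"
    using assms by (auto simp: so_row_def so_col_def)
  note low = so_coroot_low[OF assms(1,2) row(3)] so_coroot_low[OF assms(1,2) True]
  show ?thesis
  proof (cases "i < n")
    case i: True
    consider "i = j" | "i + 1 = j" | "i = j + 1" | "i \<noteq> j" "i + 1 \<noteq> j" "i \<noteq> j + 1" by blast
    then show ?thesis
      unfolding row low cartan_D_explicit[OF assms] using i True assms(2,3) by cases auto
  next
    case i: False
    then have i: "i = n" using assms by simp
    consider "j = n - 1" | "j = n - 2" | "j < n - 2" using True by linarith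
    then show ?thesis
      unfolding row low cartan_D_explicit[OF assms] using i True assms by cases auto
  qed
next
  case False
  then have j: "j = n" "so_row n j = n - 2" "so_col n j = so_star n (n - 1)"
    using assms by (auto simp: so_row_def so_col_def so_star_def)
  have "so_sign n p (so_star n (n - 1)) = - so_sign n p (n - 1)" if "p < 2 * n" for p
    using assms that so_star_props[of "n - 1" n] by (auto simp: so_sign_def)
  then have "so_coroot n i (so_col n j) = - so_coroot n i (n - 1)"
    using so_row_col_less[OF assms(1,2)] by (simp add: so_coroot_def j(3))
  moreover have "so_coroot n i (n - 2) + so_coroot n i (n - 1) = of_int (cartan_D n i j)"
  proof -
    have "n - 2 < n" "n - 1 < n" using assms(1) by auto
    note low = so_coroot_low[OF assms(1,2) this(1)] so_coroot_low[OF assms(1,2) this(2)]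
    consider "i = n" | "i = n - 1" | "i = n - 2" | "i < n - 2" using assms(2) by fastforce
    then show ?thesis
      unfolding low cartan_D_explicit[OF assms] using j(1) assms by cases auto
  qed
  ultimately show ?thesis by (simp add: j(2))
qed

text \<open>Each hypothesis removes one of the four terms of \<open>so_root_comm\<close>: its
  condition fails, or its root matrix joins an index to its star and is zero.\<close>

lemma so_serre_1:
  assumes "a < 2 * n" "b < 2 * n" "c < 2 * n" "d < 2 * n"
    and "b \<noteq> c" "a = d \<Longrightarrow> b = so_star n c" "a = so_star n c \<Longrightarrow> b = d" "b = so_star n d \<Longrightarrow> a = c"
  shows "mat_comm (so_root n a b) (so_root n c d) = 0\<^sub>m (2 * n) (2 * n)"
proof -
  let ?if = "\<lambda>P A. if P then A else 0\<^sub>m (2 * n) (2 * n) :: complex mat"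
  have "?if (b = c) (so_root n a d) = 0\<^sub>m (2 * n) (2 * n)" using assms(5) by simp
  moreover have "?if (a = d) (so_root n c b) = 0\<^sub>m (2 * n) (2 * n)"
    using assms(6) so_root_star[OF assms(3)] by metis
  moreover have "?if (b = so_star n d) (so_root n a (so_star n c)) = 0\<^sub>m (2 * n) (2 * n)"
    using assms(8) so_root_star[OF assms(3)] by metis
  moreover have "?if (a = so_star n c) (so_root n (so_star n d) b) = 0\<^sub>m (2 * n) (2 * n)"
    using assms(7) so_root_star'[OF assms(4)] by metis
  ultimately show ?thesis
    unfolding so_root_comm[OF assms(1-4)] by (intro eq_matI) simp_all
qed

text \<open>Two root matrices linked by the index \<open>b\<close> compose to one with indices
  \<open>a\<close> and \<open>d\<close>, up to sign. It shares with the first factor only an index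
  in the same position and therefore commutes with it.\<close>

lemma so_serre_2:
  assumes "a < 2 * n" "b < 2 * n" "d < 2 * n"
    and "a \<noteq> b" "a \<noteq> d" "b \<noteq> d" "a \<noteq> so_star n b" "a \<noteq> so_star n d" "b \<noteq> so_star n d"
  shows "mat_comm (so_root n a b) (mat_comm (so_root n a b) (so_root n b d)) = 0\<^sub>m (2 * n) (2 * n)"
    and "mat_comm (so_root n b a) (mat_comm (so_root n b a) (so_root n d b)) = 0\<^sub>m (2 * n) (2 * n)"
proof -
  have "mat_comm (so_root n a b) (so_root n b d) = so_root n a d"
    using assms by (subst so_root_comm) (auto intro!: eq_matI)
  moreover have "mat_comm (so_root n a b) (so_root n a d) = 0\<^sub>m (2 * n) (2 * n)"
    using assms so_star_props(3)[OF assms(1), symmetric] by (intro so_serre_1) auto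
  ultimately show "mat_comm (so_root n a b) (mat_comm (so_root n a b) (so_root n b d)) = 0\<^sub>m (2 * n) (2 * n)"
    by simp
  have star: "b \<noteq> so_star n a" "d \<noteq> so_star n b" "d \<noteq> so_star n a" "b \<noteq> so_star n b"
    using assms so_star_eq_iff(2)[of _ n] so_star_props by metis+
  have "mat_comm (so_root n b a) (so_root n d b) = (-1) \<cdot>\<^sub>m so_root n d a"
    using assms star by (subst so_root_comm) (auto intro!: eq_matI)
  moreover have "mat_comm (so_root n b a) (so_root n d a) = 0\<^sub>m (2 * n) (2 * n)"
    using assms star so_star_props(3)[OF assms(1), symmetric] by (intro so_serre_1) auto
  ultimately show "mat_comm (so_root n b a) (mat_comm (so_root n b a) (so_root n d b)) = 0\<^sub>m (2 * n) (2 * n)"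
    by (simp add: mat_comm_smult_right[of _ "2 * n"])
qed

section \<open>The Kac-Moody relations in the matrix algebra\<close>

abbreviation so_gens :: "nat \<Rightarrow> nat chevalley_gen \<Rightarrow> complex mat" where
  "so_gens n \<equiv> case_chevalley_gen (so_e n) (so_f n)"

lemma so_serre:
  assumes n: "n \<ge> 3" and ij: "i \<in> {1..n}" "j \<in> {1..n}" "i \<noteq> j"
  shows "lie_eval (so_even n) (so_gens n) (serre_term (cartan_D n) E i j) = 0\<^sub>m (2 * n) (2 * n)"
    and "lie_eval (so_even n) (so_gens n) (serre_term (cartan_D n) F i j) = 0\<^sub>m (2 * n) (2 * n)"
proof -
  let ?a = "so_row n i" and ?b = "so_col n i" and ?c = "so_row n j" and ?d = "so_col n j"
  obtain m where m: "n = m + 3" using n by (metis add.commute le_Suc_ex)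
  note less = so_row_col_less[OF n ij(1)] so_row_col_less[OF n ij(2)]
  note roots = so_e_root[OF n ij(1)] so_e_root[OF n ij(2)] so_f_root[OF n ij(1)] so_f_root[OF n ij(2)]
  have *: "lie_eval (so_even n) (so_gens n) (serre_term (cartan_D n) E i j) = 0\<^sub>m (2 * n) (2 * n) \<and>
    lie_eval (so_even n) (so_gens n) (serre_term (cartan_D n) F i j) = 0\<^sub>m (2 * n) (2 * n)"
  proof (cases "cartan_D n i j = -1")
    case True
    then have adj: "j = i + 1 \<and> i \<le> n - 2 \<or> i = j + 1 \<and> j \<le> n - 2 \<or> i = n - 2 \<and> j = n \<or> i = n \<and> j = n - 2"
      using cartan_D_explicit[OF n ij(1,2)] by (auto split: if_splits)
    \<comment> \<open>Root matrices of adjacent nodes are linked by a single index: the column of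
      one is the row of the other. The remaining inequalities exclude coincidences through the
      star.\<close>
    have "(?b = ?c \<and> ?d \<noteq> ?a \<and> ?d \<noteq> ?b \<and> ?a \<noteq> ?b \<and> ?a \<noteq> so_star n ?b \<and> ?a \<noteq> so_star n ?d \<and> ?b \<noteq> so_star n ?d)
      \<or> (?a = ?d \<and> ?c \<noteq> ?a \<and> ?c \<noteq> ?b \<and> ?a \<noteq> ?b \<and> ?b \<noteq> so_star n ?a \<and> ?b \<noteq> so_star n ?c \<and> ?a \<noteq> so_star n ?c)"
      using adj ij unfolding so_row_def so_col_def so_star_def m
      by (elim disjE conjE) (auto; linarith)+
    then consider "?b = ?c" "?d \<noteq> ?a" "?d \<noteq> ?b" "?a \<noteq> ?b" "?a \<noteq> so_star n ?b" "?a \<noteq> so_star n ?d" "?b \<noteq> so_star n ?d"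
      | "?a = ?d" "?c \<noteq> ?a" "?c \<noteq> ?b" "?a \<noteq> ?b" "?b \<noteq> so_star n ?a" "?b \<noteq> so_star n ?c" "?a \<noteq> so_star n ?c"
      by blast
    then show ?thesis
    proof cases
      case 1
      then show ?thesis
        using True so_serre_2[of ?a n ?b ?d] less by (simp add: roots numeral_2_eq_2)
    next
      case 2
      then show ?thesis
        using True so_serre_2[of ?b n ?a ?c] less by (simp add: roots numeral_2_eq_2)
    qed
  next
    case False
    then have 0: "cartan_D n i j = 0" using ij cartan_D_explicit[OF n ij(1,2)] by (auto split: if_splits)
    then have "\<not> (j = i + 1 \<and> i \<le> n - 2)" "\<not> (i = j + 1 \<and> j \<le> n - 2)" "\<not> (i = n - 2 \<and> j = n)"
        "\<not> (i = n \<and> j = n - 2)"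
      using ij cartan_D_explicit[OF n ij(1,2)] by (auto split: if_splits)
    then have "?b \<noteq> ?c \<and> ?a \<noteq> ?d \<and> ?a \<noteq> so_star n ?c \<and> (?b = so_star n ?d \<longrightarrow> ?a = ?c)"
      using ij unfolding so_row_def so_col_def so_star_def m
      by (cases "i < m + 3"; cases "j < m + 3") (simp_all, presburger+)
    then have "mat_comm (so_root n ?a ?b) (so_root n ?c ?d) = 0\<^sub>m (2 * n) (2 * n)"
      "mat_comm (so_root n ?b ?a) (so_root n ?d ?c) = 0\<^sub>m (2 * n) (2 * n)"
      using less by (intro so_serre_1; simp)+
    then show ?thesis using 0 by (simp add: roots)
  qed
  then show "lie_eval (so_even n) (so_gens n) (serre_term (cartan_D n) E i j) = 0\<^sub>m (2 * n) (2 * n)"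
    "lie_eval (so_even n) (so_gens n) (serre_term (cartan_D n) F i j) = 0\<^sub>m (2 * n) (2 * n)"
    by blast+
qed

lemma so_form_dim [simp]: "dim_row (so_form n) = 2 * n" "dim_col (so_form n) = 2 * n"
  by (simp_all add: so_form_def)

lemma so_e_f_carrier:
  assumes n: "n \<ge> 3" and i: "i \<in> {1..n}"
  shows "so_e n i \<in> carrier (so_even n)" "so_f n i \<in> carrier (so_even n)"
proof -
  have "so_root n p q \<in> carrier (so_even n)" if "p < 2 * n" "q < 2 * n" for p q
  proof -
    let ?N = "2 * n" and ?J = "so_form n" and ?E = "elem_mat (2 * n)"
    have form_right: "?E p q * ?J = ?E p (so_star n q)" if "q < ?N" for p q
    proof (rule eq_matI)
      fix i j assume ij: "i < dim_row (?E p (so_star n q))" "j < dim_col (?E p (so_star n q))"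
      then have "(?E p q * ?J) $$ (i, j) = (\<Sum>k\<in>{0..<?N}. ?E p q $$ (i, k) * ?J $$ (k, j))"
        by (simp add: scalar_prod_def)
      also have "\<dots> = (\<Sum>k\<in>{0..<?N}. if k = q then (if i = p then ?J $$ (q, j) else 0) else 0)"
        using ij by (intro sum.cong) (auto simp: elem_mat_index)
      also have "\<dots> = ?E p (so_star n q) $$ (i, j)"
        using ij that by (auto simp: elem_mat_index so_form_def so_star_def)
      finally show "(?E p q * ?J) $$ (i, j) = ?E p (so_star n q) $$ (i, j)" .
    qed auto
    have form_left: "?J * ?E p q = ?E (so_star n p) q" if "p < ?N" for p q
    proof -
      have sym: "transpose_mat ?J = ?J" by (intro eq_matI) (auto simp: so_form_def)
      have "transpose_mat (?J * ?E p q) = ?E q p * ?J"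
        by (subst transpose_mult[of _ ?N ?N _ ?N]) (simp_all add: transpose_elem_mat sym)
      also have "\<dots> = transpose_mat (?E (so_star n p) q)"
        using form_right[OF that] by (simp add: transpose_elem_mat)
      finally show ?thesis by (metis transpose_transpose)
    qed
    have sp: "so_star n p < ?N" "so_star n q < ?N" using that so_star_props by auto
    have "transpose_mat (so_root n p q) * ?J = (?E q p - ?E (so_star n p) (so_star n q)) * ?J"
      unfolding so_root_def by (subst transpose_minus[of _ ?N ?N]) (simp_all add: transpose_elem_mat)
    also have "\<dots> = ?E q (so_star n p) - ?E (so_star n p) q"
      using that sp by (subst minus_mult_distrib_mat[of _ ?N ?N _ _ ?N]) (simp_all add: form_right so_star_props)
    also have "\<dots> = (-1) \<cdot>\<^sub>m (?E (so_star n p) q - ?E q (so_star n p))"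
      by (intro eq_matI) auto
    also have "?E (so_star n p) q - ?E q (so_star n p) = ?J * so_root n p q"
      unfolding so_root_def using that sp
      by (subst mult_minus_distrib_mat[of _ ?N ?N _ ?N]) (simp_all add: form_left so_star_props)
    finally show ?thesis by (simp add: so_even_carrier)
  qed
  then show "so_e n i \<in> carrier (so_even n)" "so_f n i \<in> carrier (so_even n)"
    using so_row_col_less[OF assms] by (simp_all add: so_e_root[OF assms] so_f_root[OF assms])
qed

lemma so_gens_carrier:
  "n \<ge> 3 \<Longrightarrow> g \<in> chevalley_gens {1..n} \<Longrightarrow> so_gens n g \<in> carrier (so_even n)"
  using so_e_f_carrier by (cases g) auto

lemma so_relators:
  assumes n: "n \<ge> 3" and r: "r \<in> kac_moody_relators {1..n} (cartan_D n)"
  shows "lie_eval (so_even n) (so_gens n) r = \<zero>\<^bsub>so_even n\<^esub>"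
proof -
  let ?ev = "lie_eval (so_even n) (so_gens n)" and ?N = "2 * n"
  have cancel: "(a \<cdot>\<^sub>m X) + ((- a) \<cdot>\<^sub>m X) = 0\<^sub>m ?N ?N" "((- a) \<cdot>\<^sub>m X) + (a \<cdot>\<^sub>m X) = 0\<^sub>m ?N ?N"
    if "X \<in> carrier_mat ?N ?N" for a and X :: "complex mat"
    using that by auto
  have zero: "(0::complex) \<cdot>\<^sub>m so_root n p q = 0\<^sub>m ?N ?N" for p q
    by (intro eq_matI) auto
  consider (hh) i j where "r = Br (chevalley_h i) (chevalley_h j)" "i \<in> {1..n}" "j \<in> {1..n}"
    | (ef) i j where "r = Br (Gen (E i)) (Gen (F j))" "i \<in> {1..n}" "j \<in> {1..n}" "i \<noteq> j"
    | (he) i j where "r = Add (Br (chevalley_h i) (Gen (E j))) (Scale (- of_int (cartan_D n i j)) (Gen (E j)))"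
        "i \<in> {1..n}" "j \<in> {1..n}"
    | (hf) i j where "r = Add (Br (chevalley_h i) (Gen (F j))) (Scale (of_int (cartan_D n i j)) (Gen (F j)))"
        "i \<in> {1..n}" "j \<in> {1..n}"
    | (serre_e) i j where "r = serre_term (cartan_D n) E i j" "i \<in> {1..n}" "j \<in> {1..n}" "i \<noteq> j"
    | (serre_f) i j where "r = serre_term (cartan_D n) F i j" "i \<in> {1..n}" "j \<in> {1..n}" "i \<noteq> j"
    using r unfolding kac_moody_relators_eq km_base_relators_def by blast
  then show ?thesis
  proof cases
    case hh
    note less = so_row_col_less[OF n hh(3)]
    have so_h_zero: "mat_comm (mat_comm (so_e n i) (so_f n i)) (so_root n p p) = 0\<^sub>m ?N ?N" if "p < ?N" for p
      using so_h_comm[OF n hh(2) that that] by (simp add: zero)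
    let ?H = "mat_comm (so_e n i) (so_f n i)" and ?X = "so_root n (so_row n j) (so_row n j)"
      and ?Y = "so_root n (so_col n j) (so_col n j)"
    have H: "?H \<in> carrier_mat ?N ?N"
      unfolding so_h_root[OF n hh(2)] by (simp add: minus_carrier_mat)
    have "mat_comm ?H (?X - ?Y) = (-1) \<cdot>\<^sub>m mat_comm (?X - ?Y) ?H"
      using H by (intro mat_comm_anti) (auto simp: minus_carrier_mat)
    also have "mat_comm (?X - ?Y) ?H = (-1) \<cdot>\<^sub>m mat_comm ?H ?X - (-1) \<cdot>\<^sub>m mat_comm ?H ?Y"
      using H mat_comm_anti[OF H so_root_carrier]
      by (subst mat_comm_diff_left[of _ ?N]) auto
    finally show ?thesis
      using less so_h_zero hh(1) so_h_root[OF n hh(3)] by auto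
  next
    case ef
    note less = so_row_col_less[OF n ef(2)] so_row_col_less[OF n ef(3)]
    have "mat_comm (so_root n (so_row n i) (so_col n i)) (so_root n (so_col n j) (so_row n j)) = 0\<^sub>m ?N ?N"
    proof (rule so_serre_1)
      show "so_col n i \<noteq> so_col n j" "so_row n i = so_star n (so_col n j) \<Longrightarrow> so_col n i = so_row n j"
        "so_col n i = so_star n (so_row n j) \<Longrightarrow> so_row n i = so_col n j"
        using n ef by (auto simp: so_row_def so_col_def so_star_def split: if_splits)
      show "so_col n i = so_star n (so_col n j)" if "so_row n i = so_row n j"
        using that n ef by (auto simp: so_row_def so_col_def so_star_def split: if_splits)
    qed (use less in auto)
    then show ?thesis using ef so_e_root[OF n ef(2)] so_f_root[OF n ef(3)] by simp
  next
    case he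
    note less = so_row_col_less[OF n he(3)]
    show ?thesis
      using so_h_comm[OF n he(2) less] so_coroot_root[OF n he(2,3)] so_e_root[OF n he(3)] he(1)
      by (simp add: cancel)
  next
    case hf
    note less = so_row_col_less[OF n hf(3)]
    have "so_coroot n i (so_col n j) - so_coroot n i (so_row n j) = - of_int (cartan_D n i j)"
      using so_coroot_root[OF n hf(2,3)] by (simp add: algebra_simps)
    then show ?thesis
      using so_h_comm[OF n hf(2) less(2,1)] so_f_root[OF n hf(3)] hf(1)
      by (simp add: cancel)
  next
    case serre_e
    then show ?thesis using so_serre(1)[OF n] by simp
  next
    case serre_f
    then show ?thesis using so_serre(2)[OF n] by simp
  qed
qed


text \<open>The coefficients of half the sum of the positive coroots.\<close>

definition D_height :: "nat \<Rightarrow> nat \<Rightarrow> real" where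
  "D_height n i = (if i \<le> n - 2 then real i * real n - real i * (real i + 1) / 2
    else real n * (real n - 1) / 4)"

lemma D_height_nonneg:
  assumes "n \<ge> 3" "i \<in> {1..n}"
  shows "D_height n i \<ge> 0"
proof (cases "i \<le> n - 2")
  case True
  have "real i * (real i + 1) \<le> real i * (2 * real n)"
    using assms by (intro mult_left_mono) auto
  then show ?thesis using True by (simp add: D_height_def)
qed (use assms in \<open>simp add: D_height_def\<close>)

lemma D_height_cartan:
  assumes n: "n \<ge> 3" and j: "j \<in> {1..n}"
  shows "(\<Sum>i\<in>{1..n}. D_height n i * of_int (cartan_D n i j)) = 1"
proof -
  let ?c = "D_height n"
  \<comment> \<open>One summand for the diagonal and one for each possible neighbour of
    \<open>j\<close>, each supported at a single i, so that the sum over i collapses. The inner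
    conditions say whether that neighbour exists.\<close>
  have "?c i * of_int (cartan_D n i j) = (if i = j then 2 * ?c j else 0)
      - (if i = j + 1 then if j \<le> n - 2 then ?c (j + 1) else 0 else 0)
      - (if i = j - 1 then if j \<le> n - 1 \<and> 2 \<le> j then ?c (j - 1) else 0 else 0)
      - (if i = n - 2 then if j = n then ?c (n - 2) else 0 else 0)
      - (if i = n then if j = n - 2 then ?c n else 0 else 0)" if i: "i \<in> {1..n}" for i
  proof -
    let ?P2 = "i = j + 1 \<and> j \<le> n - 2" and ?P3 = "i = j - 1 \<and> j \<le> n - 1 \<and> 2 \<le> j"
      and ?P4 = "i = n - 2 \<and> j = n" and ?P5 = "i = n \<and> j = n - 2"
    have split: "x * of_int (if P1 then 2 else if P2 \<or> P3 \<or> P4 \<or> P5 then -1 else 0) =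
        (if P1 then 2 * x else 0) - (if P2 then x else 0) - (if P3 then x else 0)
        - (if P4 then x else 0) - (if P5 then x else 0)"
      if "\<not> (P1 \<and> (P2 \<or> P3 \<or> P4 \<or> P5))" "\<not> (P2 \<and> (P3 \<or> P4 \<or> P5))"
        "\<not> (P3 \<and> (P4 \<or> P5))" "\<not> (P4 \<and> P5)" for P1 P2 P3 P4 P5 and x :: real
      using that by auto
    have adj: "j = i + 1 \<and> i \<le> n - 2 \<longleftrightarrow> ?P3" using n i j by auto
    have cartan: "cartan_D n i j = (if i = j then 2 else if ?P2 \<or> ?P3 \<or> ?P4 \<or> ?P5 then -1 else 0)"
      unfolding cartan_D_explicit[OF n i j] adj by (simp only: disj_commute disj_left_commute)
    have excl: "\<not> (i = j \<and> (?P2 \<or> ?P3 \<or> ?P4 \<or> ?P5))" "\<not> (?P2 \<and> (?P3 \<or> ?P4 \<or> ?P5))"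
        "\<not> (?P3 \<and> (?P4 \<or> ?P5))" "\<not> (?P4 \<and> ?P5)"
      using n i j by linarith+
    have "?c i * of_int (cartan_D n i j) = (if i = j then 2 * ?c i else 0) -
        (if ?P2 then ?c i else 0) - (if ?P3 then ?c i else 0) - (if ?P4 then ?c i else 0) -
        (if ?P5 then ?c i else 0)"
      unfolding cartan by (rule split[OF excl])
    moreover have "(if i = j then 2 * ?c i else 0) = (if i = j then 2 * ?c j else 0)"
      "(if ?P2 then ?c i else 0) = (if i = j + 1 then if j \<le> n - 2 then ?c (j + 1) else 0 else 0)"
      "(if ?P3 then ?c i else 0) = (if i = j - 1 then if j \<le> n - 1 \<and> 2 \<le> j then ?c (j - 1) else 0 else 0)"
      "(if ?P4 then ?c i else 0) = (if i = n - 2 then if j = n then ?c (n - 2) else 0 else 0)"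
      "(if ?P5 then ?c i else 0) = (if i = n then if j = n - 2 then ?c n else 0 else 0)"
      by simp_all
    ultimately show ?thesis by (simp only:)
  qed
  then have "(\<Sum>i\<in>{1..n}. ?c i * of_int (cartan_D n i j)) =
      (\<Sum>i\<in>{1..n}. (if i = j then 2 * ?c j else 0)
        - (if i = j + 1 then if j \<le> n - 2 then ?c (j + 1) else 0 else 0)
        - (if i = j - 1 then if j \<le> n - 1 \<and> 2 \<le> j then ?c (j - 1) else 0 else 0)
        - (if i = n - 2 then if j = n then ?c (n - 2) else 0 else 0)
        - (if i = n then if j = n - 2 then ?c n else 0 else 0))"
    by (intro sum.cong) simp_all
  also have "\<dots> = 2 * ?c j - (if j \<le> n - 2 then ?c (j + 1) else 0)
      - (if j \<le> n - 1 \<and> 2 \<le> j then ?c (j - 1) else 0)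
      - (if j = n then ?c (n - 2) else 0) - (if j = n - 2 then ?c n else 0)"
  proof -
    have delta: "(\<Sum>i\<in>{1..n}. if i = k then x else 0) = (if k \<in> {1..n} then x else 0)" for k and x :: real
      by simp
    have "j \<in> {1..n}" "n - 2 \<in> {1..n}" "n \<in> {1..n}"
      "j \<le> n - 2 \<Longrightarrow> j + 1 \<in> {1..n}" "j \<le> n - 1 \<Longrightarrow> 2 \<le> j \<Longrightarrow> j - 1 \<in> {1..n}"
      using n j by auto
    then show ?thesis
      unfolding sum_subtractf delta by presburger
  qed
  also have "\<dots> = 1"
  proof -
    obtain m where m: "n = m + 3" using n by (metis add.commute le_Suc_ex)
    have low: "?c i = real i * (real m + 3) - real i * (real i + 1) / 2" if "i \<le> m + 1" for i
      using that by (simp add: D_height_def m)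
    have high: "?c i = (real m + 3) * (real m + 2) / 4" if "i > m + 1" for i
      using that by (simp add: D_height_def m)
    \<comment> \<open>The two end nodes of the fork, the branch node, and the rest of the chain. In
      the last two cases \<open>j\<close> can be node 1, which has no left neighbour; this accounts
      for the splits at 0.\<close>
    consider "j = m + 3" | "j = m + 2" | "j = m + 1" | k where "j = Suc k" "k < m"
      using j m by (cases j) (auto, fastforce)
    then show ?thesis
    proof cases
      case 1
      then have "?c j = (real m + 3) * (real m + 2) / 4" "?c (n - 2) = (real m + 1) * (real m + 3) - (real m + 1) * (real m + 2) / 2"
        using high[of j] low[of "m + 1"] by (simp_all add: m algebra_simps)
      then show ?thesis using 1 by (simp add: m) (simp add: field_simps)
    next
      case 2
      then have "?c j = (real m + 3) * (real m + 2) / 4" "?c (j - 1) = (real m + 1) * (real m + 3) - (real m + 1) * (real m + 2) / 2"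
        using high[of j] low[of "m + 1"] by (simp_all add: algebra_simps)
      then show ?thesis using 2 by (simp add: m) (simp add: field_simps)
    next
      case 3
      have "?c n = (real m + 3) * (real m + 2) / 4" "?c (j + 1) = (real m + 3) * (real m + 2) / 4"
          "?c j = (real m + 1) * (real m + 3) - (real m + 1) * (real m + 2) / 2"
          "(if 2 \<le> j then ?c (j - 1) else 0) = real m * (real m + 3) - real m * (real m + 1) / 2"
        using 3 high[of n] high[of "j + 1"] low[of "m + 1"] low[of m]
        by (cases "m = 0"; simp add: m Suc_le_eq algebra_simps)+
      then show ?thesis using 3 by (cases "m = 0") (simp_all add: m Suc_le_eq, simp_all add: field_simps)
    next
      case 4
      have "?c j = real j * (real m + 3) - real j * (real j + 1) / 2"
        "?c (j + 1) = (real j + 1) * (real m + 3) - (real j + 1) * (real j + 2) / 2"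
        "(if 2 \<le> j then ?c (j - 1) else 0) = (real j - 1) * (real m + 3) - (real j - 1) * real j / 2"
        using 4 low[of j] low[of "j + 1"] low[of k]
        by (cases "k = 0"; simp add: Suc_le_eq algebra_simps)+
      then show ?thesis using 4 by (cases "k = 0") (simp_all add: m Suc_le_eq, simp_all add: field_simps)
    qed
  qed
  finally show ?thesis .
qed

section \<open>Faithfulness of the matrix representation in type D\<close>

lemma so_h_entry:
  assumes "n \<ge> 3" "i \<in> {1..n}" "p < n"
  shows "mat_comm (so_e n i) (so_f n i) $$ (p, p) = so_coroot n i p"
proof -
  have "so_root n q q $$ (p, p) = so_sign n q p" if "q < 2 * n" for q
    using assms(3) that by (auto simp: so_root_def elem_mat_index so_sign_def so_star_def)
  then show ?thesis
    using assms(3) so_row_col_less[OF assms(1,2)]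
    unfolding so_h_root[OF assms(1,2)] so_coroot_def by simp
qed

text \<open>The first n diagonal entries suffice. Read from the top they give r 1 = 0, then each
  coefficient up to n - 2 from its predecessor; the last two entries yield r (n - 1) + r n = 0 and r
  n = r (n - 1).\<close>

lemma so_coroots_independent:
  fixes r :: "nat \<Rightarrow> complex"
  assumes n: "n \<ge> 3" and r: "\<And>p. p < n \<Longrightarrow> (\<Sum>i\<in>{1..n}. r i * so_coroot n i p) = 0" and "i \<in> {1..n}"
  shows "r i = 0"
proof -
  have eq: "(if p + 1 < n then r (p + 1) else 0) - (if 1 \<le> p then r p else 0) +
      (if p = n - 2 \<or> p = n - 1 then r n else 0) = 0" if p: "p < n" for p
  proof -
    have "r i * so_coroot n i p = (if i = p + 1 then if p + 1 < n then r (p + 1) else 0 else 0)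
        - (if i = p then r p else 0) + (if i = n then if p = n - 2 \<or> p = n - 1 then r n else 0 else 0)"
      if "i \<in> {1..n}" for i
      unfolding so_coroot_low[OF n that p] using that p by auto
    then have "(\<Sum>i\<in>{1..n}. r i * so_coroot n i p) = (if p + 1 < n then r (p + 1) else 0)
        - (if 1 \<le> p then r p else 0) + (if p = n - 2 \<or> p = n - 1 then r n else 0)"
      using p by (simp add: sum.distrib sum_subtractf)
    then show ?thesis using r[OF p] by simp
  qed
  have low: "r p = 0" if "1 \<le> p" "p \<le> n - 2" for p
    using that
  proof (induction p)
    case (Suc p)
    have "p < n" "p + 1 < n" "p \<noteq> n - 2" "p \<noteq> n - 1" using Suc.prems n by auto
    then show ?case using eq[of p] Suc by (cases "p = 0") auto
  qed simp
  have "n - 2 < n" "n - 1 < n" "n - 2 + 1 = n - 1" "1 \<le> n - 2" "r (n - 2) = 0"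
    using n low[of "n - 2"] by auto
  then have "r (n - 1) + r n = 0"
    using eq[of "n - 2"] by (simp only: simp_thms if_True diff_zero)
  moreover have "r n = r (n - 1)" using eq[of "n - 1"] n by auto
  ultimately have "r n = 0" "r (n - 1) = 0" by auto
  then show ?thesis using low[of i] assms(3) by (cases "i = n \<or> i = n - 1") auto
qed

text \<open>The kernel of the evaluation is an ideal, and it meets the span of the coroots trivially
  because their matrices are independent, so \<open>ideal_eq_0\<close> applies.\<close>

theorem so_faithful:
  fixes n :: nat
  defines "X \<equiv> chevalley_gens {1..n}" and "R \<equiv> kac_moody_relators {1..n} (cartan_D n)"
  assumes n: "n \<ge> 3" and t: "t \<in> lie_terms X" "lie_eval (so_even n) (so_gens n) t = \<zero>\<^bsub>so_even n\<^esub>"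
  shows "(t, Zero) \<in> lie_rel X R"
proof -
  let ?I = "{1..n}" and ?ev = "lie_eval (so_even n) (so_gens n)" and ?\<iota> = "lie_emb X R"
  let ?e = "\<lambda>i. ?\<iota> (Gen (E i))" and ?f = "\<lambda>i. ?\<iota> (Gen (F i))"
  interpret km_serre ?I "cartan_D n" ?e ?f
    unfolding X_def R_def by (rule km_serre_presented[OF gcm_cartan_D])
  have gens: "so_gens n g \<in> carrier (so_even n)" if "g \<in> X" for g
    using so_gens_carrier[OF n] that by (simp add: X_def)
  have closed: "?ev s \<in> carrier_mat (2 * n) (2 * n)" if "s \<in> lie_terms X" for s
    using lie_eval_closed[OF lie_algebra_so_even gens that] by (rule so_even_carrier_mat)
  have sound: "?ev s = ?ev s'" if "(s, s') \<in> lie_rel X R" for s s'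
    by (rule lie_eval_sound[of "so_even n" X "so_gens n" R])
      (use lie_algebra_so_even gens so_relators[OF n] that in \<open>auto simp: R_def\<close>)
  define K where "K = {?\<iota> s | s. s \<in> lie_terms X \<and> ?ev s = 0\<^sub>m (2 * n) (2 * n)}"
  have KI: "?\<iota> s \<in> K" if "s \<in> lie_terms X" "?ev s = 0\<^sub>m (2 * n) (2 * n)" for s
    using that unfolding K_def by blast
  have sub: "cl.subspace K"
  proof (rule cl.subspaceI)
    show "0 \<in> K" using KI[of Zero] by (simp add: lie_emb_Zero)
  next
    fix x y assume "x \<in> K" "y \<in> K"
    then obtain s s' where "x = ?\<iota> s" "s \<in> lie_terms X" "?ev s = 0\<^sub>m (2 * n) (2 * n)"
      "y = ?\<iota> s'" "s' \<in> lie_terms X" "?ev s' = 0\<^sub>m (2 * n) (2 * n)" unfolding K_def by blast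
    then show "x + y \<in> K" using KI[of "Add s s'"] by (simp add: lie_emb_Add)
  next
    fix c x assume "x \<in> K"
    then obtain s where "x = ?\<iota> s" "s \<in> lie_terms X" "?ev s = 0\<^sub>m (2 * n) (2 * n)"
      unfolding K_def by blast
    then show "c *\<^sub>L x \<in> K" using KI[of "Scale c s"] by (simp add: lie_emb_Scale)
  qed
  have ideal: "\<lblot>?\<iota> (Gen g), x\<rblot> \<in> K" if g: "g \<in> X" and "x \<in> K" for g x
  proof -
    obtain s where s: "x = ?\<iota> s" "s \<in> lie_terms X" "?ev s = 0\<^sub>m (2 * n) (2 * n)"
      using \<open>x \<in> K\<close> unfolding K_def by blast
    have "?ev (Br (Gen g) s) = 0\<^sub>m (2 * n) (2 * n)"
      using s(3) mat_comm_zero[OF closed[of "Gen g"]] g by simp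
    then show ?thesis using KI[of "Br (Gen g) s"] s g by (simp add: lie_emb_Br)
  qed
  have cartan: "x = 0" if x: "x \<in> K" "x \<in> cl.span ((\<lambda>k. \<lblot>?e k, ?f k\<rblot>) ` ?I)" for x
  proof -
    \<comment> \<open>A combination of coroots is lifted to a term, so that its image in the
      presented algebra and its matrix can be compared.\<close>
    define T where "T r = foldr (\<lambda>i. Add (Scale (r i) (chevalley_h i))) [1..<Suc n] Zero" for r
    have T: "T r \<in> lie_terms X \<and> ?\<iota> (T r) = (\<Sum>i\<in>?I. r i *\<^sub>L \<lblot>?e i, ?f i\<rblot>) \<and>
        (\<forall>p<n. ?ev (T r) $$ (p, p) = (\<Sum>i\<in>?I. r i * so_coroot n i p))" for r
    proof -
      have "foldr (\<lambda>i. Add (Scale (r i) (chevalley_h i))) is Zero \<in> lie_terms X \<and>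
          ?\<iota> (foldr (\<lambda>i. Add (Scale (r i) (chevalley_h i))) is Zero) = (\<Sum>i\<in>set is. r i *\<^sub>L \<lblot>?e i, ?f i\<rblot>) \<and>
          (\<forall>p<n. ?ev (foldr (\<lambda>i. Add (Scale (r i) (chevalley_h i))) is Zero) $$ (p, p) =
            (\<Sum>i\<in>set is. r i * so_coroot n i p))" if "distinct is" "set is \<subseteq> ?I" for "is"
        using that
      proof (induction "is")
        case (Cons i "is")
        then have i: "i \<in> ?I" by simp
        let ?t = "foldr (\<lambda>i. Add (Scale (r i) (chevalley_h i))) is Zero"
        have "?ev (chevalley_h i) \<in> carrier_mat (2 * n) (2 * n)" "?ev ?t \<in> carrier_mat (2 * n) (2 * n)"
          using closed[of "chevalley_h i"] closed[of ?t] Cons i by (auto simp: X_def)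
        then show ?case
          using Cons so_h_entry[OF n i] i
          by (auto simp: X_def lie_emb_Add lie_emb_Scale lie_emb_Br)
      qed (simp add: lie_emb_Zero)
      from this[of "[1..<Suc n]"] show ?thesis
        unfolding T_def by (simp add: atLeastLessThanSuc_atLeastAtMost del: upt_Suc)
    qed
    have "\<exists>r. x = (\<Sum>i\<in>?I. r i *\<^sub>L \<lblot>?e i, ?f i\<rblot>)"
      using x(2)
    proof (induction rule: cl.span_induct_alt)
      case base
      then show ?case by (intro exI[of _ "\<lambda>_. 0"]) simp
    next
      case (step c y z)
      then obtain k r where kr: "k \<in> ?I" "y = \<lblot>?e k, ?f k\<rblot>" "z = (\<Sum>i\<in>?I. r i *\<^sub>L \<lblot>?e i, ?f i\<rblot>)" by blast
      have "(\<Sum>i\<in>?I. ((if i = k then c else 0) + r i) *\<^sub>L \<lblot>?e i, ?f i\<rblot>) =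
          (\<Sum>i\<in>?I. if i = k then c *\<^sub>L \<lblot>?e i, ?f i\<rblot> else 0) + z"
        unfolding kr(3) sum.distrib[symmetric] by (intro sum.cong) (auto simp: scl_add_left)
      also have "\<dots> = c *\<^sub>L y + z" using kr(1,2) by simp
      finally show ?case by (metis (no_types))
    qed
    then obtain r where r: "x = ?\<iota> (T r)" using T by metis
    obtain s where s: "x = ?\<iota> s" "s \<in> lie_terms X" "?ev s = 0\<^sub>m (2 * n) (2 * n)"
      using x(1) unfolding K_def by blast
    have "(T r, s) \<in> lie_rel X R" using r s T[of r] by (simp add: lie_emb_eq_iff[symmetric])
    then have "?ev (T r) = 0\<^sub>m (2 * n) (2 * n)" using sound s(3) by simp
    then have "(\<Sum>i\<in>?I. r i * so_coroot n i p) = 0" if "p < n" for p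
      using T[of r] that by simp
    then have "r i = 0" if "i \<in> ?I" for i using so_coroots_independent[OF n _ that, of r] by blast
    then show ?thesis using r T[of r] by simp
  qed
  have tri: "?\<iota> t \<in> triangular"
    using lie_val_triangular[of "\<lambda>g. ?\<iota> (Gen g)" t] t(1) lie_emb_val[OF t(1), of R] by (simp add: X_def)
  have "?\<iota> t = 0"
  proof (rule ideal_eq_0[where K = K and c = "D_height n"])
    show "\<lblot>?e i, x\<rblot> \<in> K" "\<lblot>?f i, x\<rblot> \<in> K" if "i \<in> ?I" "x \<in> K" for i x
      using ideal that by (simp_all add: X_def)
    show "?\<iota> t \<in> K" using t by (intro KI) auto
  qed (fact sub cartan tri D_height_nonneg[OF n] D_height_cartan[OF n] finite_atLeastAtMost)+
  then show ?thesis using t(1) by (simp add: lie_emb_eq_0_iff)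
qed

text \<open>The map is the composite of the shifted map into the Kac-Moody algebra with the
  evaluation in matrices; \<open>so_faithful\<close> and \<open>shifted_injective\<close> take a
  vanishing matrix back to a term congruent to \<open>Zero\<close>.\<close>

lemma D_injective_hom_so:
  fixes n :: nat and b :: "nat \<Rightarrow> nat \<Rightarrow> complex"
  defines "I \<equiv> {1..n}" and "A \<equiv> cartan_D n"
  assumes n: "n \<ge> 3" and b: "edge_parameters I A b"
  shows "defines_injective_hom (electrical I A b) (elec_u I A b) I (so_even n)
    (\<lambda>i. if i = 1 then so_e n 1
      else if i \<le> n - 2 then so_e n i \<oplus>\<^bsub>so_even n\<^esub> b (i - 1) i \<odot>\<^bsub>so_even n\<^esub> so_f n (i - 1)
      else so_e n i \<oplus>\<^bsub>so_even n\<^esub> b (n - 2) i \<odot>\<^bsub>so_even n\<^esub> so_f n (n - 2))"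
proof -
  let ?c = "\<lambda>i. if i = 1 then 0 else b (D_parent n i) i" and ?p = "D_parent n"
  let ?\<phi> = "lie_subst (shifted_gen ?c ?p)" and ?ev = "lie_eval (so_even n) (so_gens n)"
  let ?X = "chevalley_gens I" and ?R = "kac_moody_relators I A"
  have mem: "shifted_gen ?c ?p i \<in> lie_terms ?X" if "i \<in> I" for i
    using that D_parent_mem[OF n, of i] by (simp add: I_def)
  have gens: "so_gens n g \<in> carrier (so_even n)" if "g \<in> ?X" for g
    using so_gens_carrier[OF n] that by (simp add: I_def)
  have rel: "(?\<phi> r, Zero) \<in> lie_rel ?X ?R" if "r \<in> electrical_relators I A b" "r \<in> lie_terms I" for r
    using D_relators_vanish[OF n b[unfolded I_def A_def]] that by (simp add: I_def A_def)
  have "defines_injective_hom (electrical I A b) (elec_u I A b) I (so_even n)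
      (\<lambda>i. ?ev (shifted_gen ?c ?p i))"
    unfolding electrical_def elec_u_def
  proof (rule defines_injective_homI[OF lie_algebra_so_even])
    show "?ev (shifted_gen ?c ?p i) \<in> carrier (so_even n)" if "i \<in> I" for i
      using lie_eval_closed[OF lie_algebra_so_even gens mem[OF that]] .
    show "lie_eval (so_even n) (\<lambda>i. ?ev (shifted_gen ?c ?p i)) r = \<zero>\<^bsub>so_even n\<^esub>"
      if "r \<in> electrical_relators I A b" "r \<in> lie_terms I" for r
    proof -
      have "?ev (?\<phi> r) = ?ev Zero"
        by (rule lie_eval_sound[of "so_even n" ?X "so_gens n" ?R])
          (use lie_algebra_so_even gens so_relators[OF n] rel[OF that] in \<open>auto simp: I_def A_def\<close>)
      then show ?thesis by (simp add: lie_eval_subst)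
    qed
    show "(t, Zero) \<in> lie_rel I (electrical_relators I A b)"
      if t: "t \<in> lie_terms I" "lie_eval (so_even n) (\<lambda>i. ?ev (shifted_gen ?c ?p i)) t = \<zero>\<^bsub>so_even n\<^esub>" for t
    proof -
      have "?ev (?\<phi> t) = \<zero>\<^bsub>so_even n\<^esub>" using t(2) by (simp add: lie_eval_subst)
      then have "(?\<phi> t, Zero) \<in> lie_rel ?X ?R"
        using so_faithful[OF n] lie_subst_in_lie_terms[OF t(1) mem] by (simp add: I_def A_def)
      then show ?thesis
        using shifted_injective[of I A ?p b ?c t] gcm_cartan_D[of n] D_parent_mem[OF n] rel t(1)
        by (simp add: I_def A_def)
    qed
  qed
  then show ?thesis
  proof (rule defines_injective_hom_cong[rotated])
    fix i assume i: "i \<in> I"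
    have "so_e n 1 + 0 \<cdot>\<^sub>m so_f n 1 = so_e n 1"
      using so_e_f_carrier[OF n, of 1] n by (auto dest!: so_even_carrier_mat)
    then show "?ev (shifted_gen ?c ?p i) = (if i = 1 then so_e n 1
      else if i \<le> n - 2 then so_e n i \<oplus>\<^bsub>so_even n\<^esub> b (i - 1) i \<odot>\<^bsub>so_even n\<^esub> so_f n (i - 1)
      else so_e n i \<oplus>\<^bsub>so_even n\<^esub> b (n - 2) i \<odot>\<^bsub>so_even n\<^esub> so_f n (n - 2))"
      by (simp add: D_parent_def)
  qed
qed

theorem theorem1p10:
  "(\<forall>(A :: nat \<Rightarrow> nat \<Rightarrow> int) (a1 :: complex) (a2 :: complex) (b :: nat \<Rightarrow> nat \<Rightarrow> complex).
      generalized_cartan_matrix {1, 2} A \<and> A 2 1 \<le> -2 \<and>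
      b 1 2 = of_int (A 2 1) * a1 * a2 \<and> b 2 1 = b 1 2 \<longrightarrow>
      (let I = {1, 2}; g = kac_moody I A in
        defines_injective_hom (electrical I A b) (elec_u I A b) I g
          (\<lambda>i. if i = 1 then km_e I A 1
               else km_e I A 2 \<oplus>\<^bsub>g\<^esub> b 1 2 \<odot>\<^bsub>g\<^esub> km_f I A 1)))
   \<and>
   (\<forall>(n :: nat) (b :: nat \<Rightarrow> nat \<Rightarrow> complex).
      n \<ge> 3 \<and> edge_parameters {1..n} (cartan_D n) b \<longrightarrow>
      (let I = {1..n}; A = cartan_D n; g = so_even n; e = so_e n; f = so_f n in
        defines_injective_hom (electrical I A b) (elec_u I A b) I g
          (\<lambda>i. if i = 1 then e 1
               else if i \<le> n - 2 then e i \<oplus>\<^bsub>g\<^esub> b (i - 1) i \<odot>\<^bsub>g\<^esub> f (i - 1)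
               else e i \<oplus>\<^bsub>g\<^esub> b (n - 2) i \<odot>\<^bsub>g\<^esub> f (n - 2))) \<and>
      (let I = {1..n}; A = cartan_D n; g = kac_moody I A; e = km_e I A; f = km_f I A in
        defines_injective_hom (electrical I A b) (elec_u I A b) I g
          (\<lambda>i. if i = 1 then e 1
               else if i \<le> n - 2 then e i \<oplus>\<^bsub>g\<^esub> b (i - 1) i \<odot>\<^bsub>g\<^esub> f (i - 1)
               else e i \<oplus>\<^bsub>g\<^esub> b (n - 2) i \<odot>\<^bsub>g\<^esub> f (n - 2))))
   \<and>
   (\<forall>(n :: nat) (b :: nat \<Rightarrow> nat \<Rightarrow> complex).
      n \<ge> 2 \<and> edge_parameters {0..<n} (cartan_affine_A n) b \<and>
      (\<forall>i\<in>{0..<n}. \<forall>j\<in>{0..<n}. cartan_affine_A n i j \<noteq> -1 \<longrightarrow> b i j = 0) \<longrightarrow>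
      (let I = {0..<n}; A = cartan_affine_A n; g = kac_moody I A; e = km_e I A; f = km_f I A in
        defines_injective_hom (electrical I A b) (elec_u I A b) I g
          (\<lambda>i. e i \<oplus>\<^bsub>g\<^esub> b ((i + n - 1) mod n) i \<odot>\<^bsub>g\<^esub> f ((i + n - 1) mod n))))"
proof (intro conjI allI impI)
  fix A :: "nat \<Rightarrow> nat \<Rightarrow> int" and a1 a2 :: complex and b :: "nat \<Rightarrow> nat \<Rightarrow> complex"
  assume "generalized_cartan_matrix {1, 2} A \<and> A 2 1 \<le> -2 \<and>
    b 1 2 = of_int (A 2 1) * a1 * a2 \<and> b 2 1 = b 1 2"
  then show "let I = {1, 2}; g = kac_moody I A in
      defines_injective_hom (electrical I A b) (elec_u I A b) I g
        (\<lambda>i. if i = 1 then km_e I A 1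
             else km_e I A 2 \<oplus>\<^bsub>g\<^esub> b 1 2 \<odot>\<^bsub>g\<^esub> km_f I A 1)"
    unfolding Let_def by (intro rank2_injective_hom) simp_all
next
  fix n :: nat and b :: "nat \<Rightarrow> nat \<Rightarrow> complex"
  assume "n \<ge> 3 \<and> edge_parameters {1..n} (cartan_D n) b"
  then show "let I = {1..n}; A = cartan_D n; g = so_even n; e = so_e n; f = so_f n in
        defines_injective_hom (electrical I A b) (elec_u I A b) I g
          (\<lambda>i. if i = 1 then e 1
               else if i \<le> n - 2 then e i \<oplus>\<^bsub>g\<^esub> b (i - 1) i \<odot>\<^bsub>g\<^esub> f (i - 1)
               else e i \<oplus>\<^bsub>g\<^esub> b (n - 2) i \<odot>\<^bsub>g\<^esub> f (n - 2))"
    unfolding Let_def by (elim conjE) (rule D_injective_hom_so)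
next
  fix n :: nat and b :: "nat \<Rightarrow> nat \<Rightarrow> complex"
  assume "n \<ge> 3 \<and> edge_parameters {1..n} (cartan_D n) b"
  then show "let I = {1..n}; A = cartan_D n; g = kac_moody I A; e = km_e I A; f = km_f I A in
        defines_injective_hom (electrical I A b) (elec_u I A b) I g
          (\<lambda>i. if i = 1 then e 1
               else if i \<le> n - 2 then e i \<oplus>\<^bsub>g\<^esub> b (i - 1) i \<odot>\<^bsub>g\<^esub> f (i - 1)
               else e i \<oplus>\<^bsub>g\<^esub> b (n - 2) i \<odot>\<^bsub>g\<^esub> f (n - 2))"
    unfolding Let_def by (elim conjE) (rule D_injective_hom_kac_moody)
next
  fix n :: nat and b :: "nat \<Rightarrow> nat \<Rightarrow> complex"
  assume "n \<ge> 2 \<and> edge_parameters {0..<n} (cartan_affine_A n) b \<and>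
      (\<forall>i\<in>{0..<n}. \<forall>j\<in>{0..<n}. cartan_affine_A n i j \<noteq> -1 \<longrightarrow> b i j = 0)"
  then show "let I = {0..<n}; A = cartan_affine_A n; g = kac_moody I A; e = km_e I A; f = km_f I A in
        defines_injective_hom (electrical I A b) (elec_u I A b) I g
          (\<lambda>i. e i \<oplus>\<^bsub>g\<^esub> b ((i + n - 1) mod n) i \<odot>\<^bsub>g\<^esub> f ((i + n - 1) mod n))"
    unfolding Let_def by (elim conjE) (rule affine_A_injective_hom; blast)
qed

end
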